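(* Let $(R,\mathfrak m)$ be a Noetherian local ring of dimension $d\ge 1$. Let $S/R$ be a finite cover such that at least one of the following two conditions holds: (i) $S/R$ is of finite length; or (ii) $S/R$ is birational. Let $I$ be an $\mathfrak m$-primary ideal of $R$, and let $\mathcal B=\{\mathcal B_n\}_{n\ge 0}$ be a filtration of ideals of $R$ such that $\mathcal B$ is $I$-admissible and $R\cap I^nS\subseteq \mathcal B_n$ for all $n\gg 0$. Then $e_1(\mathcal B)\ge e_1(I,S)$.
   Context: A finite cover $S/R$ is a (commutative) ring extension $R\subseteq S$ such that $S$ is a finite $R$-module. It is birational if $R$ is reduced and $S$ is contained in the total quotient ring of $R$; it is of finite length if the $R$-module $S/R$ has finite length. $\lambda$ denotes length as an $R$-module. A filtration of ideals of $R$ is a decreasing sequence $R=\mathcal B_0\supseteq \mathcal B_1\supseteq\cdots$ of ideals with $\mathcal B_i\mathcal B_j\subseteq\mathcal B_{i+j}$. It is $I$-admissible if there is an integer $k\ge 0$ with $\mathcal B_{n+k}\subseteq I^n\subseteq \mathcal B_n$ for every $n\ge 0$. For a nonzero $P\in\mathbb Q[X]$ of degree $d$ with $P(n)\in\mathbb Z$ for $n\gg 0$, write $P=\sum_{i=0}^d(-1)^ie_i(P)\binom{X+d-i}{d-i}$ with $e_i(P)\in\mathbb Z$. For an $I$-admissible filtration $\mathcal B$, the function $n\mapsto\lambda(R/\mathcal B_{n+1})$ agrees for $n\gg0$ with a polynomial $P_{\mathcal B}$, and $e_1(\mathcal B):=e_1(P_{\mathcal B})$. The function $n\mapsto \lambda(S/I^{n+1}S)$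 agrees for $n\gg 0$ with a polynomial $P_{I,S}$, and $e_1(I,S):=e_1(P_{I,S})$. *)

theory Defs
  imports "HOL-Computational_Algebra.Polynomial" "HOL-Library.Extended_Nat"
    "HOL-Algebra.Ring_Divisibility" "HOL-Algebra.Ideal_Product" "HOL-Algebra.QuotRing"
    "HOL-Algebra.Module"
begin

section \<open>Modules: quotients, finite generation, length\<close>

text \<open>The ring \<open>S\<close> as a module over any subring, acting by multiplication. The ring of scalars
  is not part of the record; it is supplied to \<^const>\<open>module\<close>, \<^const>\<open>submodule\<close> etc.\<close>

definition ring_as_module :: "('a, 'b) ring_scheme \<Rightarrow> ('a, 'a) module" where
  "ring_as_module S =
    \<lparr>carrier = carrier S, mult = mult S, one = one S, zero = zero S, add = add S, smult = mult S\<rparr>"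

text \<open>The ring fields \<^const>\<open>mult\<close> and \<^const>\<open>one\<close> of a module record play no role in the
  locale \<^locale>\<open>module\<close>, so they are left unspecified.\<close>

definition quot_module :: "('r, 'a, 'm) module_scheme \<Rightarrow> 'a set \<Rightarrow> ('r, 'a set) module" where
  "quot_module M N =
    \<lparr>carrier = a_rcosets\<^bsub>M\<^esub> N, mult = undefined, one = undefined, zero = N, add = set_add M,
     smult = (\<lambda>r X. \<Union>x\<in>X. N +>\<^bsub>M\<^esub> (r \<odot>\<^bsub>M\<^esub> x))\<rparr>"

lemma module_quot_module:
  assumes "module R M" "submodule N R M" shows "module R (quot_module M N)"
proof -
  interpret module R M by fact
  interpret N: abelian_subgroup N M
    using assms(2) M.abelian_group_axioms by (intro abelian_subgroupI3 additive_subgroupI) (auto simp: submodule_def)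
  interpret sm: submodule N R M by fact
  have carrD: "\<exists>x\<in>carrier M. X = N +>\<^bsub>M\<^esub> x" if "X \<in> a_rcosets\<^bsub>M\<^esub> N" for X
    using that by (auto simp: A_RCOSETS_def' a_r_coset_def')
  have coset_in: "N +>\<^bsub>M\<^esub> x \<in> a_rcosets\<^bsub>M\<^esub> N" if "x \<in> carrier M" for x
    using that by (simp add: M.a_rcosetsI N.a_subset)
  have sm: "(\<Union>y\<in>N +>\<^bsub>M\<^esub> x. N +>\<^bsub>M\<^esub> (r \<odot>\<^bsub>M\<^esub> y)) = N +>\<^bsub>M\<^esub> (r \<odot>\<^bsub>M\<^esub> x)"
    if "r \<in> carrier R" "x \<in> carrier M" for r x
  proof -
    have "N +>\<^bsub>M\<^esub> (r \<odot>\<^bsub>M\<^esub> y) = N +>\<^bsub>M\<^esub> (r \<odot>\<^bsub>M\<^esub> x)" if y: "y \<in> N +>\<^bsub>M\<^esub> x" for y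
    proof -
      obtain n where n: "n \<in> N" "y = n \<oplus>\<^bsub>M\<^esub> x"
        using y by (auto simp: a_r_coset_def')
      have "r \<odot>\<^bsub>M\<^esub> y = (r \<odot>\<^bsub>M\<^esub> n) \<oplus>\<^bsub>M\<^esub> (r \<odot>\<^bsub>M\<^esub> x)"
        using n \<open>r \<in> carrier R\<close> \<open>x \<in> carrier M\<close> N.a_Hcarr by (simp add: smult_r_distr)
      moreover have "r \<odot>\<^bsub>M\<^esub> n \<in> N" using n \<open>r \<in> carrier R\<close> by simp
      ultimately have "r \<odot>\<^bsub>M\<^esub> y \<in> N +>\<^bsub>M\<^esub> (r \<odot>\<^bsub>M\<^esub> x)"
        by (auto simp: a_r_coset_def')
      then show ?thesis using M.a_repr_independence[of "r \<odot>\<^bsub>M\<^esub> y" N "r \<odot>\<^bsub>M\<^esub> x"] N.a_subgroup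
          \<open>r \<in> carrier R\<close> \<open>x \<in> carrier M\<close> by simp
    qed
    moreover have "x \<in> N +>\<^bsub>M\<^esub> x" using N.a_rcos_self \<open>x \<in> carrier M\<close> by simp
    ultimately show ?thesis by blast
  qed
  have add: "(N +>\<^bsub>M\<^esub> x) <+>\<^bsub>M\<^esub> (N +>\<^bsub>M\<^esub> y) = N +>\<^bsub>M\<^esub> (x \<oplus>\<^bsub>M\<^esub> y)"
    if "x \<in> carrier M" "y \<in> carrier M" for x y
    using that by (rule N.a_rcos_sum)
  have ag: "abelian_group (quot_module M N)"
  proof (rule abelian_groupI)
    fix X assume "X \<in> carrier (quot_module M N)"
    then obtain x where x: "x \<in> carrier M" "X = N +>\<^bsub>M\<^esub> x"
      using carrD by (auto simp: quot_module_def)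
    have "(N +>\<^bsub>M\<^esub> (\<ominus>\<^bsub>M\<^esub> x)) \<oplus>\<^bsub>quot_module M N\<^esub> X = N"
      using x by (simp add: quot_module_def add M.l_neg M.a_coset_add_zero N.a_subset)
    then show "\<exists>Y\<in>carrier (quot_module M N). Y \<oplus>\<^bsub>quot_module M N\<^esub> X = \<zero>\<^bsub>quot_module M N\<^esub>"
      using x coset_in[of "\<ominus>\<^bsub>M\<^esub> x"] by (auto simp: quot_module_def)
    have "(N +>\<^bsub>M\<^esub> \<zero>\<^bsub>M\<^esub>) <+>\<^bsub>M\<^esub> (N +>\<^bsub>M\<^esub> x) = N +>\<^bsub>M\<^esub> x"
      using x(1) by (simp add: add)
    then show "\<zero>\<^bsub>quot_module M N\<^esub> \<oplus>\<^bsub>quot_module M N\<^esub> X = X"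
      using x by (simp add: quot_module_def M.a_coset_add_zero N.a_subset)
  next
    show "\<zero>\<^bsub>quot_module M N\<^esub> \<in> carrier (quot_module M N)"
      using coset_in[of "\<zero>\<^bsub>M\<^esub>"] by (simp add: quot_module_def M.a_coset_add_zero N.a_subset)
  qed (auto simp: quot_module_def add coset_in M.a_ac dest!: carrD)
  let ?Q = "quot_module M N"
  have addQ: "(N +>\<^bsub>M\<^esub> x) \<oplus>\<^bsub>?Q\<^esub> (N +>\<^bsub>M\<^esub> y) = N +>\<^bsub>M\<^esub> (x \<oplus>\<^bsub>M\<^esub> y)"
    if "x \<in> carrier M" "y \<in> carrier M" for x y
    using that by (simp add: quot_module_def add)
  have smQ: "r \<odot>\<^bsub>?Q\<^esub> (N +>\<^bsub>M\<^esub> x) = N +>\<^bsub>M\<^esub> (r \<odot>\<^bsub>M\<^esub> x)"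
    if "r \<in> carrier R" "x \<in> carrier M" for r x
    using sm[OF that] by (simp add: quot_module_def)
  have carrQ: "carrier ?Q = (\<lambda>x. N +>\<^bsub>M\<^esub> x) ` carrier M"
    using coset_in carrD by (auto simp: quot_module_def)
  show ?thesis
    by (intro moduleI R.is_cring ag)
       (auto simp: carrQ addQ smQ smult_l_distr smult_r_distr smult_assoc1)
qed

definition finite_module :: "('r, 'b) ring_scheme \<Rightarrow> ('r, 'a, 'm) module_scheme \<Rightarrow> bool" where
  "finite_module R M \<longleftrightarrow> module R M \<and>
    (\<exists>A \<subseteq> carrier M. finite A \<and>
      (\<forall>x \<in> carrier M. \<exists>c \<in> A \<rightarrow> carrier R. x = (\<Oplus>\<^bsub>M\<^esub>a\<in>A. c a \<odot>\<^bsub>M\<^esub> a)))"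

definition module_length :: "('r, 'b) ring_scheme \<Rightarrow> ('r, 'a, 'm) module_scheme \<Rightarrow> enat" where
  "module_length R M = Sup {enat n | n. \<exists>N :: nat \<Rightarrow> 'a set.
    (\<forall>i\<le>n. submodule (N i) R M) \<and> (\<forall>i<n. N i \<subset> N (Suc i))}"

definition finite_length :: "('r, 'b) ring_scheme \<Rightarrow> ('r, 'a, 'm) module_scheme \<Rightarrow> bool" where
  "finite_length R M \<longleftrightarrow> module_length R M < \<infinity>"


section \<open>Noetherian local rings and primary ideals\<close>

definition noetherian_local_ring :: "('a, 'b) ring_scheme \<Rightarrow> 'a set \<Rightarrow> bool" where
  "noetherian_local_ring R m \<longleftrightarrow> cring R \<and> noetherian_ring R \<and>
    maximalideal m R \<and> (\<forall>m'. maximalideal m' R \<longrightarrow> m' = m)"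

definition krull_dim :: "('a, 'b) ring_scheme \<Rightarrow> enat" where
  "krull_dim R = Sup {enat n | n. \<exists>p :: nat \<Rightarrow> 'a set.
    (\<forall>i\<le>n. primeideal (p i) R) \<and> (\<forall>i<n. p i \<subset> p (Suc i))}"

definition ideal_radical :: "('a, 'b) ring_scheme \<Rightarrow> 'a set \<Rightarrow> 'a set" where
  "ideal_radical R I = {a \<in> carrier R. \<exists>n::nat. a [^]\<^bsub>R\<^esub> n \<in> I}"

definition primary_ideal :: "('a, 'b) ring_scheme \<Rightarrow> 'a set \<Rightarrow> bool" where
  "primary_ideal R Q \<longleftrightarrow> ideal Q R \<and> Q \<noteq> carrier R \<and>
    (\<forall>a\<in>carrier R. \<forall>b\<in>carrier R. a \<otimes>\<^bsub>R\<^esub> b \<in> Q \<longrightarrow> a \<in> Q \<or> b \<in> ideal_radical R Q)"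

definition primary_to :: "('a, 'b) ring_scheme \<Rightarrow> 'a set \<Rightarrow> 'a set \<Rightarrow> bool" where
  "primary_to R p Q \<longleftrightarrow> primary_ideal R Q \<and> ideal_radical R Q = p"

abbreviation ideal_power :: "('a, 'b) ring_scheme \<Rightarrow> 'a set \<Rightarrow> nat \<Rightarrow> 'a set" where
  "ideal_power R I n \<equiv> I [^]\<^bsub>ideals_set R\<^esub> n"


section \<open>The total quotient ring\<close>

definition nonzerodivisors :: "('a, 'b) ring_scheme \<Rightarrow> 'a set" where
  "nonzerodivisors R = {s \<in> carrier R. \<forall>a\<in>carrier R. a \<otimes>\<^bsub>R\<^esub> s = \<zero>\<^bsub>R\<^esub> \<longrightarrow> a = \<zero>\<^bsub>R\<^esub>}"

text \<open>The fraction \<open>a / s\<close>, as an equivalence class of pairs.\<close>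

definition fraction :: "('a, 'b) ring_scheme \<Rightarrow> 'a \<Rightarrow> 'a \<Rightarrow> ('a \<times> 'a) set" where
  "fraction R a s = {(b, t). b \<in> carrier R \<and> t \<in> nonzerodivisors R \<and> a \<otimes>\<^bsub>R\<^esub> t = b \<otimes>\<^bsub>R\<^esub> s}"

definition total_quotient_ring :: "('a, 'b) ring_scheme \<Rightarrow> ('a \<times> 'a) set ring" where
  "total_quotient_ring R =
    \<lparr>carrier = {fraction R a s | a s. a \<in> carrier R \<and> s \<in> nonzerodivisors R},
     mult = (\<lambda>X Y. \<Union>(a, s)\<in>X. \<Union>(b, t)\<in>Y. fraction R (a \<otimes>\<^bsub>R\<^esub> b) (s \<otimes>\<^bsub>R\<^esub> t)),
     one = fraction R \<one>\<^bsub>R\<^esub> \<one>\<^bsub>R\<^esub>,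
     zero = fraction R \<zero>\<^bsub>R\<^esub> \<one>\<^bsub>R\<^esub>,
     add = (\<lambda>X Y. \<Union>(a, s)\<in>X. \<Union>(b, t)\<in>Y.
              fraction R (a \<otimes>\<^bsub>R\<^esub> t \<oplus>\<^bsub>R\<^esub> b \<otimes>\<^bsub>R\<^esub> s) (s \<otimes>\<^bsub>R\<^esub> t))\<rparr>"

lemma UN_const2:
  assumes "p \<in> A" "q \<in> B" "\<And>a s b t. (a, s) \<in> A \<Longrightarrow> (b, t) \<in> B \<Longrightarrow> F a s b t = C"
  shows "(\<Union>(a, s)\<in>A. \<Union>(b, t)\<in>B. F a s b t) = C"
proof -
  have "(\<Union>(a, s)\<in>A. \<Union>(b, t)\<in>B. F a s b t) = (\<Union>p\<in>A. \<Union>q\<in>B. C)"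
    using assms(3) by (intro SUP_cong refl) (auto simp: split_beta)
  then show ?thesis using assms(1,2) by auto
qed

lemma cring_total_quotient_ring:
  assumes "cring R" shows "cring (total_quotient_ring R)"
proof -
  interpret cring R by fact
  let ?D = "nonzerodivisors R"
  have D_carr[simp]: "s \<in> carrier R" if "s \<in> ?D" for s
    using that by (simp add: nonzerodivisors_def)
  have D_cancel: "a = b" if "a \<otimes>\<^bsub>R\<^esub> s = b \<otimes>\<^bsub>R\<^esub> s" "s \<in> ?D" "a \<in> carrier R" "b \<in> carrier R" for a b s
  proof -
    have "(a \<ominus>\<^bsub>R\<^esub> b) \<otimes>\<^bsub>R\<^esub> s = a \<otimes>\<^bsub>R\<^esub> s \<ominus>\<^bsub>R\<^esub> b \<otimes>\<^bsub>R\<^esub> s"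
      using that by (simp add: minus_eq l_distr l_minus)
    then have "(a \<ominus>\<^bsub>R\<^esub> b) \<otimes>\<^bsub>R\<^esub> s = \<zero>\<^bsub>R\<^esub>"
      using that by (simp add: r_right_minus_eq)
    then have "a \<ominus>\<^bsub>R\<^esub> b = \<zero>\<^bsub>R\<^esub>"
      using that(2) minus_closed[OF that(3,4)] unfolding nonzerodivisors_def by blast
    then show ?thesis using that(3,4) by (simp add: r_right_minus_eq)
  qed
  have D_one[simp]: "\<one>\<^bsub>R\<^esub> \<in> ?D" by (simp add: nonzerodivisors_def del: D_carr)
  have D_mult[simp]: "s \<otimes>\<^bsub>R\<^esub> t \<in> ?D" if "s \<in> ?D" "t \<in> ?D" for s t
  proof -
    have "a = \<zero>\<^bsub>R\<^esub>" if "a \<in> carrier R" "a \<otimes>\<^bsub>R\<^esub> (s \<otimes>\<^bsub>R\<^esub> t) = \<zero>\<^bsub>R\<^esub>" for a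
    proof -
      have "(a \<otimes>\<^bsub>R\<^esub> s) \<otimes>\<^bsub>R\<^esub> t = \<zero>\<^bsub>R\<^esub>"
        using that \<open>s \<in> ?D\<close> \<open>t \<in> ?D\<close> by (simp add: m_assoc)
      then have "a \<otimes>\<^bsub>R\<^esub> s = \<zero>\<^bsub>R\<^esub>"
        using \<open>t \<in> ?D\<close> m_closed[OF that(1) D_carr[OF \<open>s \<in> ?D\<close>]]
        unfolding nonzerodivisors_def by blast
      then show ?thesis
        using \<open>s \<in> ?D\<close> that(1) unfolding nonzerodivisors_def by blast
    qed
    then show ?thesis using m_closed[OF D_carr[OF that(1)] D_carr[OF that(2)]] unfolding nonzerodivisors_def by blast
  qed
  have self: "(a, s) \<in> fraction R a s" if "a \<in> carrier R" "s \<in> ?D" for a s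
    using that by (simp add: fraction_def)
  have frac_eqI: "fraction R a s = fraction R b t"
    if e: "a \<otimes>\<^bsub>R\<^esub> t = b \<otimes>\<^bsub>R\<^esub> s" and "a \<in> carrier R" "b \<in> carrier R" "s \<in> ?D" "t \<in> ?D" for a b s t
  proof -
    have "a \<otimes>\<^bsub>R\<^esub> u = c \<otimes>\<^bsub>R\<^esub> s \<longleftrightarrow> b \<otimes>\<^bsub>R\<^esub> u = c \<otimes>\<^bsub>R\<^esub> t" if c: "c \<in> carrier R" "u \<in> ?D" for c u
    proof -
      have "a \<otimes>\<^bsub>R\<^esub> u = c \<otimes>\<^bsub>R\<^esub> s \<longleftrightarrow> (a \<otimes>\<^bsub>R\<^esub> u) \<otimes>\<^bsub>R\<^esub> t = (c \<otimes>\<^bsub>R\<^esub> s) \<otimes>\<^bsub>R\<^esub> t"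
        using D_cancel \<open>t \<in> ?D\<close> \<open>s \<in> ?D\<close> \<open>a \<in> carrier R\<close> c by (metis D_carr m_closed)
      also have "(a \<otimes>\<^bsub>R\<^esub> u) \<otimes>\<^bsub>R\<^esub> t = (a \<otimes>\<^bsub>R\<^esub> t) \<otimes>\<^bsub>R\<^esub> u"
        using that c by (simp add: m_ac \<open>a \<in> carrier R\<close> \<open>t \<in> ?D\<close>)
      also have "\<dots> = (b \<otimes>\<^bsub>R\<^esub> u) \<otimes>\<^bsub>R\<^esub> s"
        using c by (simp add: e m_ac \<open>b \<in> carrier R\<close> \<open>s \<in> ?D\<close>)
      also have "(c \<otimes>\<^bsub>R\<^esub> s) \<otimes>\<^bsub>R\<^esub> t = (c \<otimes>\<^bsub>R\<^esub> t) \<otimes>\<^bsub>R\<^esub> s"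
        using c by (simp add: m_ac \<open>t \<in> ?D\<close> \<open>s \<in> ?D\<close>)
      also have "(b \<otimes>\<^bsub>R\<^esub> u) \<otimes>\<^bsub>R\<^esub> s = (c \<otimes>\<^bsub>R\<^esub> t) \<otimes>\<^bsub>R\<^esub> s \<longleftrightarrow> b \<otimes>\<^bsub>R\<^esub> u = c \<otimes>\<^bsub>R\<^esub> t"
        using D_cancel \<open>t \<in> ?D\<close> \<open>s \<in> ?D\<close> \<open>b \<in> carrier R\<close> c by (metis D_carr m_closed)
      finally show ?thesis .
    qed
    then show ?thesis by (auto simp: fraction_def)
  qed
  let ?Q = "total_quotient_ring R"
  have mult: "fraction R a s \<otimes>\<^bsub>?Q\<^esub> fraction R b t = fraction R (a \<otimes>\<^bsub>R\<^esub> b) (s \<otimes>\<^bsub>R\<^esub> t)"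
    if c: "a \<in> carrier R" "b \<in> carrier R" "s \<in> ?D" "t \<in> ?D" for a b s t
  proof -
    have "fraction R (a' \<otimes>\<^bsub>R\<^esub> b') (s' \<otimes>\<^bsub>R\<^esub> t') = fraction R (a \<otimes>\<^bsub>R\<^esub> b) (s \<otimes>\<^bsub>R\<^esub> t)"
      if "(a', s') \<in> fraction R a s" "(b', t') \<in> fraction R b t" for a' s' b' t'
    proof -
      have d: "a' \<in> carrier R" "b' \<in> carrier R" "s' \<in> ?D" "t' \<in> ?D"
        "a \<otimes>\<^bsub>R\<^esub> s' = a' \<otimes>\<^bsub>R\<^esub> s" "b \<otimes>\<^bsub>R\<^esub> t' = b' \<otimes>\<^bsub>R\<^esub> t"
        using that by (auto simp: fraction_def)
      have "(a' \<otimes>\<^bsub>R\<^esub> b') \<otimes>\<^bsub>R\<^esub> (s \<otimes>\<^bsub>R\<^esub> t) = (a' \<otimes>\<^bsub>R\<^esub> s) \<otimes>\<^bsub>R\<^esub> (b' \<otimes>\<^bsub>R\<^esub> t)"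
        using c d(1-4) by (simp add: m_ac)
      also have "\<dots> = (a \<otimes>\<^bsub>R\<^esub> s') \<otimes>\<^bsub>R\<^esub> (b \<otimes>\<^bsub>R\<^esub> t')" using d by simp
      also have "\<dots> = (a \<otimes>\<^bsub>R\<^esub> b) \<otimes>\<^bsub>R\<^esub> (s' \<otimes>\<^bsub>R\<^esub> t')" using c d(1-4) by (simp add: m_ac)
      finally show ?thesis using c d by (intro frac_eqI) auto
    qed
    then show ?thesis
      unfolding total_quotient_ring_def monoid.simps ring.simps
      by (rule UN_const2[OF self[OF c(1,3)] self[OF c(2,4)]])
  qed
  have add: "fraction R a s \<oplus>\<^bsub>?Q\<^esub> fraction R b t
      = fraction R (a \<otimes>\<^bsub>R\<^esub> t \<oplus>\<^bsub>R\<^esub> b \<otimes>\<^bsub>R\<^esub> s) (s \<otimes>\<^bsub>R\<^esub> t)"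
    if c: "a \<in> carrier R" "b \<in> carrier R" "s \<in> ?D" "t \<in> ?D" for a b s t
  proof -
    have "fraction R (a' \<otimes>\<^bsub>R\<^esub> t' \<oplus>\<^bsub>R\<^esub> b' \<otimes>\<^bsub>R\<^esub> s') (s' \<otimes>\<^bsub>R\<^esub> t')
        = fraction R (a \<otimes>\<^bsub>R\<^esub> t \<oplus>\<^bsub>R\<^esub> b \<otimes>\<^bsub>R\<^esub> s) (s \<otimes>\<^bsub>R\<^esub> t)"
      if "(a', s') \<in> fraction R a s" "(b', t') \<in> fraction R b t" for a' s' b' t'
    proof -
      have d: "a' \<in> carrier R" "b' \<in> carrier R" "s' \<in> ?D" "t' \<in> ?D"
        "a \<otimes>\<^bsub>R\<^esub> s' = a' \<otimes>\<^bsub>R\<^esub> s" "b \<otimes>\<^bsub>R\<^esub> t' = b' \<otimes>\<^bsub>R\<^esub> t"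
        using that by (auto simp: fraction_def)
      have "(a' \<otimes>\<^bsub>R\<^esub> t' \<oplus>\<^bsub>R\<^esub> b' \<otimes>\<^bsub>R\<^esub> s') \<otimes>\<^bsub>R\<^esub> (s \<otimes>\<^bsub>R\<^esub> t)
          = (a' \<otimes>\<^bsub>R\<^esub> s) \<otimes>\<^bsub>R\<^esub> (t' \<otimes>\<^bsub>R\<^esub> t) \<oplus>\<^bsub>R\<^esub> (b' \<otimes>\<^bsub>R\<^esub> t) \<otimes>\<^bsub>R\<^esub> (s' \<otimes>\<^bsub>R\<^esub> s)"
        using c d(1-4) by (simp add: m_ac l_distr r_distr)
      also have "\<dots> = (a \<otimes>\<^bsub>R\<^esub> s') \<otimes>\<^bsub>R\<^esub> (t' \<otimes>\<^bsub>R\<^esub> t) \<oplus>\<^bsub>R\<^esub> (b \<otimes>\<^bsub>R\<^esub> t') \<otimes>\<^bsub>R\<^esub> (s' \<otimes>\<^bsub>R\<^esub> s)"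
        using d by simp
      also have "\<dots> = (a \<otimes>\<^bsub>R\<^esub> t \<oplus>\<^bsub>R\<^esub> b \<otimes>\<^bsub>R\<^esub> s) \<otimes>\<^bsub>R\<^esub> (s' \<otimes>\<^bsub>R\<^esub> t')"
        using c d(1-4) by (simp add: m_ac l_distr r_distr)
      finally show ?thesis using c d by (intro frac_eqI) auto
    qed
    then show ?thesis
      unfolding total_quotient_ring_def monoid.simps ring.simps
      by (rule UN_const2[OF self[OF c(1,3)] self[OF c(2,4)]])
  qed
  have zero: "\<zero>\<^bsub>?Q\<^esub> = fraction R \<zero>\<^bsub>R\<^esub> \<one>\<^bsub>R\<^esub>" and one: "\<one>\<^bsub>?Q\<^esub> = fraction R \<one>\<^bsub>R\<^esub> \<one>\<^bsub>R\<^esub>"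
    by (simp_all add: total_quotient_ring_def)
  have carrI: "fraction R a s \<in> carrier ?Q" if "a \<in> carrier R" "s \<in> ?D" for a s
    using that by (auto simp: total_quotient_ring_def)
  have carrE: "\<exists>a\<in>carrier R. \<exists>s\<in>?D. X = fraction R a s" if "X \<in> carrier ?Q" for X
    using that by (auto simp: total_quotient_ring_def)
  have ag: "abelian_group ?Q"
  proof (rule abelian_groupI)
    fix X assume "X \<in> carrier ?Q"
    then obtain a s where x: "a \<in> carrier R" "s \<in> ?D" "X = fraction R a s" using carrE by blast
    have "fraction R (\<ominus>\<^bsub>R\<^esub> a) s \<oplus>\<^bsub>?Q\<^esub> X = \<zero>\<^bsub>?Q\<^esub>"
      using x by (simp add: add zero l_minus l_neg) (intro frac_eqI, auto)
    then show "\<exists>Y\<in>carrier ?Q. Y \<oplus>\<^bsub>?Q\<^esub> X = \<zero>\<^bsub>?Q\<^esub>"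
      using x carrI[of "\<ominus>\<^bsub>R\<^esub> a" s] by auto
  qed (auto simp: add zero l_distr r_distr m_ac a_ac intro!: carrI dest!: carrE)
  show ?thesis
  proof (rule cringI[OF ag])
    show "comm_monoid ?Q"
      by (rule comm_monoidI) (auto simp: mult one m_ac intro!: carrI dest!: carrE)
    fix X Y Z assume "X \<in> carrier ?Q" "Y \<in> carrier ?Q" "Z \<in> carrier ?Q"
    then obtain a s b t c u where *: "a \<in> carrier R" "s \<in> ?D" "X = fraction R a s"
      "b \<in> carrier R" "t \<in> ?D" "Y = fraction R b t" "c \<in> carrier R" "u \<in> ?D" "Z = fraction R c u"
      using carrE by metis
    then show "(X \<oplus>\<^bsub>?Q\<^esub> Y) \<otimes>\<^bsub>?Q\<^esub> Z = X \<otimes>\<^bsub>?Q\<^esub> Z \<oplus>\<^bsub>?Q\<^esub> Y \<otimes>\<^bsub>?Q\<^esub> Z"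
      by (simp add: mult add) (intro frac_eqI, auto simp: l_distr r_distr m_ac)
  qed
qed

definition reduced_ring :: "('a, 'b) ring_scheme \<Rightarrow> bool" where
  "reduced_ring R \<longleftrightarrow> (\<forall>a\<in>carrier R. \<forall>n::nat. a [^]\<^bsub>R\<^esub> n = \<zero>\<^bsub>R\<^esub> \<longrightarrow> a = \<zero>\<^bsub>R\<^esub>)"


section \<open>Finite covers\<close>

definition ring_extension :: "('a, 'b) ring_scheme \<Rightarrow> ('a, 'c) ring_scheme \<Rightarrow> bool" where
  "ring_extension R S \<longleftrightarrow>
    cring R \<and> cring S \<and> carrier R \<subseteq> carrier S \<and> (\<lambda>x. x) \<in> ring_hom R S"

lemma module_ring_as_module:
  assumes "ring_extension R S" shows "module R (ring_as_module S)"
proof -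
  interpret R: cring R using assms by (simp add: ring_extension_def)
  interpret S: cring S using assms by (simp add: ring_extension_def)
  have sub: "carrier R \<subseteq> carrier S" and h: "(\<lambda>x. x) \<in> ring_hom R S"
    using assms by (auto simp: ring_extension_def)
  have ag: "abelian_group (ring_as_module S)"
    by (rule abelian_groupI)
       (auto simp: ring_as_module_def S.a_ac intro: bexI[of _ "\<ominus>\<^bsub>S\<^esub> x" for x] S.l_neg)
  show ?thesis
    using sub h ag
    by (intro moduleI R.is_cring)
       (auto simp: ring_as_module_def ring_hom_def subset_iff S.l_distr S.r_distr S.m_assoc)
qed

definition finite_cover :: "('a, 'b) ring_scheme \<Rightarrow> ('a, 'c) ring_scheme \<Rightarrow> bool" where
  "finite_cover R S \<longleftrightarrow> ring_extension R S \<and> finite_module R (ring_as_module S)"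

definition finite_length_cover :: "('a, 'b) ring_scheme \<Rightarrow> ('a, 'c) ring_scheme \<Rightarrow> bool" where
  "finite_length_cover R S \<longleftrightarrow> finite_length R (quot_module (ring_as_module S) (carrier R))"

text \<open>That \<open>S\<close> is contained in the total quotient ring of \<open>R\<close> means that the extension \<open>S/R\<close> embeds
  over \<open>R\<close>, i.e. by an injective ring homomorphism extending the canonical \<open>r \<mapsto> r / 1\<close>.\<close>

definition birational_cover :: "('a, 'b) ring_scheme \<Rightarrow> ('a, 'c) ring_scheme \<Rightarrow> bool" where
  "birational_cover R S \<longleftrightarrow> reduced_ring R \<and>
    (\<exists>\<phi> \<in> ring_hom S (total_quotient_ring R). inj_on \<phi> (carrier S) \<and>
      (\<forall>r\<in>carrier R. \<phi> r = fraction R r \<one>\<^bsub>R\<^esub>))"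


section \<open>Filtrations of ideals\<close>

definition ideal_filtration :: "('a, 'b) ring_scheme \<Rightarrow> (nat \<Rightarrow> 'a set) \<Rightarrow> bool" where
  "ideal_filtration R B \<longleftrightarrow> (\<forall>n. ideal (B n) R) \<and> B 0 = carrier R \<and>
    (\<forall>n. B (Suc n) \<subseteq> B n) \<and> (\<forall>i j. B i \<cdot>\<^bsub>R\<^esub> B j \<subseteq> B (i + j))"

definition admissible_filtration ::
    "('a, 'b) ring_scheme \<Rightarrow> 'a set \<Rightarrow> (nat \<Rightarrow> 'a set) \<Rightarrow> bool" where
  "admissible_filtration R I B \<longleftrightarrow> ideal_filtration R B \<and>
    (\<exists>k. \<forall>n. B (n + k) \<subseteq> ideal_power R I n \<and> ideal_power R I n \<subseteq> B n)"


section \<open>Hilbert polynomials and their coefficients\<close>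

text \<open>The expansion of \<open>P\<close> in the binomial basis is required as an identity of functions on the
  (infinite) field of rationals, which is the same as an identity of polynomials. The coefficients
  beyond the degree are normalised to \<open>0\<close>, to make \<open>e\<close> unique.\<close>

definition hilbert_coeff :: "rat poly \<Rightarrow> nat \<Rightarrow> int" where
  "hilbert_coeff P = (THE e.
    (\<forall>x. poly P x = (\<Sum>i\<le>Polynomial.degree P. (-1) ^ i * of_int (e i) *
       ((x + of_nat (Polynomial.degree P - i)) gchoose (Polynomial.degree P - i)))) \<and>
    (\<forall>i > Polynomial.degree P. e i = 0))"

lemma binomial_basis_unique:
  fixes c :: "nat \<Rightarrow> rat"
  assumes "\<And>x. (\<Sum>k\<le>D. c k * ((x + of_nat k) gchoose k)) = 0" "k \<le> D"
  shows "c k = 0"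
  using assms(2)
proof (induction k rule: less_induct)
  case (less k)
  have "c j * ((- 1 - of_nat k + of_nat j) gchoose j) = 0" if "j \<le> D" "j \<noteq> k" for j
  proof (cases "j < k")
    case True
    then show ?thesis using less by simp
  next
    case False
    then have "(- 1 - of_nat k + of_nat j :: rat) = of_nat (j - 1 - k)"
      using that by (simp add: of_nat_diff)
    then have "((- 1 - of_nat k + of_nat j :: rat) gchoose j) = of_nat ((j - 1 - k) choose j)"
      by (simp only: binomial_gbinomial)
    moreover have "(j - 1 - k) choose j = 0"
      using that False by (intro binomial_eq_0) auto
    ultimately show ?thesis by simp
  qed
  then have "(\<Sum>j\<in>{..D} - {k}. c j * ((- 1 - of_nat k + of_nat j) gchoose j)) = 0"
    by (intro sum.neutral) auto
  then have "c k * ((- 1) gchoose k) = 0"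
    using assms(1)[of "- 1 - of_nat k"] less.prems by (simp add: sum.remove[of _ k])
  moreover have "((- 1 :: rat) gchoose k) \<noteq> 0"
    using gbinomial_minus[of "1::rat" k] by (simp add: binomial_gbinomial[symmetric])
  ultimately show ?case by simp
qed

lemma hilbert_coeff_eqI:
  assumes "\<And>x. poly P x = (\<Sum>i\<le>Polynomial.degree P. (-1) ^ i * of_int (e i) *
       ((x + of_nat (Polynomial.degree P - i)) gchoose (Polynomial.degree P - i)))"
    and "\<And>i. i > Polynomial.degree P \<Longrightarrow> e i = 0"
  shows "hilbert_coeff P = e"
  unfolding hilbert_coeff_def
proof (rule the_equality)
  show "(\<forall>x. poly P x = (\<Sum>i\<le>Polynomial.degree P. (-1) ^ i * of_int (e i) *
       ((x + of_nat (Polynomial.degree P - i)) gchoose (Polynomial.degree P - i)))) \<and>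
    (\<forall>i > Polynomial.degree P. e i = 0)"
    using assms by blast
next
  fix e'
  let ?D = "Polynomial.degree P"
  assume e': "(\<forall>x. poly P x = (\<Sum>i\<le>?D. (-1) ^ i * of_int (e' i) *
       ((x + of_nat (?D - i)) gchoose (?D - i)))) \<and> (\<forall>i > ?D. e' i = 0)"
  define c :: "nat \<Rightarrow> rat" where "c k = (-1) ^ (?D - k) * (of_int (e' (?D - k)) - of_int (e (?D - k)))" for k
  have "(\<Sum>k\<le>?D. c k * ((x + of_nat k) gchoose k)) = 0" for x
  proof -
    have "(\<Sum>k\<le>?D. c k * ((x + of_nat k) gchoose k))
        = (\<Sum>i\<le>?D. c (?D - i) * ((x + of_nat (?D - i)) gchoose (?D - i)))"
      using sum.nat_diff_reindex[of "\<lambda>k. c k * ((x + of_nat k) gchoose k)" "Suc ?D"]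
      by (simp add: lessThan_Suc_atMost)
    also have "\<dots> = (\<Sum>i\<le>?D. (-1) ^ i * of_int (e' i) * ((x + of_nat (?D - i)) gchoose (?D - i))
        - (-1) ^ i * of_int (e i) * ((x + of_nat (?D - i)) gchoose (?D - i)))"
      by (intro sum.cong refl) (simp add: c_def algebra_simps)
    also have "\<dots> = poly P x - poly P x"
      using e' assms(1)[of x] by (simp only: sum_subtractf)
    finally show ?thesis by simp
  qed
  then have c: "c (?D - i) = 0" for i
    by (rule binomial_basis_unique) simp
  show "e' = e"
  proof
    fix i show "e' i = e i"
      using c[of i] e' assms(2)[of i] by (cases "i \<le> ?D") (auto simp: c_def)
  qed
qed

definition agrees_eventually :: "(nat \<Rightarrow> enat) \<Rightarrow> rat poly \<Rightarrow> bool" where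
  "agrees_eventually f P \<longleftrightarrow>
    (\<forall>\<^sub>F n in sequentially. \<exists>l::nat. f n = enat l \<and> poly P (of_nat n) = of_nat l)"

definition eventual_poly :: "(nat \<Rightarrow> enat) \<Rightarrow> rat poly" where
  "eventual_poly f = (THE P. agrees_eventually f P)"

lemma agrees_eventually_unique:
  assumes "agrees_eventually f P" "agrees_eventually f Q"
  shows "P = Q"
proof -
  have "\<forall>\<^sub>F n in sequentially. poly P (of_nat n) = poly Q (of_nat n)"
    using assms unfolding agrees_eventually_def
    by eventually_elim auto
  then obtain N where N: "\<And>n. n \<ge> N \<Longrightarrow> poly (P - Q) (of_nat n) = 0"
    by (auto simp: eventually_sequentially)
  have "infinite (of_nat ` {N..} :: rat set)"
    by (subst finite_image_iff) (auto simp: inj_on_def infinite_Ici)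
  moreover have "of_nat ` {N..} \<subseteq> {x. poly (P - Q) x = 0}"
    using N by auto
  ultimately have "infinite {x. poly (P - Q) x = 0}"
    using finite_subset by blast
  then show ?thesis
    using poly_roots_finite[of "P - Q"] by auto
qed

lemma eventual_poly_eqI: "agrees_eventually f P \<Longrightarrow> eventual_poly f = P"
  unfolding eventual_poly_def by (blast intro: agrees_eventually_unique)

definition filtration_poly :: "('a, 'b) ring_scheme \<Rightarrow> (nat \<Rightarrow> 'a set) \<Rightarrow> rat poly" where
  "filtration_poly R B =
    eventual_poly (\<lambda>n. module_length R (quot_module (ring_as_module R) (B (n + 1))))"

definition extension_poly ::
    "('a, 'b) ring_scheme \<Rightarrow> 'a set \<Rightarrow> ('a, 'c) ring_scheme \<Rightarrow> rat poly" where
  "extension_poly R I S =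
    eventual_poly (\<lambda>n. module_length R
      (quot_module (ring_as_module S) (Idl\<^bsub>S\<^esub> (ideal_power R I (n + 1)))))"

definition e1_filtration :: "('a, 'b) ring_scheme \<Rightarrow> (nat \<Rightarrow> 'a set) \<Rightarrow> int" where
  "e1_filtration R B = hilbert_coeff (filtration_poly R B) 1"

definition e1_extension ::
    "('a, 'b) ring_scheme \<Rightarrow> 'a set \<Rightarrow> ('a, 'c) ring_scheme \<Rightarrow> int" where
  "e1_extension R I S = hilbert_coeff (extension_poly R I S) 1"

end

theory Submission
  imports Defs
begin

text \<open>
  Put \<open>f n = \<lambda>(R/B\<^sub>n\<^sub>+\<^sub>1)\<close> and \<open>g n = \<lambda>(S/I\<^sup>n\<^sup>+\<^sup>1S)\<close>. Since \<open>R \<inter> I\<^sup>nS \<subseteq> B\<^sub>n\<close> for large \<open>n\<close>, the module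
  \<open>R/B\<^sub>n\<^sub>+\<^sub>1\<close> is a quotient of a submodule of \<open>S/I\<^sup>n\<^sup>+\<^sup>1S\<close>, so \<open>f n \<le> g n\<close>. Conversely
  \<open>g n \<le> f (n + K) + l\<close> for constants \<open>K\<close>, \<open>l\<close>: if \<open>S/R\<close> has finite length, \<open>l\<close> is that length; if it is
  birational, some \<open>b \<in> R\<close> that is regular on \<open>S\<close> has \<open>bS \<subseteq> R\<close>, and by Artin-Rees \<open>bS \<inter> I\<^sup>n\<^sup>+\<^sup>c \<subseteq> b I\<^sup>nS\<close>, whence
  \<open>\<lambda>(S/I\<^sup>nS) = \<lambda>(bS/bI\<^sup>nS) \<le> \<lambda>(bS/(bS \<inter> I\<^sup>n\<^sup>+\<^sup>c)) \<le> \<lambda>(R/I\<^sup>n\<^sup>+\<^sup>c)\<close>. Hence \<open>g - f\<close> is eventually a nonnegative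
  polynomial of degree smaller than that of \<open>f\<close>, which is positive by Nakayama's lemma because \<open>d \<ge> 1\<close>, and its
  coefficient one below the top degree is \<open>e\<^sub>1(B) - e\<^sub>1(I, S) \<ge> 0\<close>. All modules in sight are quotients of
  submodules of the \<open>R\<close>-module \<open>S\<close>, so that only the lattice of these submodules is needed.
\<close>

section \<open>Relative length of submodules\<close>

text \<open>The overview takes for granted that \<open>f\<close> and \<open>g\<close> are eventually
  polynomial. For \<open>g\<close> this is the Hilbert-Serre argument. For \<open>B\<close>, the
  equality of \<open>B (n + 1)\<close> with \<open>I B n\<close> for large \<open>n\<close> comes
  from admissibility: \<open>B (n + k) \<subseteq> I^n\<close> makes the shifted filtration a graded
  submodule of the Rees algebra of \<open>I\<close>, to which a graded Hilbert basis theorem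
  applies. The same theorem, for the sequence \<open>I^nS \<inter> bS\<close>, is the Artin-Rees
  step, and it also controls the kernels in the Hilbert-Serre induction. No Rees algebra or
  associated graded module is formed: a graded module is a sequence of submodules of
  \<open>S\<close>, or of pairs \<open>C n \<subseteq> A n\<close> standing for quotients, and a
  variable is a generator of \<open>I\<close>, multiplying degree \<open>n\<close> into degree
  \<open>n + 1\<close>. Such variables satisfy relations, so an element does not determine its
  leading coefficient; this shapes the basis theorem. The degree of \<open>g - f\<close> must be
  below that of \<open>f\<close> because only then do \<open>f\<close> and \<open>g\<close> share
  degree and leading coefficient, and \<open>e\<^sub>1\<close> sits in the same place of both
  binomial expansions.\<close>

inductive has_chain :: "('r, 'b) ring_scheme \<Rightarrow> ('r, 'a, 'm) module_scheme \<Rightarrow> 'a set \<Rightarrow> nat \<Rightarrow> 'a set \<Rightarrow> bool"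
  for R M C where
  base: "submodule A R M \<Longrightarrow> C \<subseteq> A \<Longrightarrow> has_chain R M C 0 A"
| step: "has_chain R M C n A \<Longrightarrow> submodule A' R M \<Longrightarrow> A \<subset> A' \<Longrightarrow> has_chain R M C (Suc n) A'"

text \<open>For submodules \<open>C \<subseteq> A\<close> this is the length of \<open>A/C\<close>,
  obtained without the quotient. In \<open>has_chain\<close> the top of the chain is exactly
  \<open>A\<close>, while the bottom is any submodule above the mere set \<open>C\<close>, so that
  \<open>C = {}\<close> gives the length of \<open>A\<close> itself.\<close>

definition rel_length :: "('r, 'b) ring_scheme \<Rightarrow> ('r, 'a, 'm) module_scheme \<Rightarrow> 'a set \<Rightarrow> 'a set \<Rightarrow> enat" where
  "rel_length R M C A = Sup {enat n | n. has_chain R M C n A}"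

lemma has_chain_submodule: "has_chain R M C n A \<Longrightarrow> submodule A R M \<and> C \<subseteq> A"
  by (induction rule: has_chain.induct) auto

lemma has_chain_mono: "has_chain R M C n A \<Longrightarrow> A \<subseteq> A' \<Longrightarrow> submodule A' R M \<Longrightarrow> has_chain R M C n A'"
  by (induction rule: has_chain.induct) (blast intro: has_chain.intros)+

lemma has_chain_le: "has_chain R M C n A \<Longrightarrow> m \<le> n \<Longrightarrow> has_chain R M C m A"
proof (induction arbitrary: m rule: has_chain.induct)
  case (step n A A')
  show ?case
  proof (cases "m = Suc n")
    case True
    then show ?thesis using has_chain.step[OF step.hyps] by simp
  next
    case False
    then show ?thesis using step by (auto intro!: has_chain_mono[of R M C m A A'])
  qed
qed (auto intro: has_chain.base)

lemma has_chain_append: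
  "has_chain R M B q A \<Longrightarrow> has_chain R M C p B \<Longrightarrow> has_chain R M C (p + q) A"
proof (induction rule: has_chain.induct)
  case (base A) then show ?case by (simp add: has_chain_mono)
next
  case (step n A A') then show ?case using has_chain.step[of R M C "p + n" A A'] by simp
qed

lemma has_chain_map:
  assumes "has_chain R M C n A" "A \<subseteq> T"
    and "\<And>X. submodule X R M \<Longrightarrow> C \<subseteq> X \<Longrightarrow> X \<subseteq> T \<Longrightarrow> submodule (f X) R' M' \<and> C' \<subseteq> f X"
    and "\<And>X Y. submodule X R M \<Longrightarrow> submodule Y R M \<Longrightarrow> C \<subseteq> X \<Longrightarrow> X \<subset> Y \<Longrightarrow> Y \<subseteq> T \<Longrightarrow> f X \<subset> f Y"
  shows "has_chain R' M' C' n (f A)"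
  using assms(1,2)
proof (induction rule: has_chain.induct)
  case (base A) then show ?case using assms(3) by (blast intro: has_chain.base)
next
  case (step n A A')
  have "submodule A R M" "C \<subseteq> A" using has_chain_submodule[OF step.hyps(1)] by auto
  then show ?case using step assms(3,4)[of A'] assms(4)[of A A']
    by (intro has_chain.step[of _ _ _ _ "f A"]) auto
qed

text \<open>Chains can be shortened, so the attained lengths are closed downwards and every natural
  number below the supremum is attained, even when the supremum is infinite. Length inequalities
  thereby reduce to the existence of chains.\<close>

lemma enat_le_rel_length_iff:
  assumes "submodule A R M" "C \<subseteq> A"
  shows "enat n \<le> rel_length R M C A \<longleftrightarrow> has_chain R M C n A"
proof
  assume *: "enat n \<le> rel_length R M C A"
  show "has_chain R M C n A"
  proof (rule ccontr)
    assume no: "\<not> has_chain R M C n A"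
    then have "n \<noteq> 0" using has_chain.base[OF assms] by (metis)
    have "k < n" if "has_chain R M C k A" for k
      using has_chain_le[OF that, of n] no by (meson not_less)
    then have "rel_length R M C A \<le> enat (n - 1)"
      unfolding rel_length_def by (intro Sup_least) fastforce
    then have "enat n \<le> enat (n - 1)" using * order.trans by metis
    then show False using \<open>n \<noteq> 0\<close> by simp
  qed
next
  assume "has_chain R M C n A" then show "enat n \<le> rel_length R M C A"
    unfolding rel_length_def by (intro Sup_upper) blast
qed

lemma enat_le_all: "(\<And>n. enat n \<le> x \<Longrightarrow> enat n \<le> y) \<Longrightarrow> x \<le> y"
  by (cases y) (metis Suc_n_not_le_n enat_ord_simps(1) enat_ord_simps(3) not_less_eq_eq linorder_le_cases Suc_ile_eq leI, simp)

text \<open>The common source of the length comparisons below. The map \<open>f\<close> acts on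
  submodules only: it must be strictly monotone on the interval from \<open>C\<close> to
  \<open>A\<close> but need not come from a homomorphism, so intersections, sums, colons and
  preimages all qualify.\<close>

lemma rel_length_le_map:
  assumes "submodule A R M" "C \<subseteq> A" "submodule A' R' M'" "f A \<subseteq> A'"
    and "\<And>X. submodule X R M \<Longrightarrow> C \<subseteq> X \<Longrightarrow> X \<subseteq> A \<Longrightarrow> submodule (f X) R' M' \<and> C' \<subseteq> f X"
    and "\<And>X Y. submodule X R M \<Longrightarrow> submodule Y R M \<Longrightarrow> C \<subseteq> X \<Longrightarrow> X \<subset> Y \<Longrightarrow> Y \<subseteq> A \<Longrightarrow> f X \<subset> f Y"
  shows "rel_length R M C A \<le> rel_length R' M' C' A'"
proof (rule enat_le_all)
  fix n assume "enat n \<le> rel_length R M C A"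
  then have "has_chain R M C n A" using enat_le_rel_length_iff[OF assms(1,2)] by blast
  then have h: "has_chain R' M' C' n (f A)"
    using assms(5,6) by (rule has_chain_map[OF _ order.refl])
  then have "has_chain R' M' C' n A'" using has_chain_mono assms(3,4) by blast
  then show "enat n \<le> rel_length R' M' C' A'"
    using enat_le_rel_length_iff[of A' R' M' C' n] has_chain_submodule assms(3) by blast
qed

section \<open>Sums, intersections, multiples and colons of submodules\<close>

context module
begin

abbreviation sm :: "'c set \<Rightarrow> bool" where "sm N \<equiv> submodule N R M"
abbreviation scale :: "'a \<Rightarrow> 'c set \<Rightarrow> 'c set" where "scale x A \<equiv> (\<lambda>a. x \<odot>\<^bsub>M\<^esub> a) ` A"

lemma smI:
  assumes "H \<subseteq> carrier M" "\<zero>\<^bsub>M\<^esub> \<in> H" "\<And> a b. \<lbrakk>a \<in> H ; b \<in> H\<rbrakk> \<Longrightarrow> a \<oplus>\<^bsub>M\<^esub> b \<in> H"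
    and "\<And> a x. \<lbrakk>a \<in> carrier R; x \<in> H\<rbrakk> \<Longrightarrow> a \<odot>\<^bsub>M\<^esub> x \<in> H"
  shows "sm H"
proof (rule submoduleI)
  fix a assume "a \<in> H"
  then have "(\<ominus> \<one>) \<odot>\<^bsub>M\<^esub> a \<in> H" by (intro assms(4)) auto
  then show "\<ominus>\<^bsub>M\<^esub> a \<in> H" using \<open>a \<in> H\<close> subsetD[OF assms(1), of a] by (simp add: smult_l_minus)
qed (use assms in auto)

lemma sm_zero [simp]: "sm N \<Longrightarrow> \<zero>\<^bsub>M\<^esub> \<in> N"
  using subgroup.one_closed[OF submodule.axioms(1)] by force

lemmas sm_add = submoduleE(5) and sm_minus = submoduleE(3) and sm_smult = submoduleE(4)
lemma sm_carr: "sm N \<Longrightarrow> x \<in> N \<Longrightarrow> x \<in> carrier M"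
  by (rule subsetD[OF submoduleE(1)])

lemma sm_diff: "sm N \<Longrightarrow> x \<in> N \<Longrightarrow> y \<in> N \<Longrightarrow> x \<ominus>\<^bsub>M\<^esub> y \<in> N"
  by (simp add: a_minus_def sm_add sm_minus)

lemma sm_zero_sub: "sm {\<zero>\<^bsub>M\<^esub>}" by (rule smI) auto

lemma sm_Int: "sm A \<Longrightarrow> sm B \<Longrightarrow> sm (A \<inter> B)"
  by (rule smI) (auto simp: sm_add sm_smult sm_carr)

lemma set_add_iff: "x \<in> A <+>\<^bsub>M\<^esub> B \<longleftrightarrow> (\<exists>a\<in>A. \<exists>b\<in>B. x = a \<oplus>\<^bsub>M\<^esub> b)"
  by (auto simp: set_add_def')

lemma sm_set_add: assumes "sm A" "sm B" shows "sm (A <+>\<^bsub>M\<^esub> B)"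
proof (rule smI)
  fix a b assume "a \<in> A <+>\<^bsub>M\<^esub> B" "b \<in> A <+>\<^bsub>M\<^esub> B"
  then obtain p q r s where *: "p \<in> A" "q \<in> B" "a = p \<oplus>\<^bsub>M\<^esub> q" "r \<in> A" "s \<in> B" "b = r \<oplus>\<^bsub>M\<^esub> s"
    by (auto simp: set_add_iff)
  then have "a \<oplus>\<^bsub>M\<^esub> b = (p \<oplus>\<^bsub>M\<^esub> r) \<oplus>\<^bsub>M\<^esub> (q \<oplus>\<^bsub>M\<^esub> s)"
    using assms by (simp add: M.a_ac sm_carr)
  then show "a \<oplus>\<^bsub>M\<^esub> b \<in> A <+>\<^bsub>M\<^esub> B" using * assms by (auto simp: set_add_iff intro: sm_add)
next
  show "\<zero>\<^bsub>M\<^esub> \<in> A <+>\<^bsub>M\<^esub> B" unfolding set_add_iff using assms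
    by (intro bexI[of _ "\<zero>\<^bsub>M\<^esub>"]) auto
next
  fix a x assume "a \<in> carrier R" "x \<in> A <+>\<^bsub>M\<^esub> B"
  then show "a \<odot>\<^bsub>M\<^esub> x \<in> A <+>\<^bsub>M\<^esub> B"
    using assms by (auto simp: set_add_iff smult_r_distr sm_carr) (blast intro: sm_smult)
qed (use assms in \<open>auto simp: set_add_iff sm_carr\<close>)

lemma set_addI: "a \<in> A \<Longrightarrow> b \<in> B \<Longrightarrow> a \<oplus>\<^bsub>M\<^esub> b \<in> A <+>\<^bsub>M\<^esub> B"
  unfolding set_add_iff by blast

lemma set_addE:
  assumes "x \<in> A <+>\<^bsub>M\<^esub> B"
  obtains a b where "a \<in> A" "b \<in> B" "x = a \<oplus>\<^bsub>M\<^esub> b"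
  using assms unfolding set_add_iff by blast

lemma set_add_least: assumes "sm D" "A \<subseteq> D" "B \<subseteq> D" shows "A <+>\<^bsub>M\<^esub> B \<subseteq> D"
proof
  fix x assume "x \<in> A <+>\<^bsub>M\<^esub> B"
  then obtain a b where "a \<in> A" "b \<in> B" "x = a \<oplus>\<^bsub>M\<^esub> b" by (rule set_addE)
  then show "x \<in> D" using assms(2,3) sm_add[OF assms(1), of a b] by blast
qed

lemma set_add_upper1: assumes "sm A" "sm B" shows "A \<subseteq> A <+>\<^bsub>M\<^esub> B"
proof
  fix x assume "x \<in> A"
  then show "x \<in> A <+>\<^bsub>M\<^esub> B"
    using set_addI[of x A "\<zero>\<^bsub>M\<^esub>" B] sm_zero[OF assms(2)] sm_carr[OF assms(1)] by simp
qed

lemma set_add_upper2: assumes "sm A" "sm B" shows "B \<subseteq> A <+>\<^bsub>M\<^esub> B"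
proof
  fix x assume "x \<in> B"
  then show "x \<in> A <+>\<^bsub>M\<^esub> B"
    using set_addI[of "\<zero>\<^bsub>M\<^esub>" A x B] sm_zero[OF assms(1)] sm_carr[OF assms(2)] by simp
qed

lemma set_add_mono: "A \<subseteq> A' \<Longrightarrow> B \<subseteq> B' \<Longrightarrow> A <+>\<^bsub>M\<^esub> B \<subseteq> A' <+>\<^bsub>M\<^esub> B'"
  unfolding subset_iff set_add_iff by blast

text \<open>In a decomposition of an element of \<open>C\<close> the first summand already lies in
  \<open>C\<close>, hence so does the second. Only this inclusion of Dedekind's law is
  needed.\<close>

lemma modular_law:
  assumes "sm A" "sm B" "sm C" "A \<subseteq> C" "C \<subseteq> A <+>\<^bsub>M\<^esub> B"
  shows "C \<subseteq> A <+>\<^bsub>M\<^esub> (B \<inter> C)"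
proof
  fix x assume "x \<in> C"
  then have "x \<in> A <+>\<^bsub>M\<^esub> B" using assms(5) by (rule subsetD[rotated])
  then obtain a b where ab: "a \<in> A" "b \<in> B" "x = a \<oplus>\<^bsub>M\<^esub> b" by (rule set_addE)
  have c: "a \<in> carrier M" "b \<in> carrier M" using sm_carr[OF assms(1) ab(1)] sm_carr[OF assms(2) ab(2)] by auto
  have "a \<in> C" using ab(1) assms(4) by blast
  then have "x \<ominus>\<^bsub>M\<^esub> a \<in> C" using \<open>x \<in> C\<close> sm_diff[OF assms(3)] by blast
  moreover have "x \<ominus>\<^bsub>M\<^esub> a = b"
    using c by (simp add: ab(3) M.minus_eq M.a_comm[of a b] M.a_assoc M.r_neg)
  ultimately show "x \<in> A <+>\<^bsub>M\<^esub> (B \<inter> C)" using ab set_addI[of a A b] by simp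
qed

lemma sm_scale: assumes "sm A" "x \<in> carrier R" shows "sm (scale x A)"
proof (rule smI)
  fix a b assume "a \<in> scale x A" "b \<in> scale x A"
  then obtain p q where pq: "p \<in> A" "q \<in> A" "a = x \<odot>\<^bsub>M\<^esub> p" "b = x \<odot>\<^bsub>M\<^esub> q" by blast
  have "a \<oplus>\<^bsub>M\<^esub> b = x \<odot>\<^bsub>M\<^esub> (p \<oplus>\<^bsub>M\<^esub> q)"
    using pq assms by (simp add: smult_r_distr sm_carr[OF assms(1)])
  then show "a \<oplus>\<^bsub>M\<^esub> b \<in> scale x A" using sm_add[OF assms(1) pq(1,2)] by blast
next
  fix r a assume r: "r \<in> carrier R" "a \<in> scale x A"
  then obtain p where p: "p \<in> A" "a = x \<odot>\<^bsub>M\<^esub> p" by blast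
  have "r \<odot>\<^bsub>M\<^esub> a = x \<odot>\<^bsub>M\<^esub> (r \<odot>\<^bsub>M\<^esub> p)"
    using p r assms(2) sm_carr[OF assms(1)] by (simp add: smult_assoc1[symmetric] R.m_comm)
  then show "r \<odot>\<^bsub>M\<^esub> a \<in> scale x A" using sm_smult[OF assms(1) r(1) p(1)] by blast
next
  show "\<zero>\<^bsub>M\<^esub> \<in> scale x A" using sm_zero[OF assms(1)] assms(2) by (intro image_eqI[of _ _ "\<zero>\<^bsub>M\<^esub>"]) auto
next
  show "scale x A \<subseteq> carrier M" using sm_carr[OF assms(1)] assms(2) by auto
qed

text \<open>The module colon \<open>(C : x)\<close>; on submodules it is right adjoint to
  \<open>scale x\<close>, which is how it is used.\<close>

definition colon :: "'c set \<Rightarrow> 'a \<Rightarrow> 'c set" where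
  "colon C x = {a \<in> carrier M. x \<odot>\<^bsub>M\<^esub> a \<in> C}"

lemma sm_colon: assumes "sm C" "x \<in> carrier R" shows "sm (colon C x)"
  unfolding colon_def
proof (rule smI)
  fix r a assume "r \<in> carrier R" "a \<in> {a \<in> carrier M. x \<odot>\<^bsub>M\<^esub> a \<in> C}"
  then show "r \<odot>\<^bsub>M\<^esub> a \<in> {a \<in> carrier M. x \<odot>\<^bsub>M\<^esub> a \<in> C}"
    using assms sm_smult[OF assms(1), of r "x \<odot>\<^bsub>M\<^esub> a"]
    by (simp add: smult_assoc1[symmetric] R.m_comm)
qed (use assms in \<open>auto simp: smult_r_distr sm_add\<close>)

lemma scale_subset_iff: assumes "sm A" shows "scale x A \<subseteq> C \<longleftrightarrow> A \<subseteq> colon C x"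
  unfolding colon_def using sm_carr[OF assms] by auto

lemma scale_set_add: assumes "sm A" "sm B" "x \<in> carrier R"
  shows "scale x (A <+>\<^bsub>M\<^esub> B) = scale x A <+>\<^bsub>M\<^esub> scale x B"
proof -
  have *: "x \<odot>\<^bsub>M\<^esub> (a \<oplus>\<^bsub>M\<^esub> b) = x \<odot>\<^bsub>M\<^esub> a \<oplus>\<^bsub>M\<^esub> x \<odot>\<^bsub>M\<^esub> b" if "a \<in> A" "b \<in> B" for a b
    using sm_carr[OF assms(1) that(1)] sm_carr[OF assms(2) that(2)] assms(3) by (intro smult_r_distr)
  show ?thesis
  proof (intro equalityI subsetI)
    fix y assume "y \<in> scale x (A <+>\<^bsub>M\<^esub> B)"
    then obtain a b where "a \<in> A" "b \<in> B" "y = x \<odot>\<^bsub>M\<^esub> (a \<oplus>\<^bsub>M\<^esub> b)"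
      by (auto elim!: set_addE)
    then show "y \<in> scale x A <+>\<^bsub>M\<^esub> scale x B" using * by (auto intro: set_addI)
  next
    fix y assume "y \<in> scale x A <+>\<^bsub>M\<^esub> scale x B"
    then obtain a b where "a \<in> A" "b \<in> B" "y = x \<odot>\<^bsub>M\<^esub> a \<oplus>\<^bsub>M\<^esub> x \<odot>\<^bsub>M\<^esub> b"
      by (auto elim!: set_addE)
    then show "y \<in> scale x (A <+>\<^bsub>M\<^esub> B)" using * set_addI[of a A b B] by (metis imageI)
  qed
qed

lemma scale_comm: assumes "sm A" "x \<in> carrier R" "y \<in> carrier R"
  shows "scale x (scale y A) = scale y (scale x A)"
proof -
  have "x \<odot>\<^bsub>M\<^esub> (y \<odot>\<^bsub>M\<^esub> a) = y \<odot>\<^bsub>M\<^esub> (x \<odot>\<^bsub>M\<^esub> a)" if "a \<in> A" for a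
    using sm_carr[OF assms(1) that] assms(2,3) by (simp add: smult_assoc1[symmetric] R.m_comm)
  then show ?thesis unfolding image_image by (intro image_cong refl) auto
qed

section \<open>Additivity of length and the isomorphism theorems\<close>

text \<open>By the modular law, in a strict step \<open>X \<subset> Y\<close> the intersection with
  \<open>B\<close> and the sum with \<open>B\<close> cannot both stay the same. Each step therefore
  lengthens one of the two projected chains; both may grow, whence \<open>n \<le> p + q\<close>
  only.\<close>

lemma has_chain_split:
  assumes "has_chain R M C n X" "sm C" "sm B" "C \<subseteq> B"
  shows "\<exists>p q. n \<le> p + q \<and> has_chain R M C p (X \<inter> B) \<and> has_chain R M B q (X <+>\<^bsub>M\<^esub> B)"
  using assms(1)
proof (induction rule: has_chain.induct)
  case (base X)
  have "has_chain R M C 0 (X \<inter> B)" using base assms by (intro has_chain.base sm_Int) auto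
  moreover have "has_chain R M B 0 (X <+>\<^bsub>M\<^esub> B)"
    using base assms by (intro has_chain.base sm_set_add set_add_upper2) auto
  ultimately show ?case by auto
next
  case (step n X Y)
  obtain p q where pq: "n \<le> p + q" "has_chain R M C p (X \<inter> B)" "has_chain R M B q (X <+>\<^bsub>M\<^esub> B)"
    using step.IH by blast
  have X: "sm X" using has_chain_submodule[OF step.hyps(1)] by auto
  have Y: "sm Y" by fact
  have sY: "sm (Y \<inter> B)" "sm (Y <+>\<^bsub>M\<^esub> B)" using Y assms by (auto intro: sm_Int sm_set_add)
  have le: "X \<inter> B \<subseteq> Y \<inter> B" "X <+>\<^bsub>M\<^esub> B \<subseteq> Y <+>\<^bsub>M\<^esub> B"
    using step.hyps(3) set_add_mono[of X Y B B] by auto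
  show ?case
  proof (cases "X \<inter> B = Y \<inter> B")
    case True
    have "X <+>\<^bsub>M\<^esub> B \<noteq> Y <+>\<^bsub>M\<^esub> B"
    proof
      assume e: "X <+>\<^bsub>M\<^esub> B = Y <+>\<^bsub>M\<^esub> B"
      have "Y \<subseteq> X <+>\<^bsub>M\<^esub> B" using e set_add_upper1[OF Y assms(3)] by simp
      then have "Y \<subseteq> X <+>\<^bsub>M\<^esub> (B \<inter> Y)" using modular_law[OF X assms(3) Y] step.hyps(3) by auto
      also have "\<dots> \<subseteq> X" using True by (intro set_add_least X) auto
      finally show False using step.hyps(3) by blast
    qed
    then have "has_chain R M B (Suc q) (Y <+>\<^bsub>M\<^esub> B)"
      using has_chain.step[OF pq(3) sY(2)] le by blast
    moreover have "has_chain R M C p (Y \<inter> B)" using True pq by simp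
    moreover have "Suc n \<le> p + Suc q" using pq by simp
    ultimately show ?thesis by blast
  next
    case False
    then have "has_chain R M C (Suc p) (Y \<inter> B)"
      using has_chain.step[OF pq(2) sY(1)] le by blast
    moreover have "has_chain R M B q (Y <+>\<^bsub>M\<^esub> B)" by (rule has_chain_mono[OF pq(3) le(2) sY(2)])
    moreover have "Suc n \<le> Suc p + q" using pq by simp
    ultimately show ?thesis by blast
  qed
qed

lemma rel_length_add:
  assumes "sm C" "sm B" "sm A" "C \<subseteq> B" "B \<subseteq> A"
  shows "rel_length R M C A = rel_length R M C B + rel_length R M B A"
proof (rule antisym; rule enat_le_all)
  fix n assume "enat n \<le> rel_length R M C A"
  then have "has_chain R M C n A" using enat_le_rel_length_iff[of A R M C] assms by auto
  then obtain p q where pq: "n \<le> p + q" "has_chain R M C p (A \<inter> B)" "has_chain R M B q (A <+>\<^bsub>M\<^esub> B)"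
    using has_chain_split[OF _ assms(1,2,4)] by blast
  have "A \<inter> B = B" using assms by auto
  moreover have "A <+>\<^bsub>M\<^esub> B \<subseteq> A" using assms by (intro set_add_least) auto
  ultimately have "has_chain R M C p B" "has_chain R M B q A"
    using pq has_chain_mono[OF pq(3), of A] assms by simp_all
  then have "enat p \<le> rel_length R M C B" "enat q \<le> rel_length R M B A"
    using enat_le_rel_length_iff[of B R M C p] enat_le_rel_length_iff[of A R M B q] assms by simp_all
  then have "enat p + enat q \<le> rel_length R M C B + rel_length R M B A"
    by (rule add_mono)
  then have "enat (p + q) \<le> rel_length R M C B + rel_length R M B A" by simp
  then show "enat n \<le> rel_length R M C B + rel_length R M B A"
    using pq(1) by (meson enat_ord_simps(1) order.trans)
next
  fix n assume n: "enat n \<le> rel_length R M C B + rel_length R M B A"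
  have "\<exists>p q. n \<le> p + q \<and> enat p \<le> rel_length R M C B \<and> enat q \<le> rel_length R M B A"
  proof (cases "rel_length R M C B")
    case (enat p)
    show ?thesis
    proof (cases "rel_length R M B A")
      fix q assume "rel_length R M B A = enat q"
      then show ?thesis using enat n by auto
    next
      assume "rel_length R M B A = \<infinity>"
      then show ?thesis using enat by (intro exI[of _ p] exI[of _ n]) auto
    qed
  next
    case infinity
    then show ?thesis by (intro exI[of _ n] exI[of _ 0]) (auto simp: zero_enat_def[symmetric])
  qed
  then obtain p q where "n \<le> p + q" "has_chain R M C p B" "has_chain R M B q A"
    using enat_le_rel_length_iff[of B R M C] enat_le_rel_length_iff[of A R M B] assms by auto
  then have "has_chain R M C n A" using has_chain_le[OF has_chain_append] by blast
  then show "enat n \<le> rel_length R M C A" using enat_le_rel_length_iff[of A R M C n] assms by simp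
qed

lemma rel_length_mono:
  assumes "sm C" "sm C'" "sm A" "sm A'" "C \<subseteq> C'" "C' \<subseteq> A'" "A' \<subseteq> A"
  shows "rel_length R M C' A' \<le> rel_length R M C A"
  using assms by (intro rel_length_le_map[where f = "\<lambda>X. X"]) auto

lemma rel_length_self: "sm A \<Longrightarrow> rel_length R M A A = 0"
proof -
  assume A: "sm A"
  have "\<not> enat 1 \<le> rel_length R M A A"
  proof
    assume "enat 1 \<le> rel_length R M A A"
    then have "has_chain R M A (Suc 0) A" using enat_le_rel_length_iff[of A R M A "Suc 0"] A by simp
    then show False
    proof cases
      case (step B)
      then show False using has_chain_submodule[OF step(1)] by auto
    qed
  qed
  then show ?thesis by (metis enat_0_iff(2) ileI1 iless_eSuc0 one_eSuc one_enat_def not_le)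
qed

lemma rel_length_eq_0:
  assumes "sm A" "sm C" "C \<subseteq> A" "rel_length R M C A = 0" shows "C = A"
proof (rule ccontr)
  assume "C \<noteq> A"
  then have "C \<subset> A" using assms by simp
  then have "has_chain R M C (Suc 0) A" using has_chain.step[OF has_chain.base[OF assms(2) order.refl] assms(1)] by simp
  then have "enat (Suc 0) \<le> rel_length R M C A" using enat_le_rel_length_iff[OF assms(1,3)] by simp
  then show False using assms(4) by (simp add: zero_enat_def)
qed

lemma set_add_comm: assumes "sm A" "sm B" shows "A <+>\<^bsub>M\<^esub> B = B <+>\<^bsub>M\<^esub> A"
  using set_add_upper1[OF assms] set_add_upper2[OF assms] set_add_upper1[OF assms(2,1)] set_add_upper2[OF assms(2,1)]
    sm_set_add[OF assms] sm_set_add[OF assms(2,1)] by (intro equalityI set_add_least)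

text \<open>Intersecting with \<open>A\<close> and adding \<open>B\<close> map the two intervals
  into each other, and the modular law makes both maps strictly monotone.\<close>

lemma rel_length_second_iso:
  assumes "sm A" "sm B"
  shows "rel_length R M B (A <+>\<^bsub>M\<^esub> B) = rel_length R M (A \<inter> B) A"
proof (rule antisym)
  show "rel_length R M B (A <+>\<^bsub>M\<^esub> B) \<le> rel_length R M (A \<inter> B) A"
  proof (rule rel_length_le_map[where f = "\<lambda>X. X \<inter> A"])
    fix X Y assume *: "sm X" "sm Y" "B \<subseteq> X" "X \<subset> Y" "Y \<subseteq> A <+>\<^bsub>M\<^esub> B"
    have "Y \<subseteq> B <+>\<^bsub>M\<^esub> (A \<inter> Y)"
    proof (rule modular_law)
      show "Y \<subseteq> B <+>\<^bsub>M\<^esub> A" using *(5) set_add_comm[OF assms] by simp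
    qed (use * assms in simp_all)
    moreover have False if "X \<inter> A = Y \<inter> A"
    proof -
      have "A \<inter> Y \<subseteq> X" using that by (simp add: Int_commute[of A Y]) (simp flip: that)
      then have "B <+>\<^bsub>M\<^esub> (A \<inter> Y) \<subseteq> X" using set_add_least[OF *(1,3)] by simp
      then show False using *(4) \<open>Y \<subseteq> B <+>\<^bsub>M\<^esub> (A \<inter> Y)\<close> by blast
    qed
    ultimately show "X \<inter> A \<subset> Y \<inter> A" using *(4) by blast
  next
    fix X assume "sm X" "B \<subseteq> X" "X \<subseteq> A <+>\<^bsub>M\<^esub> B"
    then show "sm (X \<inter> A) \<and> A \<inter> B \<subseteq> X \<inter> A" using sm_Int[OF _ assms(1)] by auto
  qed (use assms sm_set_add[OF assms] set_add_upper2[OF assms] in simp_all)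
  show "rel_length R M (A \<inter> B) A \<le> rel_length R M B (A <+>\<^bsub>M\<^esub> B)"
  proof (rule rel_length_le_map[where f = "\<lambda>X. X <+>\<^bsub>M\<^esub> B"])
    fix X Y assume *: "sm X" "sm Y" "A \<inter> B \<subseteq> X" "X \<subset> Y" "Y \<subseteq> A"
    have "False" if "X <+>\<^bsub>M\<^esub> B = Y <+>\<^bsub>M\<^esub> B"
    proof -
      have "Y \<subseteq> X <+>\<^bsub>M\<^esub> B" using that set_add_upper1[of Y B] * assms by simp
      then have "Y \<subseteq> X <+>\<^bsub>M\<^esub> (B \<inter> Y)" using modular_law[of X B Y] * assms by simp
      also have "\<dots> \<subseteq> X" using *(3,5) by (intro set_add_least[OF *(1)]) auto
      finally show False using *(4) by simp
    qed
    then show "X <+>\<^bsub>M\<^esub> B \<subset> Y <+>\<^bsub>M\<^esub> B" using set_add_mono[of X Y B B] *(4) by auto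
  next
    fix X assume X: "sm X"
    then show "sm (X <+>\<^bsub>M\<^esub> B) \<and> B \<subseteq> X <+>\<^bsub>M\<^esub> B"
      using sm_set_add[OF X assms(2)] set_add_upper2[OF X assms(2)] by simp
  qed (use assms sm_set_add[OF assms] sm_Int[OF assms] in simp_all)
qed

text \<open>Multiplication by \<open>x\<close> induces an isomorphism from
  \<open>A / (A \<inter> (C : x))\<close> onto \<open>(xA + C) / C\<close>. For graded pairs this
  compares the kernel of a variable with its image.\<close>

lemma rel_length_scale:
  assumes "sm A" "sm C" "x \<in> carrier R"
  shows "rel_length R M (A \<inter> colon C x) A = rel_length R M C (scale x A <+>\<^bsub>M\<^esub> C)"
proof -
  have sA: "sm (scale x A)" using assms sm_scale by blast
  have 1: "rel_length R M C (scale x A <+>\<^bsub>M\<^esub> C) = rel_length R M (scale x A \<inter> C) (scale x A)"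
    using rel_length_second_iso[OF sA assms(2)] .
  have sc: "scale x (A \<inter> colon Y x) = scale x A \<inter> Y" for Y
    using sm_carr[OF assms(1)] unfolding colon_def by auto
  \<comment> \<open>Such a \<open>Y\<close> contains the kernel of \<open>x\<close> on
    \<open>A\<close>, because zero lies in \<open>C\<close>; hence it can be recovered from its
    image.\<close>
  have co: "Y = A \<inter> colon (scale x Y) x" if Y: "sm Y" "A \<inter> colon C x \<subseteq> Y" "Y \<subseteq> A" for Y
  proof
    show "Y \<subseteq> A \<inter> colon (scale x Y) x" using Y(3) sm_carr[OF Y(1)] unfolding colon_def by auto
    show "A \<inter> colon (scale x Y) x \<subseteq> Y"
    proof
      fix a assume "a \<in> A \<inter> colon (scale x Y) x"
      then obtain y where y: "a \<in> A" "y \<in> Y" "x \<odot>\<^bsub>M\<^esub> a = x \<odot>\<^bsub>M\<^esub> y" by (auto simp: colon_def)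
      have yA: "y \<in> A" using y(2) Y(3) by auto
      have c: "a \<in> carrier M" "y \<in> carrier M" using sm_carr[OF assms(1)] y(1) yA by simp_all
      have "x \<odot>\<^bsub>M\<^esub> (a \<ominus>\<^bsub>M\<^esub> y) = \<zero>\<^bsub>M\<^esub>"
        using c y(3) assms by (simp add: M.minus_eq smult_r_distr smult_r_minus M.r_neg)
      then have "a \<ominus>\<^bsub>M\<^esub> y \<in> A \<inter> colon C x"
        using y(1) yA c sm_zero[OF assms(2)] sm_diff[OF assms(1)] by (simp add: colon_def)
      then have "(a \<ominus>\<^bsub>M\<^esub> y) \<oplus>\<^bsub>M\<^esub> y \<in> Y" using sm_add[OF Y(1) _ y(2)] Y(2) by (simp add: subset_iff)
      then show "a \<in> Y" using c by (simp add: M.minus_eq M.a_assoc M.l_neg)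
    qed
  qed
  have "rel_length R M (A \<inter> colon C x) A \<le> rel_length R M (scale x A \<inter> C) (scale x A)"
  proof (rule rel_length_le_map[where f = "scale x"])
    fix X assume X: "sm X" "A \<inter> colon C x \<subseteq> X" "X \<subseteq> A"
    show "sm (scale x X) \<and> scale x A \<inter> C \<subseteq> scale x X"
      using image_mono[OF X(2), of "\<lambda>a. x \<odot>\<^bsub>M\<^esub> a"] sc[of C] sm_scale[OF X(1) assms(3)] by simp
  next
    fix X Y assume X: "sm X" "sm Y" "A \<inter> colon C x \<subseteq> X" "X \<subset> Y" "Y \<subseteq> A"
    have "X = A \<inter> colon (scale x X) x" by (rule co[OF X(1,3)]) (use X(4,5) in auto)
    moreover have "Y = A \<inter> colon (scale x Y) x" by (rule co[OF X(2) _ X(5)]) (use X(3,4) in auto)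
    ultimately have "scale x X \<noteq> scale x Y" using X(4) by auto
    then show "scale x X \<subset> scale x Y" using X(4) by (simp add: psubset_eq image_mono)
  qed (use assms sA sm_Int[OF assms(1) sm_colon[OF assms(2,3)]] in simp_all)
  moreover have "rel_length R M (scale x A \<inter> C) (scale x A) \<le> rel_length R M (A \<inter> colon C x) A"
  proof (rule rel_length_le_map[where f = "\<lambda>Y. A \<inter> colon Y x"])
    fix X assume X: "sm X" "scale x A \<inter> C \<subseteq> X" "X \<subseteq> scale x A"
    show "sm (A \<inter> colon X x) \<and> A \<inter> colon C x \<subseteq> A \<inter> colon X x"
    proof
      show "sm (A \<inter> colon X x)" by (rule sm_Int[OF assms(1) sm_colon[OF X(1) assms(3)]])
      show "A \<inter> colon C x \<subseteq> A \<inter> colon X x" using X(2) unfolding colon_def by auto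
    qed
  next
    fix X Y assume X: "sm X" "sm Y" "scale x A \<inter> C \<subseteq> X" "X \<subset> Y" "Y \<subseteq> scale x A"
    have "X = scale x (A \<inter> colon X x)" "Y = scale x (A \<inter> colon Y x)"
      unfolding sc using X(4,5) by auto
    then have "A \<inter> colon X x \<noteq> A \<inter> colon Y x" using X(4) by auto
    moreover have "A \<inter> colon X x \<subseteq> A \<inter> colon Y x" using X(4) unfolding colon_def by auto
    ultimately show "A \<inter> colon X x \<subset> A \<inter> colon Y x" by auto
  qed (use assms sA sm_Int[OF sA assms(2)] in simp_all)
  ultimately show ?thesis using 1 by auto
qed

section \<open>Ascending chains, and multiplication by a list of generators\<close>

definition acc :: "'c set \<Rightarrow> bool" where
  "acc T \<longleftrightarrow> (\<forall>N. (\<forall>i::nat. sm (N i) \<and> N i \<subseteq> T \<and> N i \<subseteq> N (Suc i)) \<longrightarrow> (\<exists>k. \<forall>i\<ge>k. N i = N k))"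

text \<open>Noetherian induction: if \<open>P\<close> failed at \<open>A\<close>, choosing a
  strictly larger counterexample again and again would produce a sequence that never becomes
  stationary.\<close>

lemma acc_induct:
  assumes "acc T" "sm A" "A \<subseteq> T"
    and step: "\<And>A. sm A \<Longrightarrow> A \<subseteq> T \<Longrightarrow> (\<And>B. sm B \<Longrightarrow> B \<subseteq> T \<Longrightarrow> A \<subset> B \<Longrightarrow> P B) \<Longrightarrow> P A"
  shows "P A"
proof (rule ccontr)
  assume "\<not> P A"
  let ?Q = "\<lambda>A. sm A \<and> A \<subseteq> T \<and> \<not> P A"
  define N where "N = rec_nat A (\<lambda>_ X. SOME B. ?Q B \<and> X \<subset> B)"
  have N: "N 0 = A" "N (Suc n) = (SOME B. ?Q B \<and> N n \<subset> B)" for n by (simp_all add: N_def)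
  have Q: "?Q (N n)" for n
  proof (induction n)
    case 0 then show ?case using N assms \<open>\<not> P A\<close> by simp
  next
    case (Suc n)
    then have "\<exists>B. ?Q B \<and> N n \<subset> B" using step by blast
    then show ?case unfolding N by (rule someI2_ex) auto
  qed
  have S: "N n \<subset> N (Suc n)" for n
  proof -
    have "\<exists>B. ?Q B \<and> N n \<subset> B" using step Q by blast
    then show ?thesis unfolding N(2) by (rule someI2_ex) auto
  qed
  have "sm (N i) \<and> N i \<subseteq> T \<and> N i \<subseteq> N (Suc i)" for i using Q[of i] S[of i] by simp
  then have "\<exists>k. \<forall>i\<ge>k. N i = N k" using assms(1)[unfolded acc_def, THEN spec, of N] by simp
  then obtain k where k: "\<forall>i\<ge>k. N i = N k" ..
  have "N (Suc k) = N k" by (rule k[rule_format]) simp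
  then show False using S[of k] by auto
qed

text \<open>For a submodule \<open>A\<close> and an ideal \<open>I\<close> generated by
  \<open>xs\<close> this is \<open>I A\<close>. Keeping the generators as a list allows induction on
  the number of variables.\<close>

primrec list_smult :: "'a list \<Rightarrow> 'c set \<Rightarrow> 'c set" where
  "list_smult [] A = {\<zero>\<^bsub>M\<^esub>}"
| "list_smult (x # xs) A = scale x A <+>\<^bsub>M\<^esub> list_smult xs A"

lemma sm_list_smult: "set xs \<subseteq> carrier R \<Longrightarrow> sm A \<Longrightarrow> sm (list_smult xs A)"
  by (induction xs) (simp_all add: sm_zero_sub sm_set_add sm_scale)

lemma list_smult_mono: "A \<subseteq> B \<Longrightarrow> list_smult xs A \<subseteq> list_smult xs B"
proof (induction xs)
  case (Cons x xs)
  then show ?case unfolding list_smult.simps by (intro set_add_mono image_mono)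
qed simp

lemma scale_sub_list_smult:
  "set xs \<subseteq> carrier R \<Longrightarrow> sm A \<Longrightarrow> x \<in> set xs \<Longrightarrow> scale x A \<subseteq> list_smult xs A"
proof (induction xs)
  case (Cons y xs)
  have s: "sm (scale y A)" "sm (list_smult xs A)" using Cons.prems by (simp_all add: sm_scale sm_list_smult)
  show ?case
  proof (cases "x = y")
    case True then show ?thesis using set_add_upper1[OF s] by simp
  next
    case False
    then have "scale x A \<subseteq> list_smult xs A" using Cons by simp
    also have "\<dots> \<subseteq> list_smult (y # xs) A" using set_add_upper2[OF s] by simp
    finally show ?thesis .
  qed
qed simp

lemma list_smult_least:
  "sm D \<Longrightarrow> (\<And>x. x \<in> set xs \<Longrightarrow> scale x A \<subseteq> D) \<Longrightarrow> list_smult xs A \<subseteq> D"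
proof (induction xs)
  case (Cons y xs)
  then show ?case unfolding list_smult.simps by (intro set_add_least[OF Cons.prems(1)]) simp_all
qed simp

lemma scale_list_smult:
  assumes "sm A" "set xs \<subseteq> carrier R" "x \<in> carrier R"
  shows "scale x (list_smult xs A) = list_smult xs (scale x A)"
  using assms(2)
proof (induction xs)
  case Nil
  then show ?case using assms by simp
next
  case (Cons y xs)
  then show ?case using assms scale_set_add[of "scale y A" "list_smult xs A" x] scale_comm[of A x y]
    by (simp add: sm_scale sm_list_smult)
qed

lemma list_smult_set_add:
  assumes "sm A" "sm B" "set xs \<subseteq> carrier R"
  shows "list_smult xs (A <+>\<^bsub>M\<^esub> B) \<subseteq> list_smult xs A <+>\<^bsub>M\<^esub> list_smult xs B"
proof (rule list_smult_least)
  show "sm (list_smult xs A <+>\<^bsub>M\<^esub> list_smult xs B)" using assms by (intro sm_set_add sm_list_smult)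
  fix x assume "x \<in> set xs"
  then show "scale x (A <+>\<^bsub>M\<^esub> B) \<subseteq> list_smult xs A <+>\<^bsub>M\<^esub> list_smult xs B"
    using set_add_mono[OF scale_sub_list_smult[OF assms(3,1)] scale_sub_list_smult[OF assms(3,2)], of x x]
      scale_set_add[OF assms(1,2), of x] assms(3) by auto
qed

end

section \<open>Graded submodules and their Hilbert functions\<close>

context module
begin

text \<open>The sum of all multiples of \<open>A\<close> by monomials of degree \<open>n\<close> in
  \<open>xs\<close>, that is, degree \<open>n\<close> of the graded module generated by
  \<open>A\<close> in degree zero. For \<open>A\<close> the ring and \<open>xs\<close> generators of
  \<open>I\<close> it is \<open>I^n\<close>.\<close>

primrec graded_span :: "'a list \<Rightarrow> 'c set \<Rightarrow> nat \<Rightarrow> 'c set" where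
  "graded_span xs A 0 = A"
| "graded_span xs A (Suc n) = list_smult xs (graded_span xs A n)"

lemma sm_graded_span: "set xs \<subseteq> carrier R \<Longrightarrow> sm A \<Longrightarrow> sm (graded_span xs A n)"
  by (induction n) (simp_all add: sm_list_smult)

lemma graded_span_closed:
  "set xs \<subseteq> carrier R \<Longrightarrow> sm A \<Longrightarrow> y \<in> set xs \<Longrightarrow> scale y (graded_span xs A n) \<subseteq> graded_span xs A (Suc n)"
  by (simp add: scale_sub_list_smult sm_graded_span)

text \<open>\<open>low_part x H j n\<close> is the sum of the \<open>x^i H (n - i)\<close> over all \<open>i < j\<close> with \<open>i \<le> n\<close>.\<close>

primrec low_part :: "'a \<Rightarrow> (nat \<Rightarrow> 'c set) \<Rightarrow> nat \<Rightarrow> nat \<Rightarrow> 'c set" where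
  "low_part x H 0 n = {\<zero>\<^bsub>M\<^esub>}"
| "low_part x H (Suc j) n = H n <+>\<^bsub>M\<^esub> (if n = 0 then {\<zero>\<^bsub>M\<^esub>} else scale x (low_part x H j (n - 1)))"

lemma sm_low_part: "x \<in> carrier R \<Longrightarrow> (\<And>n. sm (H n)) \<Longrightarrow> sm (low_part x H j n)"
  by (induction j arbitrary: n) (simp_all add: sm_zero_sub sm_set_add sm_scale)

lemma low_part_closed:
  assumes "x \<in> carrier R" "y \<in> carrier R" "\<And>n. sm (H n)" "\<And>n. scale y (H n) \<subseteq> H (Suc n)"
  shows "scale y (low_part x H j n) \<subseteq> low_part x H j (Suc n)"
proof (induction j arbitrary: n)
  case 0 then show ?case using assms(2) by simp
next
  case (Suc j)
  have s: "sm (low_part x H j n)" for n using sm_low_part assms by simp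
  have z: "sm (if n = 0 then {\<zero>\<^bsub>M\<^esub>} else scale x (low_part x H j (n - 1)))"
    using s assms(1) by (simp add: sm_zero_sub sm_scale)
  have "scale y (if n = 0 then {\<zero>\<^bsub>M\<^esub>} else scale x (low_part x H j (n - 1))) \<subseteq> scale x (low_part x H j n)"
  proof (cases n)
    case 0
    then show ?thesis using assms(2) sm_zero[OF sm_scale[OF s assms(1)]] by simp
  next
    case (Suc k)
    then show ?thesis using image_mono[OF Suc.IH[of k], of "\<lambda>a. x \<odot>\<^bsub>M\<^esub> a"] scale_comm[OF s assms(2,1)] by simp
  qed
  then show ?case
    unfolding low_part.simps scale_set_add[OF assms(3) z assms(2)] using assms(4)
    by (simp add: set_add_mono)
qed

lemma scale_low_part:
  assumes "x \<in> carrier R" "\<And>n. sm (H n)"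
  shows "scale x (low_part x H j n) \<subseteq> low_part x H (Suc j) (Suc n)"
  using set_add_upper2[OF assms(2)[of "Suc n"] sm_scale[OF sm_low_part[where H = H and j = j and n = n, OF assms] assms(1)]]
  by simp

lemma low_part_mono:
  assumes "x \<in> carrier R" "\<And>n. sm (H n)"
  shows "low_part x H j n \<subseteq> low_part x H (Suc j) n"
proof (induction j arbitrary: n)
  case 0
  then show ?case using sm_zero[OF sm_low_part[where H = H and j = "Suc 0" and n = n, OF assms]] by simp
next
  case (Suc j)
  have "(if n = 0 then {\<zero>\<^bsub>M\<^esub>} else scale x (low_part x H j (n - 1)))
      \<subseteq> (if n = 0 then {\<zero>\<^bsub>M\<^esub>} else scale x (low_part x H (Suc j) (n - 1)))"
    using image_mono[OF Suc.IH[of "n - 1"], of "\<lambda>a. x \<odot>\<^bsub>M\<^esub> a"] by (simp del: low_part.simps)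
  then show ?case
    by (subst (1 2) low_part.simps(2)) (rule set_add_mono[OF order.refl])
qed

lemma set_add_assoc:
  assumes "sm A" "sm B" "sm C"
  shows "A <+>\<^bsub>M\<^esub> (B <+>\<^bsub>M\<^esub> C) \<subseteq> (A <+>\<^bsub>M\<^esub> B) <+>\<^bsub>M\<^esub> C"
proof (rule set_add_least)
  have AB: "sm (A <+>\<^bsub>M\<^esub> B)" by (rule sm_set_add[OF assms(1,2)])
  show "sm ((A <+>\<^bsub>M\<^esub> B) <+>\<^bsub>M\<^esub> C)" by (rule sm_set_add[OF AB assms(3)])
  show "A \<subseteq> (A <+>\<^bsub>M\<^esub> B) <+>\<^bsub>M\<^esub> C"
    using set_add_upper1[OF AB assms(3)] set_add_upper1[OF assms(1,2)] by (rule order.trans[rotated])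
  show "B <+>\<^bsub>M\<^esub> C \<subseteq> (A <+>\<^bsub>M\<^esub> B) <+>\<^bsub>M\<^esub> C"
    using set_add_upper2[OF assms(1,2)] by (intro set_add_mono) simp_all
qed

text \<open>The recursion of \<open>low_part\<close> is in Horner form and splits off the lowest
  power of \<open>x\<close>, whereas a leading coefficient argument needs the highest one. The
  condition \<open>j \<le> n\<close> keeps the subtraction \<open>n - j\<close> genuine.\<close>

lemma low_part_Suc:
  assumes "x \<in> carrier R" "\<And>n. sm (H n)" "j \<le> n"
  shows "low_part x H (Suc j) n \<subseteq> low_part x H j n <+>\<^bsub>M\<^esub> scale (x [^]\<^bsub>R\<^esub> j) (H (n - j))"
  using assms(3)
proof (induction j arbitrary: n)
  case 0
  have one: "scale \<one> (H n) = H n"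
    using sm_carr[OF assms(2)] by force
  have "(if n = 0 then {\<zero>\<^bsub>M\<^esub>} else scale x (low_part x H 0 (n - 1))) \<subseteq> H n"
    using sm_zero[OF assms(2)] assms(1) by simp
  then have "low_part x H (Suc 0) n \<subseteq> H n"
    unfolding low_part.simps(2) by (intro set_add_least assms(2) order.refl)
  also have "\<dots> \<subseteq> low_part x H 0 n <+>\<^bsub>M\<^esub> H n"
    using set_add_upper2[OF sm_zero_sub assms(2)] by simp
  finally show ?case using one by simp
next
  case (Suc j)
  then obtain k where k: "n = Suc k" "j \<le> k" by (cases n) auto
  have sL: "sm (low_part x H j n)" for n j by (rule sm_low_part[where H = H, OF assms(1,2)])
  have xj: "x [^] j \<in> carrier R" using assms(1) by simp
  have sH: "sm (scale (x [^] j) (H (k - j)))" by (rule sm_scale[OF assms(2) xj])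
  have e: "scale x (scale (x [^] j) (H (k - j))) = scale (x [^] Suc j) (H (n - Suc j))"
    unfolding image_image using k assms(1) sm_carr[OF assms(2)]
    by (intro image_cong) (simp_all add: smult_assoc1[symmetric] R.m_comm)
  have "low_part x H (Suc (Suc j)) n = H n <+>\<^bsub>M\<^esub> scale x (low_part x H (Suc j) k)" using k by simp
  also have "\<dots> \<subseteq> H n <+>\<^bsub>M\<^esub> scale x (low_part x H j k <+>\<^bsub>M\<^esub> scale (x [^] j) (H (k - j)))"
    by (intro set_add_mono image_mono order.refl Suc.IH k)
  also have "\<dots> = H n <+>\<^bsub>M\<^esub> (scale x (low_part x H j k) <+>\<^bsub>M\<^esub> scale (x [^] Suc j) (H (n - Suc j)))"
    using scale_set_add[OF sL sH assms(1)] e by simp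
  also have "\<dots> \<subseteq> (H n <+>\<^bsub>M\<^esub> scale x (low_part x H j k)) <+>\<^bsub>M\<^esub> scale (x [^] Suc j) (H (n - Suc j))"
    using set_add_assoc[OF assms(2) sm_scale[OF sL assms(1)] sm_scale[OF sH assms(1)]] e by simp
  also have "H n <+>\<^bsub>M\<^esub> scale x (low_part x H j k) = low_part x H (Suc j) n" using k by simp
  finally show ?case .
qed

text \<open>A monomial of degree \<open>n\<close> in \<open>x # xs\<close> contains \<open>x\<close>
  at most \<open>n\<close> times, so the powers below \<open>n + 1\<close> exhaust it.\<close>

lemma graded_span_Cons_low_part:
  assumes "x \<in> carrier R" "set xs \<subseteq> carrier R" "sm A"
  shows "graded_span (x # xs) A n \<subseteq> low_part x (graded_span xs A) (Suc n) n"
proof (induction n)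
  case 0
  show ?case using set_add_upper1[OF assms(3) sm_zero_sub] by simp
next
  case (Suc n)
  let ?H = "graded_span xs A"
  have H: "sm (?H n)" for n by (rule sm_graded_span[OF assms(2,3)])
  have "scale y (graded_span (x # xs) A n) \<subseteq> low_part x ?H (Suc (Suc n)) (Suc n)" if y: "y \<in> set (x # xs)" for y
  proof -
    have 1: "scale y (graded_span (x # xs) A n) \<subseteq> scale y (low_part x ?H (Suc n) n)" by (rule image_mono[OF Suc.IH])
    also have "\<dots> \<subseteq> low_part x ?H (Suc (Suc n)) (Suc n)"
    proof (cases "y = x")
      case True then show ?thesis using scale_low_part[where H = ?H, OF assms(1) H] by blast
    next
      case False
      then have y': "y \<in> set xs" "y \<in> carrier R" using y assms(2) by auto
      have "scale y (low_part x ?H (Suc n) n) \<subseteq> low_part x ?H (Suc n) (Suc n)"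
        using low_part_closed[where H = ?H, OF assms(1) y'(2) H graded_span_closed[OF assms(2,3) y'(1)]] .
      also have "\<dots> \<subseteq> low_part x ?H (Suc (Suc n)) (Suc n)" by (rule low_part_mono[OF assms(1) H])
      finally show ?thesis .
    qed
    finally show ?thesis .
  qed
  then show ?case unfolding graded_span.simps by (intro list_smult_least sm_low_part[OF assms(1) H])
qed

lemma acc_chain:
  assumes "acc T" "\<And>i. sm (N i)" "\<And>i. N i \<subseteq> T" "\<And>i. N i \<subseteq> N (Suc i)"
  shows "\<exists>k. \<forall>i. N i \<subseteq> N k"
proof -
  have "\<exists>k. \<forall>i\<ge>k. N i = N k" using assms(1)[unfolded acc_def, THEN spec, of N] assms(2-4) by simp
  then obtain k where k: "\<forall>i\<ge>k. N i = N k" ..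
  have "N i \<subseteq> N k" for i
    using lift_Suc_mono_le[of N, OF assms(4)] k[rule_format, of i] by (cases "i \<le> k") auto
  then show ?thesis by blast
qed

text \<open>A graded form of Hilbert's basis theorem: with \<open>x # xs\<close> in place of the variables, the submodules \<open>L j m\<close>
  of leading coefficients of \<open>x^j\<close> increase with \<open>j\<close>, and become stationary uniformly in the degree \<open>m\<close>.\<close>

theorem graded_noetherian:
  assumes "acc (carrier M)" "set xs \<subseteq> carrier R" "sm A"
    and "\<And>n. sm (N n)" "\<And>n. N n \<subseteq> graded_span xs A n"
    and "\<And>n x. x \<in> set xs \<Longrightarrow> scale x (N n) \<subseteq> N (Suc n)"
  shows "\<exists>c. \<forall>n\<ge>c. N (Suc n) \<subseteq> list_smult xs (N n)"
  using assms(2,4-)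
proof (induction xs arbitrary: N)
  case Nil
  have "N (Suc n) \<subseteq> list_smult [] (N n)" for n using Nil.prems(3)[of "Suc n"] by simp
  then show ?case by blast
next
  case (Cons x xs)
  have x: "x \<in> carrier R" and xs: "set xs \<subseteq> carrier R" using Cons.prems by auto
  have xj: "x [^] (j::nat) \<in> carrier R" for j using x by simp
  define H where "H = graded_span xs A"
  have H: "sm (H n)" for n unfolding H_def by (rule sm_graded_span[OF xs assms(3)])
  let ?U = "low_part x H"
  have U: "sm (?U j n)" for j n by (rule sm_low_part[OF x H])
  have N: "sm (N n)" for n by (rule Cons.prems(2))
  have NU: "sm (N n <+>\<^bsub>M\<^esub> ?U j n)" for j n by (rule sm_set_add[OF N U])
  have x_NU: "scale x (N n <+>\<^bsub>M\<^esub> ?U j n) \<subseteq> scale x (N n) <+>\<^bsub>M\<^esub> ?U (Suc j) (Suc n)" for j n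
    unfolding scale_set_add[OF N U x] by (intro set_add_mono order.refl scale_low_part[OF x H])
  have y_U: "scale y (?U j n) \<subseteq> ?U j (Suc n)" if "y \<in> set xs" for y j n
  proof (rule low_part_closed[where H = H, OF x _ H])
    show "y \<in> carrier R" using that xs by auto
    show "scale y (H n) \<subseteq> H (Suc n)" for n unfolding H_def by (rule graded_span_closed[OF xs assms(3) that])
  qed
  have y_NU: "scale y (N n <+>\<^bsub>M\<^esub> ?U j n) \<subseteq> N (Suc n) <+>\<^bsub>M\<^esub> ?U j (Suc n)" if "y \<in> set xs" for y j n
    unfolding scale_set_add[OF N U subsetD[OF xs that]]
    using that by (intro set_add_mono y_U Cons.prems(4)) simp_all
  \<comment> \<open>\<open>h\<close> of degree \<open>m\<close> belongs to \<open>L j m\<close> when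
    some element of \<open>N (m + j)\<close> has the form \<open>x^j h\<close> plus terms of lower
    degree in \<open>x\<close>. Since relations between the variables make such forms ambiguous, the
    condition is put on \<open>x^j h\<close> modulo \<open>low_part\<close> instead of reading off a
    coefficient.\<close>
  define L where "L j m = H m \<inter> colon (N (m + j) <+>\<^bsub>M\<^esub> ?U j (m + j)) (x [^] j)" for j m :: nat
  have L: "sm (L j m)" for j m unfolding L_def by (intro sm_Int H sm_colon NU xj)
  have LH: "L j m \<subseteq> H m" for j m unfolding L_def by blast
  have L_iff: "scale (x [^] j) (L j m) \<subseteq> N (m + j) <+>\<^bsub>M\<^esub> ?U j (m + j)" for j m
    unfolding scale_subset_iff[OF L] unfolding L_def by blast
  have x_assoc: "scale (x [^] Suc j) (L i m) = scale x (scale (x [^] j) (L i m))" for i j m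
    unfolding image_image using x sm_carr[OF L]
    by (intro image_cong) (simp_all add: smult_assoc1[symmetric] R.m_comm)
  \<comment> \<open>Multiplying an element of \<open>N\<close> by \<open>x\<close> raises both
    degrees by one and keeps the leading coefficient.\<close>
  have L_Suc: "L j m \<subseteq> L (Suc j) m" for j m
  proof -
    have "scale (x [^] Suc j) (L j m) \<subseteq> scale x (N (m + j) <+>\<^bsub>M\<^esub> ?U j (m + j))"
      unfolding x_assoc by (rule image_mono[OF L_iff])
    also have "\<dots> \<subseteq> scale x (N (m + j)) <+>\<^bsub>M\<^esub> ?U (Suc j) (Suc (m + j))" by (rule x_NU)
    also have "\<dots> \<subseteq> N (Suc (m + j)) <+>\<^bsub>M\<^esub> ?U (Suc j) (Suc (m + j))"
      by (intro set_add_mono order.refl Cons.prems(4)) simp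
    finally have "L j m \<subseteq> colon (N (m + Suc j) <+>\<^bsub>M\<^esub> ?U (Suc j) (m + Suc j)) (x [^] Suc j)"
      unfolding scale_subset_iff[OF L] by simp
    then show ?thesis using LH unfolding L_def[of "Suc j"] by blast
  qed
  have L_mono: "L i m \<subseteq> L j m" if "i \<le> j" for i j m
    using lift_Suc_mono_le[of "\<lambda>j. L j m", OF L_Suc that] .
  have L_closed: "scale y (L j m) \<subseteq> L j (Suc m)" if y: "y \<in> set xs" for y j m
  proof -
    have yc: "y \<in> carrier R" using y xs by blast
    have "scale (x [^] j) (scale y (L j m)) = scale y (scale (x [^] j) (L j m))"
      by (rule scale_comm[OF L xj yc])
    also have "\<dots> \<subseteq> scale y (N (m + j) <+>\<^bsub>M\<^esub> ?U j (m + j))" by (rule image_mono[OF L_iff])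
    also have "\<dots> \<subseteq> N (Suc m + j) <+>\<^bsub>M\<^esub> ?U j (Suc m + j)" using y_NU[OF y] by simp
    finally have "scale y (L j m) \<subseteq> colon (N (Suc m + j) <+>\<^bsub>M\<^esub> ?U j (Suc m + j)) (x [^] j)"
      unfolding scale_subset_iff[OF sm_scale[OF L yc]] .
    moreover have "scale y (L j m) \<subseteq> H (Suc m)"
      using image_mono[OF LH] graded_span_closed[OF xs assms(3) y] unfolding H_def by (rule order.trans)
    ultimately show ?thesis unfolding L_def[of j "Suc m"] by blast
  qed
  have "\<exists>k. \<forall>i. L i m \<subseteq> L k m" for m
    by (rule acc_chain[OF assms(1)]) (use L L_Suc submoduleE(1)[OF L] in simp_all)
  then obtain J where J: "L i m \<subseteq> L (J m) m" for i m by metis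
  \<comment> \<open>The stable values, one in each degree \<open>n\<close>, form a graded submodule
    in one variable less, to which the induction hypothesis applies.\<close>
  have "\<exists>c. \<forall>n\<ge>c. L (J (Suc n)) (Suc n) \<subseteq> list_smult xs (L (J n) n)"
  proof (rule Cons.IH[OF xs])
    fix n y assume "y \<in> set xs"
    then have "scale y (L (J n) n) \<subseteq> L (J n) (Suc n)" by (rule L_closed)
    then show "scale y (L (J n) n) \<subseteq> L (J (Suc n)) (Suc n)" using J by (rule order.trans)
  qed (use L LH in \<open>simp_all add: H_def\<close>)
  then obtain c0 where c0: "\<And>n. n \<ge> c0 \<Longrightarrow> L (J (Suc n)) (Suc n) \<subseteq> list_smult xs (L (J n) n)" by blast
  \<comment> \<open>The sum is merely a common bound of the \<open>J m\<close> with
    \<open>m \<le> c0\<close>. In degrees above \<open>c0\<close> the stable value is generated by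
    the one a degree lower, so the same \<open>K\<close> works there by induction.\<close>
  define K where "K = (\<Sum>m\<le>c0. J m)"
  have K: "L i m \<subseteq> L K m" for i m
  proof (induction m arbitrary: i rule: less_induct)
    case (less m)
    show ?case
    proof (cases "m \<le> c0")
      case True
      then have "J m \<le> K" unfolding K_def by (intro member_le_sum) auto
      then show ?thesis using J[of i m] L_mono by (meson order.trans)
    next
      case False
      then obtain k where k: "m = Suc k" "k \<ge> c0" by (cases m) auto
      have "L i m \<subseteq> list_smult xs (L (J k) k)" using J[of i m] c0[OF k(2)] k(1) by auto
      also have "\<dots> \<subseteq> list_smult xs (L K k)" using less k by (intro list_smult_mono) simp
      also have "\<dots> \<subseteq> L K m" unfolding k using L_closed by (intro list_smult_least L)
      finally show ?thesis .
    qed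
  qed
  have "\<exists>c. \<forall>n\<ge>c. L j (Suc n) \<subseteq> list_smult xs (L j n)" for j
    by (rule Cons.IH[OF xs]) (use L LH L_closed in \<open>simp_all add: H_def\<close>)
  then obtain cf where cf: "\<And>j n. n \<ge> cf j \<Longrightarrow> L j (Suc n) \<subseteq> list_smult xs (L j n)" by metis
  \<comment> \<open>Again a common bound, and only for finitely many rows \<open>j\<close>: from row
    \<open>K\<close> on all rows agree.\<close>
  define c where "c = (\<Sum>j\<le>K. cf j)"
  have c: "cf j \<le> c" if "j \<le> K" for j unfolding c_def using that by (intro member_le_sum) auto
  \<comment> \<open>For a row \<open>j \<le> K\<close> this bound gives
    \<open>n - j \<ge> c\<close>, beyond the point from which the row is generated by
    \<open>xs\<close>.\<close>
  have main: "N (Suc n) \<subseteq> list_smult (x # xs) (N n)" if n: "n \<ge> c + K" for n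
  proof -
    let ?G = "scale x (N n) <+>\<^bsub>M\<^esub> list_smult xs (N n)"
    have sN: "sm (scale x (N n))" "sm (list_smult xs (N n))" by (rule sm_scale[OF N x], rule sm_list_smult[OF xs N])
    have G: "sm ?G" by (rule sm_set_add[OF sN])
    have GN: "?G \<subseteq> N (Suc n)"
      using Cons.prems(4) by (intro set_add_least N list_smult_least) simp_all
    \<comment> \<open>Each possible leading term in degree \<open>n + 1\<close> is matched by an
      element of \<open>?G\<close> up to lower terms in \<open>x\<close>. For
      \<open>j \<le> K\<close> the coefficient is generated by \<open>xs\<close> from degree
      \<open>n - j\<close> of the same row; for \<open>j > K\<close> it occurs already in row
      \<open>j - 1\<close>, and multiplication by \<open>x\<close> lifts it.\<close>
    have xG: "scale (x [^] j) (L j (Suc n - j)) \<subseteq> ?G <+>\<^bsub>M\<^esub> ?U j (Suc n)" if j: "j \<le> Suc n" for j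
    proof (cases "j \<le> K")
      case True
      define m where "m = n - j"
      have m: "Suc n - j = Suc m" "m + j = n" "cf j \<le> m" using True n c[OF True] unfolding m_def by auto
      have "L j (Suc m) \<subseteq> list_smult xs (L j m)" by (rule cf[OF m(3)])
      then have "scale (x [^] j) (L j (Suc m)) \<subseteq> scale (x [^] j) (list_smult xs (L j m))" by (rule image_mono)
      also have "\<dots> = list_smult xs (scale (x [^] j) (L j m))" by (rule scale_list_smult[OF L xs xj])
      also have "\<dots> \<subseteq> list_smult xs (N n <+>\<^bsub>M\<^esub> ?U j n)"
        using L_iff[of j m] m(2) by (intro list_smult_mono) simp
      also have "\<dots> \<subseteq> list_smult xs (N n) <+>\<^bsub>M\<^esub> list_smult xs (?U j n)" by (rule list_smult_set_add[OF N U xs])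
      also have "\<dots> \<subseteq> ?G <+>\<^bsub>M\<^esub> ?U j (Suc n)"
        by (intro set_add_mono set_add_upper2 sN list_smult_least U y_U)
      finally show ?thesis using m by simp
    next
      case False
      then obtain i where i: "j = Suc i" "K \<le> i" by (cases j) auto
      define m where "m = n - i"
      have m: "Suc n - j = m" "m + i = n" using i j unfolding m_def by auto
      have "L j m \<subseteq> L i m" using K[of j m] L_mono[OF i(2)] by (rule order.trans)
      then have "scale (x [^] Suc i) (L j m) \<subseteq> scale (x [^] Suc i) (L i m)" by (rule image_mono)
      also have "\<dots> \<subseteq> scale x (N n <+>\<^bsub>M\<^esub> ?U i n)" unfolding x_assoc using L_iff[of i m] m by (intro image_mono) simp
      also have "\<dots> \<subseteq> scale x (N n) <+>\<^bsub>M\<^esub> ?U j (Suc n)" using x_NU i by simp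
      also have "\<dots> \<subseteq> ?G <+>\<^bsub>M\<^esub> ?U j (Suc n)" by (intro set_add_mono set_add_upper1 sN order.refl)
      finally show ?thesis using m i by simp
    qed
    \<comment> \<open>Reduction of the degree in \<open>x\<close>: the leading term is cancelled by
      an element of \<open>?G\<close>, which lies in \<open>N (Suc n)\<close>, so the remainder
      stays in \<open>N (Suc n)\<close> and falls under the induction hypothesis.\<close>
    have "N (Suc n) \<inter> ?U j (Suc n) \<subseteq> ?G" if "j \<le> Suc (Suc n)" for j
      using that
    proof (induction j)
      case 0 then show ?case using sm_zero[OF G] by auto
    next
      case (Suc j)
      then have j: "j \<le> Suc n" by simp
      have "N (Suc n) \<inter> ?U (Suc j) (Suc n) \<subseteq> ?G <+>\<^bsub>M\<^esub> ?U j (Suc n)"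
      proof
        fix u assume u: "u \<in> N (Suc n) \<inter> ?U (Suc j) (Suc n)"
        then have "u \<in> ?U j (Suc n) <+>\<^bsub>M\<^esub> scale (x [^] j) (H (Suc n - j))"
          using low_part_Suc[where H = H, OF x H j] by blast
        then obtain w h where wh: "w \<in> ?U j (Suc n)" "h \<in> H (Suc n - j)" "u = w \<oplus>\<^bsub>M\<^esub> x [^] j \<odot>\<^bsub>M\<^esub> h"
          by (auto elim!: set_addE)
        have uN: "u \<in> N (Suc n)" using u by simp
        have car: "w \<in> carrier M" "h \<in> carrier M" "u \<in> carrier M"
          using sm_carr[OF U wh(1)] sm_carr[OF H wh(2)] sm_carr[OF N uN] by auto
        have "x [^] j \<odot>\<^bsub>M\<^esub> h = u \<oplus>\<^bsub>M\<^esub> (\<ominus>\<^bsub>M\<^esub> w)"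
          using car xj unfolding wh(3) by (simp add: M.a_comm[of w] M.a_assoc M.r_neg)
        then have "x [^] j \<odot>\<^bsub>M\<^esub> h \<in> N (Suc n) <+>\<^bsub>M\<^esub> ?U j (Suc n)"
          using set_addI[OF uN sm_minus[OF U wh(1)]] by simp
        then have "h \<in> L j (Suc n - j)" unfolding L_def colon_def using wh(2) car j by simp
        then have "x [^] j \<odot>\<^bsub>M\<^esub> h \<in> ?G <+>\<^bsub>M\<^esub> ?U j (Suc n)" using xG[OF j] by blast
        moreover have "w \<in> ?G <+>\<^bsub>M\<^esub> ?U j (Suc n)" using set_add_upper2[OF G U] wh(1) by blast
        ultimately show "u \<in> ?G <+>\<^bsub>M\<^esub> ?U j (Suc n)"
          unfolding wh(3) using sm_add[OF sm_set_add[OF G U]] by simp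
      qed
      then have 1: "N (Suc n) \<inter> ?U (Suc j) (Suc n) \<subseteq> N (Suc n) \<inter> (?G <+>\<^bsub>M\<^esub> ?U j (Suc n))" by blast
      have GU: "sm (?G <+>\<^bsub>M\<^esub> ?U j (Suc n))" by (rule sm_set_add[OF G U])
      have "N (Suc n) \<inter> (?G <+>\<^bsub>M\<^esub> ?U j (Suc n)) \<subseteq> ?G <+>\<^bsub>M\<^esub> (?U j (Suc n) \<inter> (N (Suc n) \<inter> (?G <+>\<^bsub>M\<^esub> ?U j (Suc n))))"
        using GN set_add_upper1[OF G U] by (intro modular_law[OF G U sm_Int[OF N GU]]) simp_all
      also have "\<dots> \<subseteq> ?G"
        using Suc.IH Suc.prems by (intro set_add_least[OF G order.refl]) auto
      finally show ?case using 1 by (rule order.trans[rotated])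
    qed
    moreover have "N (Suc n) \<subseteq> ?U (Suc (Suc n)) (Suc n)"
      using Cons.prems(3)[of "Suc n"] graded_span_Cons_low_part[OF x xs assms(3), of "Suc n"] unfolding H_def
      by (rule order.trans)
    ultimately have "N (Suc n) \<subseteq> ?G" by blast
    then show ?thesis by simp
  qed
  then show ?case by blast
qed

end

section \<open>Eventually polynomial integer functions\<close>

text \<open>The basis \<open>(n + k) choose k\<close> with integer coefficients is used because
  Hilbert coefficients are, up to sign, these coefficients in reverse order. Here \<open>D\<close>
  only bounds the degree.\<close>

definition eventually_numerical :: "(nat \<Rightarrow> int) \<Rightarrow> bool" where
  "eventually_numerical f \<longleftrightarrow> (\<exists>D c. \<forall>\<^sub>F n in sequentially. f n = (\<Sum>k\<le>D. c k * int ((n + k) choose k)))"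

lemma eventually_numerical_zero: "(\<forall>\<^sub>F n in sequentially. f n = 0) \<Longrightarrow> eventually_numerical f"
  unfolding eventually_numerical_def by (intro exI[of _ 0] exI[of _ "\<lambda>_. 0"]) simp

lemma sum_choose_extend:
  fixes c :: "nat \<Rightarrow> int"
  assumes "D \<le> D'"
  shows "(\<Sum>k\<le>D. c k * g k) = (\<Sum>k\<le>D'. (if k \<le> D then c k else 0) * g k)"
  using assms by (intro sum.mono_neutral_cong_left) auto

lemma eventually_numerical_diff:
  assumes "eventually_numerical f" "eventually_numerical g" shows "eventually_numerical (\<lambda>n. f n - g n)"
proof -
  obtain D c where c: "\<forall>\<^sub>F n in sequentially. f n = (\<Sum>k\<le>D. c k * int ((n + k) choose k))"
    using assms(1) unfolding eventually_numerical_def by blast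
  obtain E d where d: "\<forall>\<^sub>F n in sequentially. g n = (\<Sum>k\<le>E. d k * int ((n + k) choose k))"
    using assms(2) unfolding eventually_numerical_def by blast
  let ?c = "\<lambda>k. (if k \<le> D then c k else 0) - (if k \<le> E then d k else 0)"
  have "\<forall>\<^sub>F n in sequentially. f n - g n = (\<Sum>k\<le>max D E. ?c k * int ((n + k) choose k))"
    using c d
  proof eventually_elim
    case (elim n)
    show ?case
      unfolding elim sum_choose_extend[of D "max D E", simplified] sum_choose_extend[of E "max D E", simplified]
      by (simp only: sum_subtractf left_diff_distrib)
  qed
  then show ?thesis unfolding eventually_numerical_def by (intro exI)
qed

lemma eventually_numerical_antidiff:
  assumes "eventually_numerical (\<lambda>n. f (Suc n) - f n)" shows "eventually_numerical f"
proof -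
  obtain D c where "\<forall>\<^sub>F n in sequentially. f (Suc n) - f n = (\<Sum>k\<le>D. c k * int ((n + k) choose k))"
    using assms unfolding eventually_numerical_def by blast
  then obtain N where N: "\<And>n. n \<ge> N \<Longrightarrow> f (Suc n) - f n = (\<Sum>k\<le>D. c k * int ((n + k) choose k))"
    by (auto simp: eventually_sequentially)
  \<comment> \<open>By Pascal's rule this is an antidifference of the given sum, but not yet written
    in the chosen basis.\<close>
  define g where "g n = (\<Sum>k\<le>D. c k * int ((n + k) choose Suc k))" for n
  have g: "g (Suc n) - g n = (\<Sum>k\<le>D. c k * int ((n + k) choose k))" for n
    unfolding g_def sum_subtractf[symmetric] by (intro sum.cong refl) (simp add: algebra_simps)
  have fg: "f n = g n + (f N - g N)" if "n \<ge> N" for n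
    using that
  proof (induction n rule: dec_induct)
    case (step n)
    then show ?case using N[of n] g[of n] by simp
  qed simp
  \<comment> \<open>The coefficients after rewriting \<open>(n + k) choose (k + 1)\<close> as
    \<open>(n + k + 1) choose (k + 1)\<close> minus \<open>(n + k) choose k\<close>; the integration
    constant goes into \<open>h 0\<close>.\<close>
  define h where "h k = (if k = 0 then f N - g N - c 0 else c (k - 1) - (if k \<le> D then c k else 0))" for k
  have gh: "g n + (f N - g N) = (\<Sum>k\<le>Suc D. h k * int ((n + k) choose k))" for n
  proof -
    have "(\<Sum>k\<le>Suc D. h k * int ((n + k) choose k))
        = h 0 + (\<Sum>k\<le>D. h (Suc k) * int ((n + Suc k) choose Suc k))"
      by (subst sum.atMost_Suc_shift) simp
    also have "\<dots> = f N - g N - c 0 + (\<Sum>k\<le>D. c k * int ((n + Suc k) choose Suc k))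
       - (\<Sum>k\<le>D. (if Suc k \<le> D then c (Suc k) else 0) * int ((n + Suc k) choose Suc k))"
      by (simp add: h_def sum_subtractf left_diff_distrib del: binomial_Suc_Suc)
    also have "(\<Sum>k\<le>D. (if Suc k \<le> D then c (Suc k) else 0) * int ((n + Suc k) choose Suc k))
      = (\<Sum>k\<le>Suc D. (if k \<le> D then c k else 0) * int ((n + k) choose k)) - c 0"
      by (subst sum.atMost_Suc_shift) simp
    also have "(\<Sum>k\<le>Suc D. (if k \<le> D then c k else 0) * int ((n + k) choose k))
      = (\<Sum>k\<le>D. c k * int ((n + k) choose k))"
      by simp
    also have "f N - g N - c 0 + (\<Sum>k\<le>D. c k * int ((n + Suc k) choose Suc k)) - ((\<Sum>k\<le>D. c k * int ((n + k) choose k)) - c 0)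
      = f N - g N + (\<Sum>k\<le>D. c k * int ((n + Suc k) choose Suc k) - c k * int ((n + k) choose k))"
      by (simp add: sum_subtractf)
    also have "\<dots> = f N - g N + g n"
      unfolding g_def by (intro arg_cong2[where f = "(+)"] sum.cong refl) (simp add: algebra_simps)
    finally show ?thesis by simp
  qed
  have "\<forall>\<^sub>F n in sequentially. f n = (\<Sum>k\<le>Suc D. h k * int ((n + k) choose k))"
    using eventually_ge_at_top[of N] by eventually_elim (use fg gh in metis)
  then show ?thesis unfolding eventually_numerical_def by blast
qed


section \<open>The Hilbert-Serre theorem for graded quotients\<close>

context module
begin

text \<open>From degree \<open>n0\<close> on, \<open>A\<close> is the span of \<open>A n0\<close> up
  to \<open>C\<close>. The basis theorem applied to the part of \<open>N\<close> inside that span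
  gives generators, and the modular law adds \<open>C\<close> back.\<close>

lemma graded_noetherian_mod:
  assumes "acc (carrier M)" "set xs \<subseteq> carrier R"
    and A: "\<And>n. sm (A n)" and C: "\<And>n. sm (C n)" and N: "\<And>n. sm (N n)"
    and CN: "\<And>n. C n \<subseteq> N n" and NA: "\<And>n. N n \<subseteq> A n"
    and clC: "\<And>n x. x \<in> set xs \<Longrightarrow> scale x (C n) \<subseteq> C (Suc n)"
    and clN: "\<And>n x. x \<in> set xs \<Longrightarrow> scale x (N n) \<subseteq> N (Suc n)"
    and gen: "\<And>n. n \<ge> n0 \<Longrightarrow> A (Suc n) \<subseteq> list_smult xs (A n) <+>\<^bsub>M\<^esub> C (Suc n)"
  shows "\<exists>c. \<forall>n\<ge>c. N (Suc n) \<subseteq> list_smult xs (N n) <+>\<^bsub>M\<^esub> C (Suc n)"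
proof -
  define H where "H = graded_span xs (A n0)"
  have H: "sm (H n)" for n unfolding H_def by (rule sm_graded_span[OF assms(2) A])
  have AH: "A (n0 + k) \<subseteq> H k <+>\<^bsub>M\<^esub> C (n0 + k)" for k
  proof (induction k)
    case 0 show ?case using set_add_upper1[OF A C] by (simp add: H_def)
  next
    case (Suc k)
    have HC: "sm (H (Suc k) <+>\<^bsub>M\<^esub> C (n0 + Suc k))" by (rule sm_set_add[OF H C])
    have "A (n0 + Suc k) \<subseteq> list_smult xs (A (n0 + k)) <+>\<^bsub>M\<^esub> C (n0 + Suc k)" using gen[of "n0 + k"] by simp
    also have "\<dots> \<subseteq> H (Suc k) <+>\<^bsub>M\<^esub> C (n0 + Suc k)"
    proof (rule set_add_least[OF HC _ set_add_upper2[OF H C]])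
      have "list_smult xs (A (n0 + k)) \<subseteq> list_smult xs (H k <+>\<^bsub>M\<^esub> C (n0 + k))" by (rule list_smult_mono[OF Suc.IH])
      also have "\<dots> \<subseteq> list_smult xs (H k) <+>\<^bsub>M\<^esub> list_smult xs (C (n0 + k))" by (rule list_smult_set_add[OF H C assms(2)])
      also have "\<dots> \<subseteq> H (Suc k) <+>\<^bsub>M\<^esub> C (n0 + Suc k)"
      proof (rule set_add_mono)
        show "list_smult xs (H k) \<subseteq> H (Suc k)" by (simp add: H_def)
        show "list_smult xs (C (n0 + k)) \<subseteq> C (n0 + Suc k)" using clC by (intro list_smult_least C) simp
      qed
      finally show "list_smult xs (A (n0 + k)) \<subseteq> H (Suc k) <+>\<^bsub>M\<^esub> C (n0 + Suc k)" .
    qed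
    finally show ?case .
  qed
  have "\<exists>c. \<forall>n\<ge>c. N (n0 + Suc n) \<inter> H (Suc n) \<subseteq> list_smult xs (N (n0 + n) \<inter> H n)"
  proof (rule graded_noetherian[OF assms(1,2) A[of n0]])
    fix n x assume x: "x \<in> set xs"
    have "scale x (N (n0 + n)) \<subseteq> N (n0 + Suc n)" using clN[OF x] by simp
    moreover have "scale x (H n) \<subseteq> H (Suc n)" unfolding H_def by (rule graded_span_closed[OF assms(2) A x])
    ultimately show "scale x (N (n0 + n) \<inter> H n) \<subseteq> N (n0 + Suc n) \<inter> H (Suc n)" by blast
  qed (use sm_Int[OF N H] in \<open>simp_all add: H_def\<close>)
  then obtain c where c: "\<forall>n\<ge>c. N (n0 + Suc n) \<inter> H (Suc n) \<subseteq> list_smult xs (N (n0 + n) \<inter> H n)" ..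
  have "N (Suc n) \<subseteq> list_smult xs (N n) <+>\<^bsub>M\<^esub> C (Suc n)" if "n \<ge> n0 + c" for n
  proof -
    define k where "k = n - n0"
    have k: "n = n0 + k" "k \<ge> c" using that unfolding k_def by auto
    have "N (Suc n) \<subseteq> C (Suc n) <+>\<^bsub>M\<^esub> H (Suc k)"
      using NA[of "Suc n"] AH[of "Suc k"] set_add_comm[OF H C] k by simp
    then have "N (Suc n) \<subseteq> C (Suc n) <+>\<^bsub>M\<^esub> (H (Suc k) \<inter> N (Suc n))"
      by (rule modular_law[OF C H N CN])
    also have "\<dots> = (H (Suc k) \<inter> N (Suc n)) <+>\<^bsub>M\<^esub> C (Suc n)" by (rule set_add_comm[OF C sm_Int[OF H N]])
    also have "\<dots> \<subseteq> list_smult xs (N (n0 + k) \<inter> H k) <+>\<^bsub>M\<^esub> C (Suc n)"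
      using c[rule_format, OF k(2)] k(1) by (intro set_add_mono order.refl) (simp add: Int_commute)
    also have "\<dots> \<subseteq> list_smult xs (N n) <+>\<^bsub>M\<^esub> C (Suc n)"
      unfolding k(1) by (intro set_add_mono list_smult_mono Int_lower1 order.refl)
    finally show ?thesis .
  qed
  then show ?thesis by blast
qed

text \<open>The pairs \<open>C n \<subseteq> A n\<close> represent a graded module
  \<open>A/C\<close> generated by \<open>xs\<close> from some degree on. The induction removes one
  variable \<open>x\<close> at a time: kernel and cokernel of multiplication by \<open>x\<close> are
  killed by \<open>x\<close>, hence are generated by the remaining variables.\<close>

theorem hilbert_function:
  assumes "acc (carrier M)" "set xs \<subseteq> carrier R"
    and "\<And>n. sm (A n)" "\<And>n. sm (C n)" "\<And>n. C n \<subseteq> A n"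
    and "\<And>n x. x \<in> set xs \<Longrightarrow> scale x (A n) \<subseteq> A (Suc n)"
    and "\<And>n x. x \<in> set xs \<Longrightarrow> scale x (C n) \<subseteq> C (Suc n)"
    and "\<exists>n0. \<forall>n\<ge>n0. A (Suc n) \<subseteq> list_smult xs (A n) <+>\<^bsub>M\<^esub> C (Suc n)"
    and "\<And>n. rel_length R M (C n) (A n) \<noteq> \<infinity>"
  shows "eventually_numerical (\<lambda>n. int (the_enat (rel_length R M (C n) (A n))))"
  using assms(2-)
proof (induction xs arbitrary: A C)
  case Nil
  then obtain n0 where n0: "\<And>n. n \<ge> n0 \<Longrightarrow> A (Suc n) \<subseteq> list_smult [] (A n) <+>\<^bsub>M\<^esub> C (Suc n)" by blast
  \<comment> \<open>Without variables, nothing is generated in large degrees.\<close>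
  have "rel_length R M (C n) (A n) = 0" if n: "n \<ge> Suc n0" for n
  proof -
    obtain k where k: "n = Suc k" "k \<ge> n0" using n by (cases n) auto
    have "A n \<subseteq> C n"
      using n0[OF k(2)] set_add_least[OF Nil.prems(3)[of n], of "{\<zero>\<^bsub>M\<^esub>}" "C n"] sm_zero[OF Nil.prems(3)] k(1) by auto
    then have "A n = C n" using Nil.prems(4)[of n] by auto
    then show ?thesis using rel_length_self[OF Nil.prems(3)] by simp
  qed
  then have "\<forall>\<^sub>F n in sequentially. int (the_enat (rel_length R M (C n) (A n))) = 0"
    unfolding eventually_sequentially by (intro exI[of _ "Suc n0"]) (simp add: zero_enat_def)
  then show ?case by (rule eventually_numerical_zero)
next
  case (Cons x xs)
  note A = Cons.prems(2) and C = Cons.prems(3) and CA = Cons.prems(4) and clA = Cons.prems(5)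
    and clC = Cons.prems(6)
  have x: "x \<in> carrier R" and xs: "set xs \<subseteq> carrier R" using Cons.prems(1) by auto
  obtain n0 where n0: "\<And>n. n \<ge> n0 \<Longrightarrow> A (Suc n) \<subseteq> list_smult (x # xs) (A n) <+>\<^bsub>M\<^esub> C (Suc n)"
    using Cons.prems(7) by blast
  \<comment> \<open>Multiplication by \<open>x\<close> from degree \<open>n\<close> to
    \<open>n + 1\<close> has kernel \<open>K n / C n\<close>, image \<open>E n / C (n + 1)\<close>
    and cokernel \<open>A (n + 1) / E n\<close>.\<close>
  define K where "K n = A n \<inter> colon (C (Suc n)) x" for n
  define E where "E n = scale x (A n) <+>\<^bsub>M\<^esub> C (Suc n)" for n
  have xA: "sm (scale x (A n))" for n by (rule sm_scale[OF A x])
  have K: "sm (K n)" for n unfolding K_def by (intro sm_Int A sm_colon C x)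
  have E: "sm (E n)" for n unfolding E_def by (intro sm_set_add xA C)
  have KA: "K n \<subseteq> A n" for n unfolding K_def by blast
  have xK: "scale x (K n) \<subseteq> C (Suc n)" for n unfolding scale_subset_iff[OF K] unfolding K_def by blast
  have CK: "C n \<subseteq> K n" for n
    using clC[of x n] CA[of n] scale_subset_iff[OF C] unfolding K_def by simp
  have CE: "C (Suc n) \<subseteq> E n" for n unfolding E_def by (rule set_add_upper2[OF xA C])
  have EA: "E n \<subseteq> A (Suc n)" for n
    unfolding E_def using clA[of x] CA by (intro set_add_least A) simp_all
  have clK: "scale y (K n) \<subseteq> K (Suc n)" if y: "y \<in> set (x # xs)" for y n
  proof -
    have yc: "y \<in> carrier R" using y x xs by auto
    have "scale x (scale y (K n)) = scale y (scale x (K n))" by (rule scale_comm[OF K x yc])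
    also have "\<dots> \<subseteq> scale y (C (Suc n))" by (rule image_mono[OF xK])
    also have "\<dots> \<subseteq> C (Suc (Suc n))" by (rule clC[OF y])
    finally have "scale y (K n) \<subseteq> colon (C (Suc (Suc n))) x"
      unfolding scale_subset_iff[OF sm_scale[OF K yc]] .
    moreover have "scale y (K n) \<subseteq> A (Suc n)" using image_mono[OF KA] clA[OF y] by (rule order.trans)
    ultimately show ?thesis unfolding K_def[of "Suc n"] by blast
  qed
  have fin: "rel_length R M (C n) (A n) \<noteq> \<infinity>" for n by (rule Cons.prems(8))
  have l1: "rel_length R M (C n) (A n) = rel_length R M (C n) (K n) + rel_length R M (C (Suc n)) (E n)" for n
    using rel_length_add[OF C K A CK KA, of n] rel_length_scale[OF A C x, of n "Suc n"] unfolding K_def E_def by simp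
  have l2: "rel_length R M (C (Suc n)) (A (Suc n)) = rel_length R M (C (Suc n)) (E n) + rel_length R M (E n) (A (Suc n))" for n
    by (rule rel_length_add[OF C E A CE EA])
  have finK: "rel_length R M (C n) (K n) \<noteq> \<infinity>" and finE: "rel_length R M (E n) (A (Suc n)) \<noteq> \<infinity>"
    and finCE: "rel_length R M (C (Suc n)) (E n) \<noteq> \<infinity>" for n
    using fin[of n] fin[of "Suc n"] l1[of n] l2[of n] by (simp_all add: plus_eq_infty_iff_enat del: not_infinity_eq)
  have pK: "eventually_numerical (\<lambda>n. int (the_enat (rel_length R M (C n) (K n))))"
  proof (rule Cons.IH[OF xs K C CK])
    have "\<exists>c. \<forall>n\<ge>c. K (Suc n) \<subseteq> list_smult (x # xs) (K n) <+>\<^bsub>M\<^esub> C (Suc n)"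
      by (rule graded_noetherian_mod[where A = A and C = C and N = K and xs = "x # xs" and ?n0.0 = n0,
            OF assms(1) Cons.prems(1) A C K CK KA clC clK n0])
    then obtain c where c: "\<And>n. n \<ge> c \<Longrightarrow> K (Suc n) \<subseteq> list_smult (x # xs) (K n) <+>\<^bsub>M\<^esub> C (Suc n)" by blast
    have "K (Suc n) \<subseteq> list_smult xs (K n) <+>\<^bsub>M\<^esub> C (Suc n)" if "n \<ge> c" for n
    proof -
      have s: "sm (list_smult xs (K n))" by (rule sm_list_smult[OF xs K])
      have T: "sm (list_smult xs (K n) <+>\<^bsub>M\<^esub> C (Suc n))" by (rule sm_set_add[OF s C])
      have "list_smult (x # xs) (K n) \<subseteq> list_smult xs (K n) <+>\<^bsub>M\<^esub> C (Suc n)"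
        unfolding list_smult.simps
        using xK set_add_upper2[OF s C] set_add_upper1[OF s C] by (intro set_add_least[OF T]) (rule order.trans)
      then have "list_smult (x # xs) (K n) <+>\<^bsub>M\<^esub> C (Suc n) \<subseteq> list_smult xs (K n) <+>\<^bsub>M\<^esub> C (Suc n)"
        by (rule set_add_least[OF T _ set_add_upper2[OF s C]])
      then show ?thesis using c[OF that] by (rule order.trans[rotated])
    qed
    then show "\<exists>n0. \<forall>n\<ge>n0. K (Suc n) \<subseteq> list_smult xs (K n) <+>\<^bsub>M\<^esub> C (Suc n)" by blast
  qed (use clK clC finK in simp_all)
  have pE: "eventually_numerical (\<lambda>n. int (the_enat (rel_length R M (E n) (A (Suc n)))))"
  proof (rule Cons.IH[OF xs A E EA])
    fix n y assume y: "y \<in> set xs"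
    then have yc: "y \<in> carrier R" and y': "y \<in> set (x # xs)" using xs by auto
    have "scale y (scale x (A n)) \<subseteq> scale x (A (Suc n))"
      unfolding scale_comm[OF A yc x] by (rule image_mono[OF clA[OF y']])
    then show "scale y (E n) \<subseteq> E (Suc n)"
      unfolding E_def scale_set_add[OF xA C yc] by (rule set_add_mono[OF _ clC[OF y']])
  next
    have "A (Suc (Suc n)) \<subseteq> list_smult xs (A (Suc n)) <+>\<^bsub>M\<^esub> E (Suc n)" if "n \<ge> n0" for n
    proof -
      have s: "sm (list_smult xs (A (Suc n)))" by (rule sm_list_smult[OF xs A])
      have T: "sm (list_smult xs (A (Suc n)) <+>\<^bsub>M\<^esub> E (Suc n))" by (rule sm_set_add[OF s E])
      have e: "E (Suc n) \<subseteq> list_smult xs (A (Suc n)) <+>\<^bsub>M\<^esub> E (Suc n)" by (rule set_add_upper2[OF s E])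
      have "scale x (A (Suc n)) \<subseteq> E (Suc n)" unfolding E_def by (rule set_add_upper1[OF xA C])
      then have "scale x (A (Suc n)) \<subseteq> list_smult xs (A (Suc n)) <+>\<^bsub>M\<^esub> E (Suc n)" using e by (rule order.trans)
      then have "list_smult (x # xs) (A (Suc n)) \<subseteq> list_smult xs (A (Suc n)) <+>\<^bsub>M\<^esub> E (Suc n)"
        unfolding list_smult.simps by (rule set_add_least[OF T _ set_add_upper1[OF s E]])
      moreover have "C (Suc (Suc n)) \<subseteq> list_smult xs (A (Suc n)) <+>\<^bsub>M\<^esub> E (Suc n)"
        using CE e by (rule order.trans)
      ultimately show ?thesis
        using n0[of "Suc n"] that set_add_least[OF T, of "list_smult (x # xs) (A (Suc n))" "C (Suc (Suc n))"]
        by (meson le_SucI order.trans)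
    qed
    then show "\<exists>n0. \<forall>n\<ge>n0. A (Suc (Suc n)) \<subseteq> list_smult xs (A (Suc n)) <+>\<^bsub>M\<^esub> E (Suc n)" by blast
  qed (use clA finE in simp_all)
  let ?l = "\<lambda>X Y. int (the_enat (rel_length R M X Y))"
  \<comment> \<open>The alternating sum along the four-term exact sequence of \<open>x\<close>. The
    image cancels, which is legitimate because all lengths are finite.\<close>
  have "?l (C (Suc n)) (A (Suc n)) - ?l (C n) (A n) = ?l (E n) (A (Suc n)) - ?l (C n) (K n)" for n
    unfolding l1[of n] l2[of n] using finK[of n] finE[of n] finCE[of n] by auto
  then have "eventually_numerical (\<lambda>n. ?l (C (Suc n)) (A (Suc n)) - ?l (C n) (A n))"
    using eventually_numerical_diff[OF pE pK] by simp
  then show ?case by (rule eventually_numerical_antidiff)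
qed

end

section \<open>Noetherian modules over local rings\<close>

text \<open>In a Noetherian ring the union of a nonempty chain of ideals is a member of the chain,
  so it is proper and Zorn's lemma applies.\<close>

lemma (in noetherian_ring) ex_maximalideal:
  assumes "ideal J R" "J \<noteq> carrier R"
  shows "\<exists>m. maximalideal m R \<and> J \<subseteq> m"
proof -
  let ?A = "{K. ideal K R \<and> K \<noteq> carrier R \<and> J \<subseteq> K}"
  have "\<exists>U\<in>?A. \<forall>X\<in>C. X \<subseteq> U" if C: "C \<in> chains ?A" for C
  proof (cases "C = {}")
    case True then show ?thesis using assms by blast
  next
    case False
    have C': "subset.chain {K. ideal K R} C" "C \<subseteq> ?A"
      using C by (auto simp: chains_def chain_subset_def subset.chain_def)
    have "\<Union>C \<in> C" by (rule ideal_chain_is_trivial[OF False C'(1)])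
    then show ?thesis using C'(2) by (intro bexI[of _ "\<Union>C"] ballI) auto
  qed
  then obtain m where m: "m \<in> ?A" "\<forall>X\<in>?A. m \<subseteq> X \<longrightarrow> X = m" using Zorn_Lemma2[of ?A] by auto
  have "maximalideal m R"
  proof (rule maximalidealI)
    fix K assume "ideal K R" "m \<subseteq> K" "K \<subseteq> carrier R"
    then show "K = m \<or> K = carrier R" using m by blast
  qed (use m in auto)
  then show ?thesis using m by blast
qed

lemma noetherian_local_Units:
  fixes R (structure)
  assumes "noetherian_local_ring R m" "x \<in> carrier R" "x \<notin> m" shows "x \<in> Units R"
proof (rule ccontr)
  interpret cring R using assms(1) by (simp add: noetherian_local_ring_def)
  interpret N: noetherian_ring R using assms(1) by (simp add: noetherian_local_ring_def)
  assume nu: "x \<notin> Units R"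
  have x: "x \<in> PIdl x" by (rule cgenideal_self[OF assms(2)])
  have "PIdl x \<noteq> carrier R"
  proof
    assume "PIdl x = carrier R"
    then have "\<one> \<in> PIdl x" by simp
    then obtain r where r: "r \<in> carrier R" "\<one> = r \<otimes> x" unfolding cgenideal_def by auto
    have "x \<otimes> r = \<one>" using r assms(2) m_comm[of r x] by simp
    then show False using nu assms(2) r unfolding Units_def by auto
  qed
  then obtain m' where "maximalideal m' R" "PIdl x \<subseteq> m'"
    using N.ex_maximalideal[OF cgenideal_ideal[OF assms(2)]] by blast
  then show False using assms x unfolding noetherian_local_ring_def by blast
qed

context module
begin

definition cyclic :: "'c \<Rightarrow> 'c set" where "cyclic g = (\<lambda>r. r \<odot>\<^bsub>M\<^esub> g) ` carrier R"

lemma sm_cyclic: assumes g: "g \<in> carrier M" shows "sm (cyclic g)"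
proof (rule smI)
  show "\<zero>\<^bsub>M\<^esub> \<in> cyclic g" unfolding cyclic_def using g by (intro image_eqI[of _ _ \<zero>]) auto
  show "cyclic g \<subseteq> carrier M" unfolding cyclic_def using g by auto
  fix a b assume "a \<in> cyclic g" "b \<in> cyclic g"
  then obtain r s where "r \<in> carrier R" "s \<in> carrier R" "a = r \<odot>\<^bsub>M\<^esub> g" "b = s \<odot>\<^bsub>M\<^esub> g" unfolding cyclic_def by auto
  then show "a \<oplus>\<^bsub>M\<^esub> b \<in> cyclic g" unfolding cyclic_def using g
    by (intro image_eqI[of _ _ "r \<oplus> s"]) (auto simp: smult_l_distr)
next
  fix a b assume "a \<in> carrier R" "b \<in> cyclic g"
  then obtain r where "r \<in> carrier R" "b = r \<odot>\<^bsub>M\<^esub> g" unfolding cyclic_def by auto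
  then show "a \<odot>\<^bsub>M\<^esub> b \<in> cyclic g" unfolding cyclic_def using g \<open>a \<in> carrier R\<close>
    by (intro image_eqI[of _ _ "a \<otimes> r"]) (auto simp: smult_assoc1)
qed

lemma cyclic_self: "g \<in> carrier M \<Longrightarrow> g \<in> cyclic g"
  unfolding cyclic_def by (intro image_eqI[of _ _ \<one>]) auto

lemma cyclic_least: "sm D \<Longrightarrow> g \<in> D \<Longrightarrow> cyclic g \<subseteq> D"
  unfolding cyclic_def by (auto simp: sm_smult)

text \<open>The ideal \<open>(D : g)\<close>. Through it, a membership checked on generators of an
  ideal extends to the whole ideal.\<close>

lemma ideal_transporter:
  assumes "sm D" "g \<in> carrier M"
  shows "ideal {r \<in> carrier R. r \<odot>\<^bsub>M\<^esub> g \<in> D} R"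
proof (rule idealI)
  show "ring R" by (rule R.ring_axioms)
  show "subgroup {r \<in> carrier R. r \<odot>\<^bsub>M\<^esub> g \<in> D} (add_monoid R)"
  proof
    fix x assume "x \<in> {r \<in> carrier R. r \<odot>\<^bsub>M\<^esub> g \<in> D}"
    then show "inv\<^bsub>add_monoid R\<^esub> x \<in> {r \<in> carrier R. r \<odot>\<^bsub>M\<^esub> g \<in> D}"
      using assms sm_minus[OF assms(1)] by (simp add: smult_l_minus a_inv_def[symmetric])
  qed (use assms sm_zero[OF assms(1)] in \<open>auto simp: smult_l_distr sm_add[OF assms(1)]\<close>)
  fix a x assume a: "a \<in> {r \<in> carrier R. r \<odot>\<^bsub>M\<^esub> g \<in> D}" and x: "x \<in> carrier R"
  then show "x \<otimes> a \<in> {r \<in> carrier R. r \<odot>\<^bsub>M\<^esub> g \<in> D}"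
    using assms sm_smult[OF assms(1)] by (simp add: smult_assoc1)
  then show "a \<otimes> x \<in> {r \<in> carrier R. r \<odot>\<^bsub>M\<^esub> g \<in> D}"
    using a x by (simp add: R.m_comm)
qed

primrec list_span :: "'c list \<Rightarrow> 'c set" where
  "list_span [] = {\<zero>\<^bsub>M\<^esub>}"
| "list_span (g # gs) = cyclic g <+>\<^bsub>M\<^esub> list_span gs"

lemma sm_list_span: "set gs \<subseteq> carrier M \<Longrightarrow> sm (list_span gs)"
  by (induction gs) (simp_all add: sm_zero_sub sm_set_add sm_cyclic)

lemma set_sub_list_span: "set gs \<subseteq> carrier M \<Longrightarrow> set gs \<subseteq> list_span gs"
proof (induction gs)
  case (Cons g gs)
  then have g: "g \<in> carrier M" and gs: "set gs \<subseteq> carrier M" by auto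
  have "g \<in> list_span (g # gs)" using set_add_upper1[OF sm_cyclic[OF g] sm_list_span[OF gs]] cyclic_self[OF g] by auto
  moreover have "set gs \<subseteq> list_span (g # gs)"
    using set_add_upper2[OF sm_cyclic[OF g] sm_list_span[OF gs]] Cons.IH[OF gs] by auto
  ultimately show ?case by simp
qed simp

lemma finsum_in_sm:
  assumes "sm D" "finite A" "A \<subseteq> D" "c \<in> A \<rightarrow> carrier R"
  shows "(\<Oplus>\<^bsub>M\<^esub>a\<in>A. c a \<odot>\<^bsub>M\<^esub> a) \<in> D"
  using assms(2-)
proof (induction A rule: finite_induct)
  case empty then show ?case using sm_zero[OF assms(1)] by simp
next
  case (insert a A)
  have "(\<lambda>a. c a \<odot>\<^bsub>M\<^esub> a) \<in> A \<rightarrow> carrier M" "c a \<odot>\<^bsub>M\<^esub> a \<in> carrier M"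
    using insert.prems sm_carr[OF assms(1)] by (auto intro!: smult_closed simp: Pi_iff)
  then have "(\<Oplus>\<^bsub>M\<^esub>a\<in>insert a A. c a \<odot>\<^bsub>M\<^esub> a) = c a \<odot>\<^bsub>M\<^esub> a \<oplus>\<^bsub>M\<^esub> (\<Oplus>\<^bsub>M\<^esub>a\<in>A. c a \<odot>\<^bsub>M\<^esub> a)"
    using insert.hyps by (intro M.finsum_insert)
  moreover have "c a \<odot>\<^bsub>M\<^esub> a \<in> D" using insert.prems by (intro sm_smult[OF assms(1)]) auto
  ultimately show ?case using insert by (simp add: sm_add[OF assms(1)])
qed

text \<open>Induction on the generators. Of nested submodules, the larger equals the smaller once
  their intersections with \<open>?D\<close> agree and so do the ideals of coefficients of
  \<open>g\<close> modulo \<open>?D\<close>. The first become stationary by induction, the second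
  because the ring is Noetherian.\<close>

lemma acc_list_span:
  assumes "noetherian_ring R" "set gs \<subseteq> carrier M"
  shows "acc (list_span gs)"
  using assms(2)
proof (induction gs)
  case Nil
  show ?case unfolding acc_def
  proof (intro allI impI)
    fix N assume "\<forall>i::nat. sm (N i) \<and> N i \<subseteq> list_span [] \<and> N i \<subseteq> N (Suc i)"
    then have "N i = {\<zero>\<^bsub>M\<^esub>}" for i using sm_zero[of "N i"] by auto
    then show "\<exists>k. \<forall>i\<ge>k. N i = N k" by simp
  qed
next
  case (Cons g gs)
  then have g: "g \<in> carrier M" and gs: "set gs \<subseteq> carrier M" by auto
  let ?D = "list_span gs"
  have D: "sm ?D" by (rule sm_list_span[OF gs])
  show ?case unfolding acc_def
  proof (intro allI impI)
    fix N assume N: "\<forall>i::nat. sm (N i) \<and> N i \<subseteq> list_span (g # gs) \<and> N i \<subseteq> N (Suc i)"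
    then have sN: "sm (N i)" and inc: "N i \<subseteq> N (Suc i)" for i by auto
    have mono: "N i \<subseteq> N j" if "i \<le> j" for i j by (rule lift_Suc_mono_le[of N, OF inc that])
    have ND: "sm (N i <+>\<^bsub>M\<^esub> ?D)" for i by (rule sm_set_add[OF sN D])
    have "\<exists>k. \<forall>i. N i \<inter> ?D \<subseteq> N k \<inter> ?D"
      by (rule acc_chain[OF Cons.IH[OF gs]]) (use sm_Int[OF sN D] inc in blast)+
    then obtain k1 where k1: "N i \<inter> ?D \<subseteq> N k1 \<inter> ?D" for i by metis
    define J where "J i = {r \<in> carrier R. r \<odot>\<^bsub>M\<^esub> g \<in> N i <+>\<^bsub>M\<^esub> ?D}" for i
    have J: "ideal (J i) R" for i unfolding J_def by (rule ideal_transporter[OF ND g])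
    have Jm: "J i \<subseteq> J j" if "i \<le> j" for i j
      unfolding J_def using set_add_mono[OF mono[OF that] order.refl[of ?D]] by blast
    have "subset.chain {I. ideal I R} (range J)"
      unfolding subset_chain_def
    proof (intro conjI ballI)
      show "range J \<subseteq> {I. ideal I R}" using J by auto
      fix X Y assume "X \<in> range J" "Y \<in> range J"
      then obtain i j where "X = J i" "Y = J j" by auto
      then show "X \<subseteq> Y \<or> Y \<subseteq> X" using Jm[of i j] Jm[of j i] nle_le[of i j] by auto
    qed
    then have "\<Union>(range J) \<in> range J" using noetherian_ring.ideal_chain_is_trivial[OF assms(1)] by blast
    then obtain k2 where k2: "\<Union>(range J) = J k2" by auto
    have "N i = N (max k1 k2)" if "i \<ge> max k1 k2" for i
    proof
      let ?k = "max k1 k2"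
      show "N ?k \<subseteq> N i" by (rule mono[OF that])
      have "N i \<subseteq> N ?k <+>\<^bsub>M\<^esub> ?D"
      proof
        fix n assume n: "n \<in> N i"
        then have "n \<in> cyclic g <+>\<^bsub>M\<^esub> ?D" using N by auto
        then obtain r d where rd: "r \<in> carrier R" "d \<in> ?D" "n = r \<odot>\<^bsub>M\<^esub> g \<oplus>\<^bsub>M\<^esub> d"
          by (auto elim!: set_addE simp: cyclic_def)
        have d: "d \<in> carrier M" by (rule sm_carr[OF D rd(2)])
        have "r \<odot>\<^bsub>M\<^esub> g = n \<oplus>\<^bsub>M\<^esub> (\<ominus>\<^bsub>M\<^esub> d)" unfolding rd(3) using rd(1) g d by (simp add: M.a_assoc M.r_neg)
        then have "r \<odot>\<^bsub>M\<^esub> g \<in> N i <+>\<^bsub>M\<^esub> ?D" using set_addI[OF n sm_minus[OF D rd(2)]] by simp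
        then have "r \<in> J i" unfolding J_def using rd(1) by simp
        then have "r \<in> J k2" using k2 by blast
        then have "r \<in> J ?k" using Jm[of k2 ?k] by auto
        then have "r \<odot>\<^bsub>M\<^esub> g \<in> N ?k <+>\<^bsub>M\<^esub> ?D" unfolding J_def by simp
        moreover have "d \<in> N ?k <+>\<^bsub>M\<^esub> ?D" using set_add_upper2[OF sN D] rd(2) by (rule subsetD)
        ultimately show "n \<in> N ?k <+>\<^bsub>M\<^esub> ?D" unfolding rd(3) by (rule sm_add[OF ND])
      qed
      then have "N i \<subseteq> N ?k <+>\<^bsub>M\<^esub> (?D \<inter> N i)" by (rule modular_law[OF sN D sN mono[OF that]])
      also have "\<dots> \<subseteq> N ?k" using k1[of i] mono[of k1 ?k] by (intro set_add_least[OF sN order.refl]) auto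
      finally show "N i \<subseteq> N ?k" .
    qed
    then show "\<exists>k. \<forall>i\<ge>k. N i = N k" by (intro exI[of _ "max k1 k2"] allI impI)
  qed
qed

lemma acc_finite_module:
  assumes "noetherian_ring R" "finite_module R M" shows "acc (carrier M)"
proof -
  obtain A where A: "A \<subseteq> carrier M" "finite A"
    "\<forall>x \<in> carrier M. \<exists>c \<in> A \<rightarrow> carrier R. x = (\<Oplus>\<^bsub>M\<^esub>a\<in>A. c a \<odot>\<^bsub>M\<^esub> a)"
    using assms(2) unfolding finite_module_def by blast
  obtain gs where gs: "set gs = A" using A(2) finite_list by blast
  have gs': "set gs \<subseteq> carrier M" using A(1) gs by simp
  have AD: "A \<subseteq> list_span gs" using set_sub_list_span[OF gs'] gs by simp
  have "x \<in> list_span gs" if x: "x \<in> carrier M" for x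
  proof -
    obtain c where "c \<in> A \<rightarrow> carrier R" "x = (\<Oplus>\<^bsub>M\<^esub>a\<in>A. c a \<odot>\<^bsub>M\<^esub> a)" using A(3) x by blast
    then show ?thesis using finsum_in_sm[OF sm_list_span[OF gs'] A(2) AD] by simp
  qed
  then have "carrier M = list_span gs" using submoduleE(1)[OF sm_list_span[OF gs']] by blast
  then show ?thesis using acc_list_span[OF assms(1) gs'] by simp
qed

text \<open>Noetherian induction on \<open>D\<close> from above. If \<open>D \<noteq> A\<close>,
  some \<open>g\<close> in \<open>A\<close> outside \<open>D\<close> is sent into \<open>D\<close>
  by all of \<open>m\<close>, so that \<open>(Rg + D)/D\<close> is simple, and the induction
  hypothesis handles \<open>Rg + D\<close>. Since \<open>m\<close> is finitely generated, separate
  nilpotency of its elements is enough.\<close>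

lemma rel_length_finite:
  assumes "acc (carrier M)" "noetherian_local_ring R m" "sm A" "sm D" "D \<subseteq> A"
    and "\<And>y. y \<in> m \<Longrightarrow> \<exists>t::nat. scale (y [^] t) A \<subseteq> D"
  shows "rel_length R M D A \<noteq> \<infinity>"
proof -
  have idm: "ideal m R" using assms(2) by (simp add: noetherian_local_ring_def maximalideal_def)
  obtain Y where Y: "Y \<subseteq> carrier R" "finite Y" "m = Idl Y"
    using assms(2) noetherian_ring.finetely_gen[OF _ idm] unfolding noetherian_local_ring_def by blast
  have "D \<subseteq> A \<longrightarrow> (\<forall>y\<in>m. \<exists>t::nat. scale (y [^] t) A \<subseteq> D) \<longrightarrow> rel_length R M D A \<noteq> \<infinity>"
  proof (rule acc_induct[OF assms(1,4) submoduleE(1)[OF assms(4)]], intro impI)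
    fix D assume D: "sm D" and IH: "\<And>B. sm B \<Longrightarrow> B \<subseteq> carrier M \<Longrightarrow> D \<subset> B \<Longrightarrow>
        B \<subseteq> A \<longrightarrow> (\<forall>y\<in>m. \<exists>t::nat. scale (y [^] t) A \<subseteq> B) \<longrightarrow> rel_length R M B A \<noteq> \<infinity>"
      and DA: "D \<subseteq> A" and nil: "\<forall>y\<in>m. \<exists>t::nat. scale (y [^] t) A \<subseteq> D"
    show "rel_length R M D A \<noteq> \<infinity>"
    proof (cases "D = A")
      case True then show ?thesis using rel_length_self[OF D] by simp
    next
      case False
      \<comment> \<open>For a new \<open>y\<close>, the previous \<open>g\<close> is multiplied by
        the last power of \<open>y\<close> that keeps it outside \<open>D\<close>; elements that
        sent \<open>g\<close> into \<open>D\<close> still do so.\<close>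
      have "\<exists>g\<in>A - D. \<forall>y\<in>Z. y \<odot>\<^bsub>M\<^esub> g \<in> D" if "finite Z" "Z \<subseteq> m" for Z
        using that
      proof (induction Z rule: finite_induct)
        case empty then show ?case using False DA by auto
      next
        case (insert y Z)
        then obtain g where g: "g \<in> A" "g \<notin> D" "\<forall>z\<in>Z. z \<odot>\<^bsub>M\<^esub> g \<in> D" by auto
        have y: "y \<in> carrier R" and Z: "Z \<subseteq> carrier R" using insert.prems ideal.Icarr[OF idm] by auto
        have gc: "g \<in> carrier M" by (rule sm_carr[OF assms(3) g(1)])
        obtain t :: nat where "scale (y [^] t) A \<subseteq> D" using nil insert.prems by auto
        then have ex: "\<exists>t::nat. y [^] t \<odot>\<^bsub>M\<^esub> g \<in> D" using g(1) by blast
        define t where "t = (LEAST t::nat. y [^] t \<odot>\<^bsub>M\<^esub> g \<in> D)"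
        have t: "y [^] t \<odot>\<^bsub>M\<^esub> g \<in> D" unfolding t_def using ex by (rule LeastI_ex)
        have "t \<noteq> 0" using t g(2) gc by (intro notI) simp
        then obtain s where s: "t = Suc s" by (cases t) auto
        have ns: "y [^] s \<odot>\<^bsub>M\<^esub> g \<notin> D" using not_less_Least[of s "\<lambda>t. y [^] t \<odot>\<^bsub>M\<^esub> g \<in> D"] s unfolding t_def by auto
        have ys: "y [^] s \<in> carrier R" using y by simp
        show ?case
        proof (intro bexI ballI)
          show "y [^] s \<odot>\<^bsub>M\<^esub> g \<in> A - D" using ns sm_smult[OF assms(3) ys g(1)] by simp
          fix z assume z: "z \<in> insert y Z"
          show "z \<odot>\<^bsub>M\<^esub> (y [^] s \<odot>\<^bsub>M\<^esub> g) \<in> D"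
          proof (cases "z = y")
            case True
            then show ?thesis using t s y ys gc by (simp add: smult_assoc1[symmetric] R.m_comm)
          next
            case False
            then have "z \<in> Z" using z by simp
            then have zz: "z \<odot>\<^bsub>M\<^esub> g \<in> D" "z \<in> carrier R" using g(3) Z by auto
            have "z \<odot>\<^bsub>M\<^esub> (y [^] s \<odot>\<^bsub>M\<^esub> g) = y [^] s \<odot>\<^bsub>M\<^esub> (z \<odot>\<^bsub>M\<^esub> g)"
              using zz(2) ys gc by (simp add: smult_assoc1[symmetric] R.m_comm)
            then show ?thesis using sm_smult[OF D ys zz(1)] by simp
          qed
        qed
      qed
      moreover have "Y \<subseteq> m" using R.genideal_self[OF Y(1)] Y(3) by simp
      ultimately obtain g where g: "g \<in> A" "g \<notin> D" "\<forall>y\<in>Y. y \<odot>\<^bsub>M\<^esub> g \<in> D" using Y(2) by (metis DiffE)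
      have gc: "g \<in> carrier M" by (rule sm_carr[OF assms(3) g(1)])
      have "Idl Y \<subseteq> {r \<in> carrier R. r \<odot>\<^bsub>M\<^esub> g \<in> D}"
        by (rule R.genideal_minimal[OF ideal_transporter[OF D gc]]) (use g(3) Y(1) in auto)
      then have mg: "r \<odot>\<^bsub>M\<^esub> g \<in> D" if "r \<in> m" for r using that Y(3) by auto
      define B where "B = cyclic g <+>\<^bsub>M\<^esub> D"
      have cg: "sm (cyclic g)" by (rule sm_cyclic[OF gc])
      have B: "sm B" unfolding B_def by (rule sm_set_add[OF cg D])
      have DB: "D \<subseteq> B" unfolding B_def by (rule set_add_upper2[OF cg D])
      have gB: "g \<in> B" unfolding B_def using set_add_upper1[OF cg D] cyclic_self[OF gc] by (rule subsetD)
      have BA: "B \<subseteq> A" unfolding B_def by (rule set_add_least[OF assms(3) cyclic_least[OF assms(3) g(1)] DA])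
      \<comment> \<open>An element of \<open>X\<close> outside \<open>D\<close> has a coefficient at
        \<open>g\<close> outside \<open>m\<close>, hence a unit, which brings \<open>g\<close>
        itself into \<open>X\<close>.\<close>
      have simple: "X = B" if X: "sm X" "D \<subset> X" "X \<subseteq> B" for X
      proof -
        obtain x where x: "x \<in> X" "x \<notin> D" using X(2) by auto
        then have "x \<in> cyclic g <+>\<^bsub>M\<^esub> D" using X(3) unfolding B_def by auto
        then obtain r d where rd: "r \<in> carrier R" "d \<in> D" "x = r \<odot>\<^bsub>M\<^esub> g \<oplus>\<^bsub>M\<^esub> d"
          by (auto elim!: set_addE simp: cyclic_def)
        have d: "d \<in> carrier M" by (rule sm_carr[OF D rd(2)])
        have "r \<odot>\<^bsub>M\<^esub> g = x \<oplus>\<^bsub>M\<^esub> (\<ominus>\<^bsub>M\<^esub> d)" unfolding rd(3) using rd(1) gc d by (simp add: M.a_assoc M.r_neg)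
        moreover have "\<ominus>\<^bsub>M\<^esub> d \<in> X" using sm_minus[OF D rd(2)] X(2) by auto
        ultimately have rX: "r \<odot>\<^bsub>M\<^esub> g \<in> X" using sm_add[OF X(1) x(1)] by simp
        have "r \<notin> m"
        proof
          assume "r \<in> m"
          then have "x \<in> D" unfolding rd(3) using sm_add[OF D mg rd(2)] by simp
          then show False using x(2) by simp
        qed
        then have r: "r \<in> Units R" by (rule noetherian_local_Units[OF assms(2) rd(1)])
        have "inv r \<odot>\<^bsub>M\<^esub> (r \<odot>\<^bsub>M\<^esub> g) = g" using r rd(1) gc by (simp add: smult_assoc1[symmetric])
        then have "g \<in> X" using sm_smult[OF X(1) R.Units_inv_closed[OF r] rX] by simp
        then have "B \<subseteq> X" unfolding B_def using X(2) by (intro set_add_least[OF X(1)] cyclic_least[OF X(1)]) auto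
        then show "X = B" using X(3) by simp
      qed
      have "\<not> has_chain R M D (Suc (Suc 0)) B"
      proof
        assume "has_chain R M D (Suc (Suc 0)) B"
        then show False
        proof cases
          case (step X)
          from step(1) show False
          proof cases
            case (step X0)
            have "D \<subseteq> X0" using has_chain_submodule[OF step(1)] by simp
            then have "D \<subset> X" using step(3) by auto
            then have "X = B" using simple step(2) \<open>X \<subset> B\<close> by auto
            then show False using \<open>X \<subset> B\<close> by simp
          qed
        qed
      qed
      then have "rel_length R M D B \<noteq> \<infinity>" using enat_le_rel_length_iff[OF B DB, of "Suc (Suc 0)"] by (intro notI) simp
      moreover have "rel_length R M B A \<noteq> \<infinity>"
      proof -
        have "D \<subset> B" using DB gB g(2) by auto
        moreover have "\<forall>y\<in>m. \<exists>t::nat. scale (y [^] t) A \<subseteq> B" using nil DB by (meson order.trans)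
        ultimately show ?thesis using IH[OF B submoduleE(1)[OF B]] BA by simp
      qed
      moreover have "rel_length R M D A = rel_length R M D B + rel_length R M B A" by (rule rel_length_add[OF D B assms(3) DB BA])
      ultimately show ?thesis by (simp add: plus_eq_infty_iff_enat del: not_infinity_eq)
    qed
  qed
  then show ?thesis using assms(5,6) by simp
qed

text \<open>A submodule \<open>D\<close> maximal among the proper submodules of \<open>N\<close>
  contains \<open>m N\<close>, which is incompatible with
  \<open>N \<subseteq> list_smult xs N\<close>. Noetherian induction then forces every submodule of
  \<open>N\<close> to equal \<open>N\<close>, in particular zero.\<close>

lemma nakayama:
  assumes "acc (carrier M)" "noetherian_local_ring R m" "sm N" "set xs \<subseteq> m" "N \<subseteq> list_smult xs N"
  shows "N = {\<zero>\<^bsub>M\<^esub>}"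
proof -
  have mm: "maximalideal m R" using assms(2) by (simp add: noetherian_local_ring_def)
  have idm: "ideal m R" using mm by (simp add: maximalideal_def)
  have "D \<subseteq> N \<longrightarrow> D = N" if "sm D" for D
  proof (rule acc_induct[OF assms(1) that submoduleE(1)[OF that]], intro impI, rule ccontr)
    fix D assume D: "sm D" "D \<subseteq> N" "D \<noteq> N" and IH: "\<And>B. sm B \<Longrightarrow> B \<subseteq> carrier M \<Longrightarrow> D \<subset> B \<Longrightarrow> B \<subseteq> N \<longrightarrow> B = N"
    have big: "cyclic g <+>\<^bsub>M\<^esub> D = N" if g: "g \<in> N" "g \<notin> D" for g
    proof -
      have gc: "g \<in> carrier M" by (rule sm_carr[OF assms(3) g(1)])
      have B: "sm (cyclic g <+>\<^bsub>M\<^esub> D)" by (rule sm_set_add[OF sm_cyclic[OF gc] D(1)])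
      have "g \<in> cyclic g <+>\<^bsub>M\<^esub> D" using set_add_upper1[OF sm_cyclic[OF gc] D(1)] cyclic_self[OF gc] by (rule subsetD)
      then have "D \<subset> cyclic g <+>\<^bsub>M\<^esub> D" using set_add_upper2[OF sm_cyclic[OF gc] D(1)] g(2) by auto
      moreover have "cyclic g <+>\<^bsub>M\<^esub> D \<subseteq> N" by (rule set_add_least[OF assms(3) cyclic_least[OF assms(3) g(1)] D(2)])
      ultimately show ?thesis using IH[OF B submoduleE(1)[OF B]] by simp
    qed
    \<comment> \<open>Otherwise \<open>N = R(yn) + D\<close>, so \<open>n = r(yn) + d\<close> and
      \<open>(1 - ry)n = d\<close> lies in \<open>D\<close>. As \<open>1 - ry\<close> is a unit,
      \<open>n\<close> is in \<open>D\<close>, a contradiction.\<close>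
    have "y \<odot>\<^bsub>M\<^esub> n \<in> D" if y: "y \<in> m" and n: "n \<in> N" for y n
    proof (rule ccontr)
      assume no: "y \<odot>\<^bsub>M\<^esub> n \<notin> D"
      have yc: "y \<in> carrier R" by (rule ideal.Icarr[OF idm y])
      have nc: "n \<in> carrier M" by (rule sm_carr[OF assms(3) n])
      have "n \<in> cyclic (y \<odot>\<^bsub>M\<^esub> n) <+>\<^bsub>M\<^esub> D" using big[OF sm_smult[OF assms(3) yc n] no] n by simp
      then obtain r d where rd: "r \<in> carrier R" "d \<in> D" "n = r \<odot>\<^bsub>M\<^esub> (y \<odot>\<^bsub>M\<^esub> n) \<oplus>\<^bsub>M\<^esub> d"
        by (auto elim!: set_addE simp: cyclic_def)
      have d: "d \<in> carrier M" by (rule sm_carr[OF D(1) rd(2)])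
      have ry: "r \<otimes> y \<in> m" by (rule ideal.I_l_closed[OF idm y rd(1)])
      let ?u = "\<one> \<ominus> r \<otimes> y"
      have uc: "?u \<in> carrier R" using rd(1) yc by simp
      have "?u \<notin> m"
      proof
        assume "?u \<in> m"
        then have "?u \<oplus> r \<otimes> y \<in> m" using ry additive_subgroup.a_closed[OF ideal.axioms(1)[OF idm]] by blast
        moreover have "?u \<oplus> r \<otimes> y = \<one>" using rd(1) yc by (simp add: R.minus_eq R.a_assoc R.l_neg)
        ultimately show False using maximalideal.I_notcarr[OF mm] ideal.one_imp_carrier[OF idm] by simp
      qed
      then have u: "?u \<in> Units R" by (rule noetherian_local_Units[OF assms(2) uc])
      have "?u \<odot>\<^bsub>M\<^esub> n = n \<oplus>\<^bsub>M\<^esub> (\<ominus>\<^bsub>M\<^esub> (r \<odot>\<^bsub>M\<^esub> (y \<odot>\<^bsub>M\<^esub> n)))"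
        using rd(1) yc nc by (simp add: R.minus_eq smult_l_distr smult_l_minus smult_assoc1)
      also have "\<dots> = (d \<oplus>\<^bsub>M\<^esub> r \<odot>\<^bsub>M\<^esub> (y \<odot>\<^bsub>M\<^esub> n)) \<oplus>\<^bsub>M\<^esub> (\<ominus>\<^bsub>M\<^esub> (r \<odot>\<^bsub>M\<^esub> (y \<odot>\<^bsub>M\<^esub> n)))"
        using rd(3) M.a_comm[of d "r \<odot>\<^bsub>M\<^esub> (y \<odot>\<^bsub>M\<^esub> n)"] rd(1) yc nc d by simp
      also have "\<dots> = d" using rd(1) yc nc d by (simp add: M.a_assoc M.r_neg)
      finally have "?u \<odot>\<^bsub>M\<^esub> n \<in> D" using rd(2) by simp
      then have "inv ?u \<odot>\<^bsub>M\<^esub> (?u \<odot>\<^bsub>M\<^esub> n) \<in> D" by (rule sm_smult[OF D(1) R.Units_inv_closed[OF u]])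
      then have "n \<in> D" using u uc nc by (simp add: smult_assoc1[symmetric])
      then show False using no sm_smult[OF D(1) yc] by simp
    qed
    then have "list_smult xs N \<subseteq> D" using assms(4) by (intro list_smult_least D(1)) auto
    then show False using assms(5) D(2,3) by auto
  qed
  then show ?thesis using sm_zero_sub sm_zero[OF assms(3)] by force
qed

section \<open>Lengths of modules and quotient modules as relative lengths\<close>

lemma module_length_eq_rel_length: "module_length R M = rel_length R M {} (carrier M)"
proof -
  have 1: "has_chain R M {} n (N n)" if "\<forall>i\<le>n. sm (N i)" "\<forall>i<n. N i \<subset> N (Suc i)" for n N
    using that
  proof (induction n)
    case 0 then show ?case by (intro has_chain.base) auto
  next
    case (Suc n)
    then have "has_chain R M {} n (N n)" by simp
    then show ?case by (rule has_chain.step) (use Suc.prems in auto)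
  qed
  have 2: "\<exists>N. (\<forall>i\<le>n. sm (N i)) \<and> (\<forall>i<n. N i \<subset> N (Suc i)) \<and> N n = A" if "has_chain R M {} n A" for n A
    using that
  proof (induction rule: has_chain.induct)
    case (base A) then show ?case by (intro exI[of _ "\<lambda>_. A"]) simp
  next
    case (step n A A')
    then obtain N where N: "\<forall>i\<le>n. sm (N i)" "\<forall>i<n. N i \<subset> N (Suc i)" "N n = A" by blast
    show ?case
      by (intro exI[of _ "N(Suc n := A')"]) (use N step.hyps in \<open>auto simp: le_Suc_eq less_Suc_eq\<close>)
  qed
  have "(\<exists>N. (\<forall>i\<le>n. sm (N i)) \<and> (\<forall>i<n. N i \<subset> N (Suc i))) \<longleftrightarrow> has_chain R M {} n (carrier M)" for n
  proof
    assume "\<exists>N. (\<forall>i\<le>n. sm (N i)) \<and> (\<forall>i<n. N i \<subset> N (Suc i))"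
    then obtain N where "\<forall>i\<le>n. sm (N i)" "\<forall>i<n. N i \<subset> N (Suc i)" by blast
    then show "has_chain R M {} n (carrier M)"
      using has_chain_mono[OF 1 submoduleE(1) carrier_is_submodule, of n N] by simp
  next
    assume "has_chain R M {} n (carrier M)"
    from 2[OF this] show "\<exists>N. (\<forall>i\<le>n. sm (N i)) \<and> (\<forall>i<n. N i \<subset> N (Suc i))" by blast
  qed
  then show ?thesis unfolding module_length_def rel_length_def by simp
qed

text \<open>The correspondence theorem: images and preimages under the quotient map are strictly
  monotone between the submodules above \<open>N\<close> and those of the quotient. Afterwards
  quotient modules disappear from the argument.\<close>

lemma module_length_quot:
  assumes N: "sm N" shows "module_length R (quot_module M N) = rel_length R M N (carrier M)"
proof -
  let ?Q = "quot_module M N"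
  interpret Q: module R ?Q using module_quot_module[OF _ N] module_axioms by blast
  interpret N: abelian_subgroup N M
    using N M.abelian_group_axioms by (intro abelian_subgroupI3 additive_subgroupI) (auto simp: submodule_def)
  define q where "q x = N +>\<^bsub>M\<^esub> x" for x
  have q_eq: "q x = q y \<longleftrightarrow> x \<ominus>\<^bsub>M\<^esub> y \<in> N" if "x \<in> carrier M" "y \<in> carrier M" for x y
  proof -
    have "x \<in> N +>\<^bsub>M\<^esub> y \<longleftrightarrow> x \<ominus>\<^bsub>M\<^esub> y \<in> N"
      using N.a_rcos_module[OF that(2,1)] by (simp add: M.minus_eq)
    moreover have "q x = q y \<longleftrightarrow> x \<in> N +>\<^bsub>M\<^esub> y"
      unfolding q_def using N.a_rcos_self[OF that(1)] N.a_repr_independence'[of x y] that by auto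
    ultimately show ?thesis by simp
  qed
  have carr: "carrier ?Q = q ` carrier M"
    unfolding q_def quot_module_def by (auto simp: A_RCOSETS_def' a_r_coset_def')
  have zero: "\<zero>\<^bsub>?Q\<^esub> = N" by (simp add: quot_module_def)
  have qN: "q x = N \<longleftrightarrow> x \<in> N" if "x \<in> carrier M" for x
  proof -
    have "q \<zero>\<^bsub>M\<^esub> = N" unfolding q_def by (rule M.a_coset_add_zero[OF submoduleE(1)[OF N]])
    then show ?thesis using q_eq[OF that M.zero_closed] that M.minus_equality[of "\<zero>\<^bsub>M\<^esub>" "\<zero>\<^bsub>M\<^esub>"] by (simp add: M.minus_eq)
  qed
  have add: "q x \<oplus>\<^bsub>?Q\<^esub> q y = q (x \<oplus>\<^bsub>M\<^esub> y)" if "x \<in> carrier M" "y \<in> carrier M" for x y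
    using N.a_rcos_sum[OF that] by (simp add: q_def quot_module_def)
  have smu: "r \<odot>\<^bsub>?Q\<^esub> q x = q (r \<odot>\<^bsub>M\<^esub> x)" if r: "r \<in> carrier R" and x: "x \<in> carrier M" for r x
  proof -
    have "q (r \<odot>\<^bsub>M\<^esub> y) = q (r \<odot>\<^bsub>M\<^esub> x)" if y: "y \<in> q x" for y
    proof -
      obtain n where n: "n \<in> N" "y = n \<oplus>\<^bsub>M\<^esub> x" using y by (auto simp: q_def a_r_coset_def')
      have nc: "n \<in> carrier M" by (rule sm_carr[OF N n(1)])
      have "r \<odot>\<^bsub>M\<^esub> y \<ominus>\<^bsub>M\<^esub> r \<odot>\<^bsub>M\<^esub> x = r \<odot>\<^bsub>M\<^esub> n"
        unfolding n(2) using nc r x by (simp add: smult_r_distr M.minus_eq M.a_assoc M.r_neg)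
      then show ?thesis using q_eq n nc r x sm_smult[OF N r n(1)] by simp
    qed
    moreover have "x \<in> q x" unfolding q_def using N.a_rcos_self x by simp
    ultimately have "(\<Union>y\<in>q x. q (r \<odot>\<^bsub>M\<^esub> y)) = q (r \<odot>\<^bsub>M\<^esub> x)" by blast
    then show ?thesis by (simp add: q_def quot_module_def)
  qed
  have "rel_length R ?Q {} (carrier ?Q) = rel_length R M N (carrier M)"
  proof (rule antisym)
    show "rel_length R M N (carrier M) \<le> rel_length R ?Q {} (carrier ?Q)"
    proof (rule rel_length_le_map[where f = "\<lambda>X. q ` X"])
      fix X assume X: "sm X" "N \<subseteq> X"
      have Xc: "X \<subseteq> carrier M" by (rule submoduleE(1)[OF X(1)])
      have "submodule (q ` X) R ?Q"
      proof (rule Q.smI)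
        show "q ` X \<subseteq> carrier ?Q" unfolding carr using Xc by (rule image_mono)
        show "\<zero>\<^bsub>?Q\<^esub> \<in> q ` X" unfolding zero using qN[of "\<zero>\<^bsub>M\<^esub>"] sm_zero[OF N] sm_zero[OF X(1)] by force
      next
        fix a b assume "a \<in> q ` X" "b \<in> q ` X"
        then obtain x y where "x \<in> X" "y \<in> X" "a = q x" "b = q y" by blast
        then show "a \<oplus>\<^bsub>?Q\<^esub> b \<in> q ` X" using add[of x y] Xc sm_add[OF X(1), of x y] by auto
      next
        fix r a assume r: "r \<in> carrier R" "a \<in> q ` X"
        then obtain x where "x \<in> X" "a = q x" by blast
        then show "r \<odot>\<^bsub>?Q\<^esub> a \<in> q ` X" using smu[OF r(1), of x] Xc sm_smult[OF X(1) r(1), of x] by auto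
      qed
      then show "submodule (q ` X) R ?Q \<and> {} \<subseteq> q ` X" by simp
    next
      fix X Y assume X: "sm X" "sm Y" "N \<subseteq> X" "X \<subset> Y" "Y \<subseteq> carrier M"
      obtain y where y: "y \<in> Y" "y \<notin> X" using X(4) by auto
      have "q y \<notin> q ` X"
      proof
        assume "q y \<in> q ` X"
        then obtain x where x: "x \<in> X" "q y = q x" by auto
        have c: "x \<in> carrier M" "y \<in> carrier M" using x y X by auto
        have "(y \<ominus>\<^bsub>M\<^esub> x) \<oplus>\<^bsub>M\<^esub> x \<in> X" using q_eq[of y x] c x X(3) sm_add[OF X(1)] by auto
        moreover have "(y \<ominus>\<^bsub>M\<^esub> x) \<oplus>\<^bsub>M\<^esub> x = y" using c by (simp add: M.minus_eq M.a_assoc M.l_neg)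
        ultimately show False using y(2) by simp
      qed
      then show "q ` X \<subset> q ` Y" using X(4) y(1) by blast
    qed (use carrier_is_submodule Q.carrier_is_submodule submoduleE(1)[OF N] in \<open>simp_all add: carr\<close>)
    show "rel_length R ?Q {} (carrier ?Q) \<le> rel_length R M N (carrier M)"
    proof (rule rel_length_le_map[where f = "\<lambda>Y. {x \<in> carrier M. q x \<in> Y}"])
      fix Y assume Y: "submodule Y R ?Q"
      have "sm {x \<in> carrier M. q x \<in> Y}"
      proof (rule smI)
        show "\<zero>\<^bsub>M\<^esub> \<in> {x \<in> carrier M. q x \<in> Y}" using qN[of "\<zero>\<^bsub>M\<^esub>"] sm_zero[OF N] Q.sm_zero[OF Y] zero by simp
      next
        fix a b assume "a \<in> {x \<in> carrier M. q x \<in> Y}" "b \<in> {x \<in> carrier M. q x \<in> Y}"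
        then show "a \<oplus>\<^bsub>M\<^esub> b \<in> {x \<in> carrier M. q x \<in> Y}" using add[of a b] Q.sm_add[OF Y, of "q a" "q b"] by auto
      next
        fix r a assume "r \<in> carrier R" "a \<in> {x \<in> carrier M. q x \<in> Y}"
        then show "r \<odot>\<^bsub>M\<^esub> a \<in> {x \<in> carrier M. q x \<in> Y}" using smu[of r a] Q.sm_smult[OF Y, of r "q a"] by auto
      qed auto
      moreover have "N \<subseteq> {x \<in> carrier M. q x \<in> Y}"
      proof
        fix x assume x: "x \<in> N"
        have "x \<in> carrier M" by (rule sm_carr[OF N x])
        moreover from this have "q x = \<zero>\<^bsub>?Q\<^esub>" using qN x zero by simp
        ultimately show "x \<in> {x \<in> carrier M. q x \<in> Y}" using Q.sm_zero[OF Y] by simp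
      qed
      ultimately show "sm {x \<in> carrier M. q x \<in> Y} \<and> N \<subseteq> {x \<in> carrier M. q x \<in> Y}" by simp
    next
      fix X Y assume "X \<subset> Y" "Y \<subseteq> carrier ?Q"
      then show "{x \<in> carrier M. q x \<in> X} \<subset> {x \<in> carrier M. q x \<in> Y}" unfolding carr by auto
    qed (use carrier_is_submodule Q.carrier_is_submodule in auto)
  qed
  then show ?thesis using Q.module_length_eq_rel_length by simp
qed

end

section \<open>Comparing Hilbert coefficients\<close>

text \<open>The polynomial \<open>(X + k) choose k\<close>. The field is left open because Hilbert
  coefficients live over the rationals, while signs of leading coefficients are found from growth
  over the reals.\<close>

definition binomial_poly :: "nat \<Rightarrow> 'a :: field_char_0 poly" where
  "binomial_poly k = Polynomial.smult (1 / fact k) (\<Prod>i=0..<k. [:of_nat k - of_nat i, 1:])"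

lemma poly_binomial_poly: "poly (binomial_poly k) x = (x + of_nat k) gchoose k"
  unfolding binomial_poly_def gbinomial_prod_rev by (simp add: poly_prod algebra_simps)

lemma binomial_poly_degree: "Polynomial.degree (binomial_poly k :: 'a :: field_char_0 poly) = k"
  and coeff_binomial_poly: "Polynomial.coeff (binomial_poly k :: 'a :: field_char_0 poly) k = 1 / fact k"
proof -
  have d: "Polynomial.degree (\<Prod>i=0..<n. [:of_nat k - of_nat i, 1 :: 'a:]) = n" for n
    by (subst degree_prod_eq_sum_degree) auto
  have l: "lead_coeff (\<Prod>i=0..<n. [:of_nat k - of_nat i, 1 :: 'a:]) = 1" for n
    by (subst lead_coeff_prod) simp
  show "Polynomial.degree (binomial_poly k :: 'a poly) = k" unfolding binomial_poly_def using d by simp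
  show "Polynomial.coeff (binomial_poly k :: 'a poly) k = 1 / fact k" unfolding binomial_poly_def using d[of k] l[of k] by simp
qed

definition binomial_sum_poly :: "nat \<Rightarrow> (nat \<Rightarrow> int) \<Rightarrow> 'a :: field_char_0 poly" where
  "binomial_sum_poly D c = (\<Sum>k\<le>D. Polynomial.smult (of_int (c k)) (binomial_poly k))"

lemma poly_binomial_sum_poly: "poly (binomial_sum_poly D c) x = (\<Sum>k\<le>D. of_int (c k) * ((x + of_nat k) gchoose k))"
  unfolding binomial_sum_poly_def by (simp add: poly_sum poly_binomial_poly)

lemma poly_binomial_sum_poly_nat:
  "poly (binomial_sum_poly D c) (of_nat n :: 'a :: field_char_0) = of_int (\<Sum>k\<le>D. c k * int ((n + k) choose k))"
  unfolding poly_binomial_sum_poly by (simp add: binomial_gbinomial)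

lemma coeff_binomial_sum_poly: "Polynomial.coeff (binomial_sum_poly D c :: 'a :: field_char_0 poly) D = of_int (c D) / fact D"
proof -
  have "Polynomial.coeff (binomial_sum_poly D c :: 'a poly) D = (\<Sum>k\<le>D. if k = D then of_int (c D) / fact D else 0)"
    unfolding binomial_sum_poly_def coeff_sum
    by (intro sum.cong refl) (auto simp: coeff_binomial_poly binomial_poly_degree intro!: coeff_eq_0)
  then show ?thesis by simp
qed

lemma degree_binomial_sum_poly:
  assumes "c D \<noteq> 0" shows "Polynomial.degree (binomial_sum_poly D c :: 'a :: field_char_0 poly) = D"
proof (rule antisym)
  show "Polynomial.degree (binomial_sum_poly D c :: 'a poly) \<le> D"
    unfolding binomial_sum_poly_def using degree_smult_le by (intro degree_sum_le) (auto simp: binomial_poly_degree)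
  show "D \<le> Polynomial.degree (binomial_sum_poly D c :: 'a poly)"
    by (rule le_degree) (use assms in \<open>simp add: coeff_binomial_sum_poly\<close>)
qed

text \<open>Comparing the two expansions gives the \<open>i\<close>-th coefficient as
  \<open>(-1)^i c (D - i)\<close>. The assumption \<open>c D \<noteq> 0\<close> makes
  \<open>D\<close> the true degree; otherwise the indices would shift.\<close>

lemma hilbert_coeff_binomial_sum_poly:
  assumes "c D \<noteq> 0" "D \<ge> 1"
  shows "hilbert_coeff (binomial_sum_poly D c) 1 = - c (D - 1)"
proof -
  let ?e = "\<lambda>i. if i \<le> D then (-1) ^ i * c (D - i) else 0"
  have "hilbert_coeff (binomial_sum_poly D c) = ?e"
  proof (rule hilbert_coeff_eqI)
    fix x
    have "poly (binomial_sum_poly D c) x = (\<Sum>i\<le>D. of_int (c (D - i)) * ((x + of_nat (D - i)) gchoose (D - i)))"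
      unfolding poly_binomial_sum_poly
      using sum.nat_diff_reindex[of "\<lambda>k. of_int (c k) * ((x + of_nat k) gchoose k)" "Suc D"]
      by (simp add: lessThan_Suc_atMost)
    also have "\<dots> = (\<Sum>i\<le>D. (-1) ^ i * of_int (?e i) * ((x + of_nat (D - i)) gchoose (D - i)))"
      by (intro sum.cong refl) (simp add: mult.assoc[symmetric] power_mult_distrib[symmetric])
    finally show "poly (binomial_sum_poly D c) x = (\<Sum>i\<le>Polynomial.degree (binomial_sum_poly D c :: rat poly). (-1) ^ i * of_int (?e i) *
       ((x + of_nat (Polynomial.degree (binomial_sum_poly D c :: rat poly) - i)) gchoose (Polynomial.degree (binomial_sum_poly D c :: rat poly) - i)))"
      unfolding degree_binomial_sum_poly[of c, OF assms(1)] .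
  qed (simp add: degree_binomial_sum_poly[of c, OF assms(1)])
  then show ?thesis using assms(2) by simp
qed

lemma e1_eventual_poly:
  fixes F :: "nat \<Rightarrow> enat"
  assumes "\<And>n. F n \<noteq> \<infinity>"
    and "\<forall>\<^sub>F n in sequentially. int (the_enat (F n)) = (\<Sum>k\<le>D. c k * int ((n + k) choose k))"
    and "c D \<noteq> 0" "D \<ge> 1"
  shows "hilbert_coeff (eventual_poly F) 1 = - c (D - 1)"
proof -
  have "agrees_eventually F (binomial_sum_poly D c)"
    unfolding agrees_eventually_def using assms(2)
  proof eventually_elim
    case (elim n)
    obtain l where l: "F n = enat l" using assms(1)[of n] by auto
    have "poly (binomial_sum_poly D c) (of_nat n) = (of_int (int l) :: rat)"
      unfolding poly_binomial_sum_poly_nat using elim l by (metis the_enat.simps)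
    then show ?case using l by auto
  qed
  then have "eventual_poly F = binomial_sum_poly D c" by (rule eventual_poly_eqI)
  then show ?thesis using hilbert_coeff_binomial_sum_poly assms(3,4) by simp
qed

section \<open>Growth and leading coefficients\<close>

lemma lead_coeff_nonneg:
  fixes p :: "real poly"
  assumes "\<forall>\<^sub>F n in sequentially. poly p (of_nat n) \<ge> 0"
  shows "lead_coeff p \<ge> 0"
proof (rule ccontr)
  assume "\<not> lead_coeff p \<ge> 0"
  then have l: "lead_coeff (- p) > 0" by simp
  obtain z where z: "\<forall>x\<ge>z. poly (- p) x \<ge> lead_coeff (- p)" using poly_pinfty_gt_lc[OF l] by blast
  obtain N where N: "\<And>n. n \<ge> N \<Longrightarrow> poly p (of_nat n) \<ge> 0" using assms by (auto simp: eventually_sequentially)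
  define n where "n = max N (nat \<lceil>z\<rceil>)"
  have "real n \<ge> z" unfolding n_def by linarith
  then have "poly (- p) (real n) > 0" using z l by fastforce
  moreover have "n \<ge> N" unfolding n_def by simp
  ultimately show False using N[of n] by simp
qed

text \<open>A shift of the argument preserves degree and leading coefficient, so the top terms
  cancel.\<close>

lemma degree_pcompose_shift_diff:
  fixes p :: "real poly"
  assumes "Polynomial.degree p > 0"
  shows "Polynomial.degree (pcompose p [:b, 1:] - p) < Polynomial.degree p"
proof (rule ccontr)
  let ?q = "pcompose p [:b, 1:] - p"
  have d: "Polynomial.degree (pcompose p [:b, 1:]) = Polynomial.degree p" by (simp add: degree_pcompose)
  have l: "lead_coeff (pcompose p [:b, 1:]) = lead_coeff p" by (subst lead_coeff_comp) auto
  assume "\<not> Polynomial.degree ?q < Polynomial.degree p"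
  moreover have "Polynomial.degree ?q \<le> Polynomial.degree p" using d by (intro degree_diff_le) auto
  ultimately have e: "Polynomial.degree ?q = Polynomial.degree p" by simp
  have "lead_coeff ?q = 0" unfolding e using l d by simp
  then have "?q = 0" by (simp only: leading_coeff_0_iff)
  then show False using e assms by simp
qed

lemma eventually_numerical_normal:
  assumes "eventually_numerical f"
  shows "(\<forall>\<^sub>F n in sequentially. f n = 0) \<or>
    (\<exists>D c. c D \<noteq> 0 \<and> (\<forall>\<^sub>F n in sequentially. f n = (\<Sum>k\<le>D. c k * int ((n + k) choose k))))"
proof -
  obtain D c where "\<forall>\<^sub>F n in sequentially. f n = (\<Sum>k\<le>D. c k * int ((n + k) choose k))"
    using assms unfolding eventually_numerical_def by blast
  then show ?thesis
  proof (induction D)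
    case 0
    then show ?case by (cases "c 0 = 0") (auto intro!: exI[of _ 0] exI[of _ c])
  next
    case (Suc D)
    show ?case
    proof (cases "c (Suc D) = 0")
      case True
      then show ?thesis using Suc by simp
    next
      case False
      then show ?thesis using Suc.prems by blast
    qed
  qed
qed

lemma e1_compare:
  fixes F G :: "nat \<Rightarrow> enat"
  defines "f \<equiv> \<lambda>n. int (the_enat (F n))" and "g \<equiv> \<lambda>n. int (the_enat (G n))"
  assumes "\<And>n. F n \<noteq> \<infinity>" "\<And>n. G n \<noteq> \<infinity>" "eventually_numerical f" "eventually_numerical g"
    and le: "\<forall>\<^sub>F n in sequentially. f n \<le> g n"
    and ge: "\<And>n. g n \<le> f (n + K) + l"
    and nonconst: "\<not> (\<exists>c. \<forall>\<^sub>F n in sequentially. f n = c)"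
  shows "hilbert_coeff (eventual_poly G) 1 \<le> hilbert_coeff (eventual_poly F) 1"
proof -
  obtain D a where a: "a D \<noteq> 0" "\<forall>\<^sub>F n in sequentially. f n = (\<Sum>k\<le>D. a k * int ((n + k) choose k))"
    using eventually_numerical_normal[OF assms(5)] nonconst by blast
  have D: "D \<ge> 1"
  proof (rule ccontr)
    assume "\<not> D \<ge> 1"
    then have "D = 0" by simp
    then show False using a(2) nonconst by auto
  qed
  let ?p = "binomial_sum_poly D a :: real poly"
  have dp: "Polynomial.degree ?p = D" by (rule degree_binomial_sum_poly[of a, OF a(1)])
  have fp: "\<forall>\<^sub>F n in sequentially. real_of_int (f n) = poly ?p (of_nat n)"
    using a(2) by eventually_elim (simp only: poly_binomial_sum_poly_nat)
  have "\<exists>c. (\<forall>\<^sub>F n in sequentially. g n - f n = (\<Sum>k\<le>D - 1. c k * int ((n + k) choose k))) \<and> c (D - 1) \<ge> 0"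
    using eventually_numerical_normal[OF eventually_numerical_diff[OF assms(6,5)]]
  proof
    assume "\<forall>\<^sub>F n in sequentially. g n - f n = 0"
    then show ?thesis by (intro exI[of _ "\<lambda>_. 0"]) simp
  next
    assume "\<exists>E c. c E \<noteq> 0 \<and> (\<forall>\<^sub>F n in sequentially. g n - f n = (\<Sum>k\<le>E. c k * int ((n + k) choose k)))"
    then obtain E c where c: "c E \<noteq> 0"
      "\<forall>\<^sub>F n in sequentially. g n - f n = (\<Sum>k\<le>E. c k * int ((n + k) choose k))" by blast
    let ?q = "binomial_sum_poly E c :: real poly"
    have dq: "Polynomial.degree ?q = E" by (rule degree_binomial_sum_poly[of c, OF c(1)])
    have gq: "\<forall>\<^sub>F n in sequentially. real_of_int (g n - f n) = poly ?q (of_nat n)"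
      using c(2) by eventually_elim (simp only: poly_binomial_sum_poly_nat)
    have "\<forall>\<^sub>F n in sequentially. poly ?q (of_nat n) \<ge> 0"
      using gq le by eventually_elim simp
    then have "lead_coeff ?q \<ge> 0" by (rule lead_coeff_nonneg)
    then have cE: "c E > 0" using c(1) fact_gt_zero[of E, where 'a = real] unfolding dq coeff_binomial_sum_poly
      by (auto simp: zero_le_divide_iff)
    have "E < D"
    proof (rule ccontr)
      assume ED: "\<not> E < D"
      \<comment> \<open>At \<open>n\<close> this takes the value \<open>f (n + K) - f n + l\<close>,
        so \<open>?w - ?q\<close> becomes \<open>f (n + K) + l - g n\<close>, which is nonnegative.
        But \<open>?w\<close> has degree below \<open>E\<close>, and \<open>?q\<close> has degree
        \<open>E\<close> and positive leading coefficient.\<close>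
      let ?w = "(pcompose ?p [:real K, 1:] - ?p) + [:real_of_int l:]"
      have "Polynomial.degree (pcompose ?p [:real K, 1:] - ?p) < D"
        using degree_pcompose_shift_diff[of ?p] dp D by simp
      then have dw: "Polynomial.degree ?w < E" using ED D by (intro degree_add_less) auto
      have "\<forall>\<^sub>F n in sequentially. real_of_int (f (n + K)) = poly ?p (of_nat (n + K))"
        using fp unfolding eventually_sequentially by (meson trans_le_add1)
      then have "\<forall>\<^sub>F n in sequentially. poly (?w - ?q) (of_nat n) \<ge> 0"
        using gq fp
      proof eventually_elim
        case (elim n)
        have "real_of_int (g n) \<le> real_of_int (f (n + K) + l)" using ge[of n] by (simp only: of_int_le_iff)
        then show ?case using elim by (simp add: poly_pcompose add.commute)
      qed
      then have "lead_coeff (?w - ?q) \<ge> 0" by (rule lead_coeff_nonneg)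
      moreover have "lead_coeff (?w - ?q) = - lead_coeff ?q"
        using lead_coeff_add_le[of ?w "- ?q"] dw dq by simp
      ultimately have "lead_coeff ?q \<le> 0" by (metis neg_0_le_iff_le)
      moreover have "lead_coeff ?q > 0" using cE unfolding dq coeff_binomial_sum_poly by simp
      ultimately show False by simp
    qed
    then have E: "E \<le> D - 1" by simp
    show ?thesis
    proof (intro exI conjI)
      \<comment> \<open>Padding with zeros: the coefficient at \<open>D - 1\<close> is either zero
        or the positive leading one.\<close>
      let ?c = "\<lambda>k. if k \<le> E then c k else 0"
      show "\<forall>\<^sub>F n in sequentially. g n - f n = (\<Sum>k\<le>D - 1. ?c k * int ((n + k) choose k))"
        using c(2) by eventually_elim (use sum_choose_extend[OF E] in metis)
      show "?c (D - 1) \<ge> 0" using cE E by auto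
    qed
  qed
  then obtain c where c: "\<forall>\<^sub>F n in sequentially. g n - f n = (\<Sum>k\<le>D - 1. c k * int ((n + k) choose k))"
    "c (D - 1) \<ge> 0" by blast
  \<comment> \<open>The top coefficient \<open>?b D\<close> is still \<open>a D\<close>, since
    \<open>D \<ge> 1\<close> keeps \<open>D\<close> out of the correction. Hence \<open>g\<close>
    has exact degree \<open>D\<close>, and its coefficient \<open>e\<^sub>1\<close> is read off at
    \<open>D - 1\<close> as for \<open>f\<close>.\<close>
  let ?b = "\<lambda>k. a k + (if k \<le> D - 1 then c k else 0)"
  have "\<forall>\<^sub>F n in sequentially. g n = (\<Sum>k\<le>D. ?b k * int ((n + k) choose k))"
    using c(1) a(2)
  proof eventually_elim
    case (elim n)
    have "g n = (\<Sum>k\<le>D. a k * int ((n + k) choose k)) + (\<Sum>k\<le>D - 1. c k * int ((n + k) choose k))"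
      using elim by simp
    also have "\<dots> = (\<Sum>k\<le>D. ?b k * int ((n + k) choose k))"
      by (subst sum_choose_extend[of "D - 1" D]) (simp_all only: sum.distrib distrib_right diff_le_self)
    finally show ?case .
  qed
  then have "hilbert_coeff (eventual_poly G) 1 = - ?b (D - 1)"
    using assms(4) a(1) D unfolding g_def by (intro e1_eventual_poly) auto
  moreover have "hilbert_coeff (eventual_poly F) 1 = - a (D - 1)"
    using assms(3) a D unfolding f_def by (intro e1_eventual_poly) auto
  ultimately show ?thesis using c(2) by simp
qed

section \<open>Ring extensions\<close>

lemma carrier_ring_as_module [simp]: "carrier (ring_as_module S) = carrier S"
  and smult_ring_as_module [simp]: "x \<odot>\<^bsub>ring_as_module S\<^esub> y = x \<otimes>\<^bsub>S\<^esub> y"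
  and add_ring_as_module [simp]: "x \<oplus>\<^bsub>ring_as_module S\<^esub> y = x \<oplus>\<^bsub>S\<^esub> y"
  and zero_ring_as_module [simp]: "\<zero>\<^bsub>ring_as_module S\<^esub> = \<zero>\<^bsub>S\<^esub>"
  by (simp_all add: ring_as_module_def)

lemma ring_extensionD:
  assumes "ring_extension R S"
  shows "cring R" "cring S" "carrier R \<subseteq> carrier S"
    and "\<And>x y. x \<in> carrier R \<Longrightarrow> y \<in> carrier R \<Longrightarrow> x \<otimes>\<^bsub>R\<^esub> y = x \<otimes>\<^bsub>S\<^esub> y"
    and "\<And>x y. x \<in> carrier R \<Longrightarrow> y \<in> carrier R \<Longrightarrow> x \<oplus>\<^bsub>R\<^esub> y = x \<oplus>\<^bsub>S\<^esub> y"
    and "\<one>\<^bsub>R\<^esub> = \<one>\<^bsub>S\<^esub>" "\<zero>\<^bsub>R\<^esub> = \<zero>\<^bsub>S\<^esub>"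
proof -
  interpret R: cring R using assms by (simp add: ring_extension_def)
  interpret S: cring S using assms by (simp add: ring_extension_def)
  have h: "(\<lambda>x. x) \<in> ring_hom R S" using assms by (simp add: ring_extension_def)
  show "cring R" "cring S" "carrier R \<subseteq> carrier S" using assms by (simp_all add: ring_extension_def)
  show "x \<otimes>\<^bsub>R\<^esub> y = x \<otimes>\<^bsub>S\<^esub> y" if "x \<in> carrier R" "y \<in> carrier R" for x y
    using ring_hom_mult[OF h that] .
  show "x \<oplus>\<^bsub>R\<^esub> y = x \<oplus>\<^bsub>S\<^esub> y" if "x \<in> carrier R" "y \<in> carrier R" for x y
    using ring_hom_add[OF h that] .
  show "\<one>\<^bsub>R\<^esub> = \<one>\<^bsub>S\<^esub>" using ring_hom_one[OF h] .
  show "\<zero>\<^bsub>R\<^esub> = \<zero>\<^bsub>S\<^esub>" using ring_hom_zero[OF h R.ring_axioms S.ring_axioms] .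
qed

lemma ring_extension_refl: "cring R \<Longrightarrow> ring_extension R R"
  by (simp add: ring_extension_def ring_hom_def)

lemma submodule_ideal_base:
  assumes "ring_extension R S" "ideal J R" shows "submodule J R (ring_as_module S)"
proof -
  interpret M: module R "ring_as_module S" by (rule module_ring_as_module[OF assms(1)])
  interpret J: ideal J R by fact
  note e = ring_extensionD[OF assms(1)]
  show ?thesis
  proof (rule M.smI)
    show "J \<subseteq> carrier (ring_as_module S)" using J.a_subset e(3) by auto
    show "\<zero>\<^bsub>ring_as_module S\<^esub> \<in> J" using J.zero_closed e(7) by simp
    show "a \<oplus>\<^bsub>ring_as_module S\<^esub> b \<in> J" if "a \<in> J" "b \<in> J" for a b
      using J.a_closed[OF that] e(5)[OF J.Icarr[OF that(1)] J.Icarr[OF that(2)]] by simp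
    show "a \<odot>\<^bsub>ring_as_module S\<^esub> b \<in> J" if "a \<in> carrier R" "b \<in> J" for a b
      using J.I_l_closed[OF that(2,1)] e(4)[OF that(1) J.Icarr[OF that(2)]] by simp
  qed
qed

lemma submodule_ideal_top:
  assumes "ring_extension R S" "ideal J S" shows "submodule J R (ring_as_module S)"
proof -
  interpret M: module R "ring_as_module S" by (rule module_ring_as_module[OF assms(1)])
  interpret J: ideal J S by fact
  note e = ring_extensionD[OF assms(1)]
  show ?thesis
  proof (rule M.smI)
    show "a \<odot>\<^bsub>ring_as_module S\<^esub> b \<in> J" if "a \<in> carrier R" "b \<in> J" for a b
      using J.I_l_closed[OF that(2), of a] that(1) e(3) by auto
  qed (use J.a_subset J.zero_closed J.a_closed in auto)
qed

lemma submodule_base_iff: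
  assumes "ring_extension R S" "X \<subseteq> carrier R"
  shows "submodule X R (ring_as_module R) \<longleftrightarrow> submodule X R (ring_as_module S)"
proof -
  note e = ring_extensionD[OF assms(1)]
  interpret MS: module R "ring_as_module S" by (rule module_ring_as_module[OF assms(1)])
  interpret MR: module R "ring_as_module R" by (rule module_ring_as_module[OF ring_extension_refl[OF e(1)]])
  have eq: "a \<otimes>\<^bsub>R\<^esub> b = a \<otimes>\<^bsub>S\<^esub> b" "a \<oplus>\<^bsub>R\<^esub> c = a \<oplus>\<^bsub>S\<^esub> c" if "b \<in> X" "a \<in> carrier R" "c \<in> X" for a b c
    using e(4,5) that assms(2) by auto
  show ?thesis
  proof
    assume X: "submodule X R (ring_as_module R)"
    show "submodule X R (ring_as_module S)"
    proof (rule MS.smI)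
      show "X \<subseteq> carrier (ring_as_module S)" using assms(2) e(3) by auto
      show "\<zero>\<^bsub>ring_as_module S\<^esub> \<in> X" using MR.sm_zero[OF X] e(7) by simp
      show "a \<oplus>\<^bsub>ring_as_module S\<^esub> b \<in> X" if "a \<in> X" "b \<in> X" for a b
        using MR.sm_add[OF X that] eq(2)[of a a b] that assms(2) by auto
      show "a \<odot>\<^bsub>ring_as_module S\<^esub> b \<in> X" if "a \<in> carrier R" "b \<in> X" for a b
        using MR.sm_smult[OF X that] eq(1)[OF that(2,1,2)] by simp
    qed
  next
    assume X: "submodule X R (ring_as_module S)"
    show "submodule X R (ring_as_module R)"
    proof (rule MR.smI)
      show "X \<subseteq> carrier (ring_as_module R)" using assms(2) by simp
      show "\<zero>\<^bsub>ring_as_module R\<^esub> \<in> X" using MS.sm_zero[OF X] e(7) by simp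
      show "a \<oplus>\<^bsub>ring_as_module R\<^esub> b \<in> X" if "a \<in> X" "b \<in> X" for a b
        using MS.sm_add[OF X that] eq(2)[of a a b] that assms(2) by auto
      show "a \<odot>\<^bsub>ring_as_module R\<^esub> b \<in> X" if "a \<in> carrier R" "b \<in> X" for a b
        using MS.sm_smult[OF X that] eq(1)[OF that(2,1,2)] by simp
    qed
  qed
qed

text \<open>The Hilbert polynomial of the filtration uses \<open>R\<close> as a module over itself;
  this carries its lengths into \<open>S\<close>, where all comparisons take place.\<close>

lemma rel_length_base:
  assumes "ring_extension R S" "ideal J R"
  shows "rel_length R (ring_as_module R) J (carrier R) = rel_length R (ring_as_module S) J (carrier R)"
proof -
  note e = ring_extensionD[OF assms(1)]
  interpret R: cring R by (rule e(1))
  have J: "J \<subseteq> carrier R" using ideal.Icarr[OF assms(2)] by auto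
  have c: "submodule (carrier R) R (ring_as_module R)" "submodule (carrier R) R (ring_as_module S)"
    using submodule_ideal_base[OF assms(1) R.oneideal] submodule_base_iff[OF assms(1) order.refl] by simp_all
  show ?thesis
  proof (rule antisym)
    show "rel_length R (ring_as_module R) J (carrier R) \<le> rel_length R (ring_as_module S) J (carrier R)"
      by (rule rel_length_le_map[where f = "\<lambda>X. X"]) (use c J submodule_base_iff[OF assms(1)] in simp_all)
    show "rel_length R (ring_as_module S) J (carrier R) \<le> rel_length R (ring_as_module R) J (carrier R)"
      by (rule rel_length_le_map[where f = "\<lambda>X. X"]) (use c J submodule_base_iff[OF assms(1)] in simp_all)
  qed
qed

section \<open>Powers of an ideal and their extensions\<close>

lemma ideal_power_0: "ideal_power R I 0 = carrier R"
  by (simp add: nat_pow_def ideals_set_def)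

lemma ideal_power_Suc: "ideal_power R I (Suc n) = ideal_power R I n \<cdot>\<^bsub>R\<^esub> I"
  by (simp add: nat_pow_def ideals_set_def)

lemma ideal_power_ideal: assumes "cring R" "ideal I R" shows "ideal (ideal_power R I n) R"
proof -
  interpret cring R by fact
  show ?thesis by (induction n) (simp_all only: ideal_power_0 ideal_power_Suc oneideal ideal_prod_is_ideal assms)
qed

lemma pow_in_ideal_power:
  fixes R (structure)
  assumes "cring R" "ideal I R" "y \<in> carrier R" "y [^]\<^bsub>R\<^esub> (t::nat) \<in> I"
  shows "y [^]\<^bsub>R\<^esub> (n * t) \<in> ideal_power R I n"
proof -
  interpret cring R by fact
  show ?thesis
  proof (induction n)
    case 0 show ?case unfolding ideal_power_0 by simp
  next
    case (Suc n)
    have "y [^] (Suc n * t) = y [^] (n * t) \<otimes> y [^] t" using assms(3) by (simp add: nat_pow_mult add.commute)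
    then show ?case unfolding ideal_power_Suc using ideal_prod.prod[OF Suc assms(4)] by simp
  qed
qed

text \<open>The bridge between ideal arithmetic and the graded theory: ideal products and generated
  ideals become sums of multiples by the generators \<open>xs\<close>, both in \<open>R\<close> and
  in \<open>S\<close>.\<close>

lemma ideal_power_eq_graded_span:
  fixes R :: "('a, 'b) ring_scheme" and S :: "('a, 'c) ring_scheme"
  assumes "ring_extension R S" "ideal I R" "set xs \<subseteq> carrier R" "I = Idl\<^bsub>R\<^esub> (set xs)"
  shows "ideal_power R I n = module.graded_span (ring_as_module S) xs (carrier R) n"
    and "Idl\<^bsub>S\<^esub> (ideal_power R I n) = module.graded_span (ring_as_module S) xs (carrier S) n"
proof -
  note e = ring_extensionD[OF assms(1)]
  interpret R: cring R by (rule e(1))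
  interpret S: cring S by (rule e(2))
  interpret M: module R "ring_as_module S" by (rule module_ring_as_module[OF assms(1)])
  have xI: "x \<in> I" if "x \<in> set xs" for x using R.genideal_self[OF assms(3)] assms(4) that by auto
  have idp: "ideal (ideal_power R I n) R" for n by (rule ideal_power_ideal[OF e(1) assms(2)])
  have psub: "ideal_power R I n \<subseteq> carrier R" for n using ideal.Icarr[OF idp] by auto
  have psm: "M.sm (ideal_power R I n)" for n by (rule submodule_ideal_base[OF assms(1) idp])
  \<comment> \<open>The scalars \<open>r\<close> that send \<open>a\<close> into the right-hand side
    form an ideal containing \<open>xs\<close>, hence containing \<open>I\<close>.\<close>
  have Isub: "I \<subseteq> M.colon (M.list_smult xs (ideal_power R I n)) a" if a: "a \<in> ideal_power R I n" for a n
  proof -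
    have ac: "a \<in> carrier R" using psub a by auto
    have aM: "a \<in> carrier (ring_as_module S)" using ac e(3) by auto
    have s: "M.sm (M.list_smult xs (ideal_power R I n))" by (rule M.sm_list_smult[OF assms(3) psm])
    have "Idl\<^bsub>R\<^esub> (set xs) \<subseteq> {r \<in> carrier R. r \<odot>\<^bsub>ring_as_module S\<^esub> a \<in> M.list_smult xs (ideal_power R I n)}"
    proof (rule R.genideal_minimal[OF M.ideal_transporter[OF s aM]])
      show "set xs \<subseteq> {r \<in> carrier R. r \<odot>\<^bsub>ring_as_module S\<^esub> a \<in> M.list_smult xs (ideal_power R I n)}"
        using M.scale_sub_list_smult[OF assms(3) psm] a assms(3) by blast
    qed
    then have "r \<in> carrier R \<and> r \<otimes>\<^bsub>S\<^esub> a \<in> M.list_smult xs (ideal_power R I n)" if "r \<in> I" for r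
      using that assms(4) by auto
    then show ?thesis unfolding M.colon_def using e(3) S.m_comm ac by (auto simp: subset_iff)
  qed
  have step: "ideal_power R I (Suc n) = M.list_smult xs (ideal_power R I n)" for n
  proof
    have s: "M.sm (M.list_smult xs (ideal_power R I n))" by (rule M.sm_list_smult[OF assms(3) psm])
    show "ideal_power R I (Suc n) \<subseteq> M.list_smult xs (ideal_power R I n)"
    proof
      fix z assume "z \<in> ideal_power R I (Suc n)"
      then have "z \<in> ideal_power R I n \<cdot>\<^bsub>R\<^esub> I" by (simp only: ideal_power_Suc)
      then show "z \<in> M.list_smult xs (ideal_power R I n)"
      proof (induction rule: ideal_prod.induct)
        case (prod i j)
        then have c: "i \<in> carrier R" "j \<in> carrier R" using psub ideal.Icarr[OF assms(2)] by auto
        have "i \<odot>\<^bsub>ring_as_module S\<^esub> j \<in> M.list_smult xs (ideal_power R I n)"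
          using Isub[OF prod(1)] prod(2) unfolding M.colon_def by blast
        then show ?case using e(4)[OF c] by simp
      next
        case (sum s1 s2)
        have c: "s1 \<in> carrier R" "s2 \<in> carrier R"
          using sum(1,2) R.ideal_prod_in_carrier[OF idp assms(2)] by auto
        show ?case using M.sm_add[OF s sum(3,4)] e(5)[OF c] by simp
      qed
    qed
    show "M.list_smult xs (ideal_power R I n) \<subseteq> ideal_power R I (Suc n)"
    proof (rule M.list_smult_least[OF psm])
      fix x assume x: "x \<in> set xs"
      have xc: "x \<in> carrier R" using x assms(3) by auto
      show "M.scale x (ideal_power R I n) \<subseteq> ideal_power R I (Suc n)"
      proof
        fix z assume "z \<in> M.scale x (ideal_power R I n)"
        then obtain a where a: "a \<in> ideal_power R I n" "z = x \<otimes>\<^bsub>S\<^esub> a" by auto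
        have ac: "a \<in> carrier R" using psub a by auto
        have "z = a \<otimes>\<^bsub>R\<^esub> x" using a(2) e(4)[OF xc ac] R.m_comm[OF xc ac] by simp
        then show "z \<in> ideal_power R I (Suc n)" unfolding ideal_power_Suc using ideal_prod.prod[OF a(1) xI[OF x]] by simp
      qed
    qed
  qed
  show 1: "ideal_power R I n = M.graded_span xs (carrier R) n" for n
  proof (induction n)
    case 0 show ?case unfolding ideal_power_0 by simp
  next
    case (Suc n) then show ?case unfolding step by simp
  qed
  let ?P = "\<lambda>n. Idl\<^bsub>S\<^esub> (ideal_power R I n)"
  have psubS: "ideal_power R I n \<subseteq> carrier S" for n using psub e(3) by blast
  have Pid: "ideal (?P n) S" for n by (rule S.genideal_ideal[OF psubS])
  have Psm: "M.sm (?P n)" for n by (rule submodule_ideal_top[OF assms(1) Pid])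
  have PS: "?P n \<subseteq> carrier S" for n using ideal.Icarr[OF Pid] by auto
  have P0: "?P 0 = carrier S"
  proof -
    have "\<one>\<^bsub>S\<^esub> \<in> ideal_power R I 0" unfolding ideal_power_0 using e(6) R.one_closed by simp
    then have "\<one>\<^bsub>S\<^esub> \<in> ?P 0" by (rule subsetD[OF S.genideal_self[OF psubS]])
    then show ?thesis by (rule ideal.one_imp_carrier[OF Pid])
  qed
  \<comment> \<open>\<open>list_smult\<close> uses only the operations of \<open>S\<close>, so it is
    the same over the scalars \<open>S\<close>. Read there, \<open>xs P n\<close> is closed under
    multiplication by \<open>S\<close>, which is not visible over \<open>R\<close>.\<close>
  interpret SM: module S "ring_as_module S" by (rule module_ring_as_module[OF ring_extension_refl[OF e(2)]])
  have same: "SM.list_smult ys A = M.list_smult ys A" for ys A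
    by (induction ys) simp_all
  have stepP: "?P (Suc n) = M.list_smult xs (?P n)" for n
  proof
    have xsS: "set xs \<subseteq> carrier S" using assms(3) e(3) by blast
    have Pn: "SM.sm (?P n)" by (rule submodule_ideal_top[OF ring_extension_refl[OF e(2)] Pid])
    have sS: "SM.sm (M.list_smult xs (?P n))" using SM.sm_list_smult[OF xsS Pn] same by simp
    \<comment> \<open>A submodule of \<open>S\<close> over itself is the transporter of
      \<open>1\<close> into it, and transporters are ideals.\<close>
    have "ideal (M.list_smult xs (?P n)) S"
    proof -
      have "ideal {r \<in> carrier S. r \<odot>\<^bsub>ring_as_module S\<^esub> \<one>\<^bsub>S\<^esub> \<in> M.list_smult xs (?P n)} S"
        by (rule SM.ideal_transporter[OF sS]) simp
      moreover have "{r \<in> carrier S. r \<odot>\<^bsub>ring_as_module S\<^esub> \<one>\<^bsub>S\<^esub> \<in> M.list_smult xs (?P n)} = M.list_smult xs (?P n)"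
        using SM.sm_carr[OF sS] by auto
      ultimately show ?thesis by simp
    qed
    moreover have "ideal_power R I (Suc n) \<subseteq> M.list_smult xs (?P n)"
      unfolding step by (rule M.list_smult_mono[OF S.genideal_self[OF psubS]])
    ultimately show "?P (Suc n) \<subseteq> M.list_smult xs (?P n)" by (rule S.genideal_minimal)
    show "M.list_smult xs (?P n) \<subseteq> ?P (Suc n)"
    proof (rule M.list_smult_least[OF Psm])
      fix x assume x: "x \<in> set xs"
      have xc: "x \<in> carrier S" using x xsS by auto
      have P': "SM.sm (?P (Suc n))" by (rule submodule_ideal_top[OF ring_extension_refl[OF e(2)] Pid])
      have xx: "ideal {r \<in> carrier S. r \<odot>\<^bsub>ring_as_module S\<^esub> x \<in> ?P (Suc n)} S"
        by (rule SM.ideal_transporter[OF P']) (use xc in simp)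
      have "?P n \<subseteq> {r \<in> carrier S. r \<odot>\<^bsub>ring_as_module S\<^esub> x \<in> ?P (Suc n)}"
      proof (rule S.genideal_minimal[OF xx], rule subsetI)
        fix a assume a: "a \<in> ideal_power R I n"
        have aS: "a \<in> carrier S" using a psubS by blast
        have "x \<otimes>\<^bsub>S\<^esub> a \<in> M.scale x (ideal_power R I n)" using a by auto
        then have "x \<otimes>\<^bsub>S\<^esub> a \<in> ideal_power R I (Suc n)"
          unfolding step using M.scale_sub_list_smult[OF assms(3) psm x] by blast
        then have "x \<otimes>\<^bsub>S\<^esub> a \<in> ?P (Suc n)" by (rule subsetD[OF S.genideal_self[OF psubS]])
        then have "a \<otimes>\<^bsub>S\<^esub> x \<in> ?P (Suc n)" using S.m_comm[OF aS xc] by simp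
        then show "a \<in> {r \<in> carrier S. r \<odot>\<^bsub>ring_as_module S\<^esub> x \<in> ?P (Suc n)}" using aS by simp
      qed
      then show "M.scale x (?P n) \<subseteq> ?P (Suc n)" using S.m_comm[OF xc] by (auto simp: subset_iff)
    qed
  qed
  show "?P n = M.graded_span xs (carrier S) n"
  proof (induction n)
    case 0 show ?case unfolding P0 by simp
  next
    case (Suc n) then show ?case unfolding stepP by simp
  qed
qed

section \<open>Fractions and the common denominator of a birational cover\<close>

lemma nonzerodivisors_carrier: "s \<in> nonzerodivisors R \<Longrightarrow> s \<in> carrier R"
  by (simp add: nonzerodivisors_def)

lemma nonzerodivisorsD:
  "s \<in> nonzerodivisors R \<Longrightarrow> a \<in> carrier R \<Longrightarrow> a \<otimes>\<^bsub>R\<^esub> s = \<zero>\<^bsub>R\<^esub> \<Longrightarrow> a = \<zero>\<^bsub>R\<^esub>"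
  by (simp add: nonzerodivisors_def)

lemma nonzerodivisors_mult:
  assumes "cring R" "s \<in> nonzerodivisors R" "t \<in> nonzerodivisors R"
  shows "s \<otimes>\<^bsub>R\<^esub> t \<in> nonzerodivisors R"
proof -
  interpret cring R by fact
  have c: "s \<in> carrier R" "t \<in> carrier R" using assms(2,3) by (simp_all add: nonzerodivisors_carrier)
  have "z = \<zero>\<^bsub>R\<^esub>" if z: "z \<in> carrier R" "z \<otimes>\<^bsub>R\<^esub> (s \<otimes>\<^bsub>R\<^esub> t) = \<zero>\<^bsub>R\<^esub>" for z
  proof -
    have "(z \<otimes>\<^bsub>R\<^esub> s) \<otimes>\<^bsub>R\<^esub> t = \<zero>\<^bsub>R\<^esub>" using z c by (simp add: m_assoc)
    then have "z \<otimes>\<^bsub>R\<^esub> s = \<zero>\<^bsub>R\<^esub>" by (rule nonzerodivisorsD[OF assms(3) m_closed[OF z(1) c(1)]])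
    then show ?thesis by (rule nonzerodivisorsD[OF assms(2) z(1)])
  qed
  then show ?thesis using c unfolding nonzerodivisors_def by simp
qed

lemma fraction_eqI:
  assumes "cring R" "a \<otimes>\<^bsub>R\<^esub> t = b \<otimes>\<^bsub>R\<^esub> s" "a \<in> carrier R" "b \<in> carrier R"
    "s \<in> nonzerodivisors R" "t \<in> nonzerodivisors R"
  shows "fraction R a s = fraction R b t"
proof -
  interpret cring R by fact
  have half: "fraction R a s \<subseteq> fraction R b t"
    if h: "a \<otimes>\<^bsub>R\<^esub> t = b \<otimes>\<^bsub>R\<^esub> s" "a \<in> carrier R" "b \<in> carrier R" "s \<in> nonzerodivisors R" "t \<in> nonzerodivisors R" for a b s t
  proof (rule subrelI)
    fix c u assume "(c, u) \<in> fraction R a s"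
    then have c: "c \<in> carrier R" "u \<in> nonzerodivisors R" "a \<otimes>\<^bsub>R\<^esub> u = c \<otimes>\<^bsub>R\<^esub> s" by (auto simp: fraction_def)
    have car: "s \<in> carrier R" "t \<in> carrier R" "u \<in> carrier R" using h(4,5) c(2) by (simp_all add: nonzerodivisors_carrier)
    have "(b \<otimes>\<^bsub>R\<^esub> u) \<otimes>\<^bsub>R\<^esub> s = (b \<otimes>\<^bsub>R\<^esub> s) \<otimes>\<^bsub>R\<^esub> u" using h(3) car by (simp add: m_ac)
    also have "\<dots> = (a \<otimes>\<^bsub>R\<^esub> u) \<otimes>\<^bsub>R\<^esub> t" unfolding h(1)[symmetric] using h(2) car by (simp add: m_ac)
    also have "\<dots> = (c \<otimes>\<^bsub>R\<^esub> t) \<otimes>\<^bsub>R\<^esub> s" unfolding c(3) using c(1) car by (simp add: m_ac)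
    finally have "(b \<otimes>\<^bsub>R\<^esub> u \<ominus>\<^bsub>R\<^esub> c \<otimes>\<^bsub>R\<^esub> t) \<otimes>\<^bsub>R\<^esub> s = \<zero>\<^bsub>R\<^esub>"
      using h(3) c(1) car by (simp add: minus_eq l_distr l_minus r_neg)
    moreover have "b \<otimes>\<^bsub>R\<^esub> u \<ominus>\<^bsub>R\<^esub> c \<otimes>\<^bsub>R\<^esub> t \<in> carrier R" using h(3) c(1) car by simp
    ultimately have "b \<otimes>\<^bsub>R\<^esub> u \<ominus>\<^bsub>R\<^esub> c \<otimes>\<^bsub>R\<^esub> t = \<zero>\<^bsub>R\<^esub>" by (rule nonzerodivisorsD[OF h(4), rotated])
    then have "b \<otimes>\<^bsub>R\<^esub> u = c \<otimes>\<^bsub>R\<^esub> t" using h(3) c(1) car by (simp add: r_right_minus_eq)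
    then show "(c, u) \<in> fraction R b t" using c by (simp add: fraction_def)
  qed
  show ?thesis using half[OF assms(2-6)] half[OF assms(2)[symmetric] assms(4,3,6,5)] by (rule equalityI)
qed

lemma fraction_mult_denom:
  assumes "cring R" "x \<in> carrier R" "s \<in> nonzerodivisors R"
  shows "fraction R s \<one>\<^bsub>R\<^esub> \<otimes>\<^bsub>total_quotient_ring R\<^esub> fraction R x s = fraction R x \<one>\<^bsub>R\<^esub>"
proof -
  interpret cring R by fact
  have one: "\<one>\<^bsub>R\<^esub> \<in> nonzerodivisors R" by (simp add: nonzerodivisors_def)
  have s: "s \<in> carrier R" using assms(3) by (simp add: nonzerodivisors_def)
  show ?thesis unfolding total_quotient_ring_def monoid.simps
  proof (rule UN_const2)
    show "(s, \<one>\<^bsub>R\<^esub>) \<in> fraction R s \<one>\<^bsub>R\<^esub>" "(x, s) \<in> fraction R x s" using s one assms by (auto simp: fraction_def)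
    fix a s' b t assume "(a, s') \<in> fraction R s \<one>\<^bsub>R\<^esub>" "(b, t) \<in> fraction R x s"
    then have h: "a \<in> carrier R" "s' \<in> nonzerodivisors R" "s \<otimes>\<^bsub>R\<^esub> s' = a \<otimes>\<^bsub>R\<^esub> \<one>\<^bsub>R\<^esub>"
      "b \<in> carrier R" "t \<in> nonzerodivisors R" "x \<otimes>\<^bsub>R\<^esub> t = b \<otimes>\<^bsub>R\<^esub> s" by (auto simp: fraction_def)
    have c: "s' \<in> carrier R" "t \<in> carrier R" using h(2,5) by (simp_all add: nonzerodivisors_carrier)
    have a: "a = s \<otimes>\<^bsub>R\<^esub> s'" using h(1,3) by simp
    have st: "s' \<otimes>\<^bsub>R\<^esub> t \<in> nonzerodivisors R"
      by (rule nonzerodivisors_mult[OF assms(1) h(2,5)])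
    have "a \<otimes>\<^bsub>R\<^esub> b = (b \<otimes>\<^bsub>R\<^esub> s) \<otimes>\<^bsub>R\<^esub> s'" unfolding a using h(4) s c by (simp add: m_ac)
    also have "\<dots> = x \<otimes>\<^bsub>R\<^esub> (s' \<otimes>\<^bsub>R\<^esub> t)" unfolding h(6)[symmetric] using assms(2) c by (simp add: m_ac)
    finally show "fraction R (a \<otimes>\<^bsub>R\<^esub> b) (s' \<otimes>\<^bsub>R\<^esub> t) = fraction R x \<one>\<^bsub>R\<^esub>"
      using h(1,4) assms(2) st one c by (intro fraction_eqI[OF assms(1)]) simp_all
  qed
qed

text \<open>The element \<open>b\<close> is the product of denominators for the finitely many module
  generators of \<open>S\<close>; the elements that \<open>b\<close> multiplies into
  \<open>R\<close> form a submodule containing these generators. Injectivity holds because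
  \<open>b\<close> becomes invertible in the total quotient ring, into which \<open>S\<close>
  embeds.\<close>

lemma birational_conductor:
  fixes R :: "('a, 'b) ring_scheme" and S :: "('a, 'c) ring_scheme"
  assumes "finite_cover R S" "birational_cover R S"
  shows "\<exists>b\<in>carrier R. (\<forall>s\<in>carrier S. b \<otimes>\<^bsub>S\<^esub> s \<in> carrier R) \<and> inj_on (\<lambda>s. b \<otimes>\<^bsub>S\<^esub> s) (carrier S)"
proof -
  have ext: "ring_extension R S" using assms(1) by (simp add: finite_cover_def)
  note e = ring_extensionD[OF ext]
  interpret R: cring R by (rule e(1))
  interpret S: cring S by (rule e(2))
  interpret M: module R "ring_as_module S" by (rule module_ring_as_module[OF ext])
  let ?Q = "total_quotient_ring R"
  interpret Q: cring ?Q by (rule cring_total_quotient_ring[OF e(1)])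
  obtain \<phi> where \<phi>: "\<phi> \<in> ring_hom S ?Q" "inj_on \<phi> (carrier S)"
    "\<And>r. r \<in> carrier R \<Longrightarrow> \<phi> r = fraction R r \<one>\<^bsub>R\<^esub>"
    using assms(2) unfolding birational_cover_def by blast
  \<comment> \<open>If \<open>a\<close> maps to \<open>x/s\<close>, then \<open>s a\<close> and
    \<open>x\<close> have the same image, so \<open>s a = x\<close> by injectivity of the
    embedding.\<close>
  have clear: "\<exists>s\<in>nonzerodivisors R. s \<otimes>\<^bsub>S\<^esub> a \<in> carrier R" if a: "a \<in> carrier S" for a
  proof -
    have "\<phi> a \<in> carrier ?Q" using ring_hom_closed[OF \<phi>(1) a] .
    then obtain x s where xs: "\<phi> a = fraction R x s" "x \<in> carrier R" "s \<in> nonzerodivisors R"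
      by (auto simp: total_quotient_ring_def)
    have sR: "s \<in> carrier R" using xs(3) by (simp add: nonzerodivisors_def)
    have sS: "s \<in> carrier S" "x \<in> carrier S" using sR xs(2) e(3) by auto
    have "\<phi> (s \<otimes>\<^bsub>S\<^esub> a) = \<phi> x"
      using ring_hom_mult[OF \<phi>(1) sS(1) a] fraction_mult_denom[OF e(1) xs(2,3)] \<phi>(3) sR xs by simp
    then have "s \<otimes>\<^bsub>S\<^esub> a = x" using \<phi>(2) sS a unfolding inj_on_def by simp
    then show ?thesis using xs by auto
  qed
  obtain A where A: "A \<subseteq> carrier (ring_as_module S)" "finite A"
    "\<forall>x \<in> carrier (ring_as_module S). \<exists>c \<in> A \<rightarrow> carrier R. x = (\<Oplus>\<^bsub>ring_as_module S\<^esub>a\<in>A. c a \<odot>\<^bsub>ring_as_module S\<^esub> a)"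
    using assms(1) unfolding finite_cover_def finite_module_def by blast
  have "\<exists>b\<in>nonzerodivisors R. \<forall>a\<in>A. b \<otimes>\<^bsub>S\<^esub> a \<in> carrier R"
    using A(2,1)
  proof (induction A rule: finite_induct)
    case empty
    have "\<one>\<^bsub>R\<^esub> \<in> nonzerodivisors R" by (simp add: nonzerodivisors_def)
    then show ?case by blast
  next
    case (insert a A)
    then obtain b where b: "b \<in> nonzerodivisors R" "\<forall>a\<in>A. b \<otimes>\<^bsub>S\<^esub> a \<in> carrier R" by auto
    have aS: "a \<in> carrier S" using insert.prems by simp
    obtain s where s: "s \<in> nonzerodivisors R" "s \<otimes>\<^bsub>S\<^esub> a \<in> carrier R" using clear[OF aS] by blast
    have c: "b \<in> carrier R" "s \<in> carrier R" using b(1) s(1) by (simp_all add: nonzerodivisors_carrier)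
    have cS: "b \<in> carrier S" "s \<in> carrier S" using c e(3) by auto
    have nz: "b \<otimes>\<^bsub>R\<^esub> s \<in> nonzerodivisors R"
      by (rule nonzerodivisors_mult[OF e(1) b(1) s(1)])
    have "(b \<otimes>\<^bsub>R\<^esub> s) \<otimes>\<^bsub>S\<^esub> a' \<in> carrier R" if "a' \<in> insert a A" for a'
    proof -
      have a'S: "a' \<in> carrier S" using that insert.prems by auto
      show ?thesis
      proof (cases "a' = a")
        case True
        have "(b \<otimes>\<^bsub>R\<^esub> s) \<otimes>\<^bsub>S\<^esub> a = b \<otimes>\<^bsub>R\<^esub> (s \<otimes>\<^bsub>S\<^esub> a)" using e(4) c s(2) cS aS by (simp add: S.m_assoc)
        then show ?thesis using True c(1) s(2) by simp
      next
        case False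
        then have ba: "b \<otimes>\<^bsub>S\<^esub> a' \<in> carrier R" using that b(2) by auto
        have "(b \<otimes>\<^bsub>R\<^esub> s) \<otimes>\<^bsub>S\<^esub> a' = s \<otimes>\<^bsub>S\<^esub> (b \<otimes>\<^bsub>S\<^esub> a')"
          using e(4)[OF c] cS a'S by (simp add: S.m_ac)
        then show ?thesis using e(4)[OF c(2) ba] R.m_closed[OF c(2) ba] by simp
      qed
    qed
    then show ?case using nz by blast
  qed
  then obtain b where b: "b \<in> nonzerodivisors R" "\<forall>a\<in>A. b \<otimes>\<^bsub>S\<^esub> a \<in> carrier R" by blast
  have bR: "b \<in> carrier R" using b(1) by (simp add: nonzerodivisors_def)
  have bS: "b \<in> carrier S" using bR e(3) by auto
  have R: "M.sm (carrier R)" by (rule submodule_ideal_base[OF ext R.oneideal])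
  have D: "M.sm (M.colon (carrier R) b)" by (rule M.sm_colon[OF R bR])
  have AD: "A \<subseteq> M.colon (carrier R) b" unfolding M.colon_def using b(2) A(1) by auto
  have "b \<otimes>\<^bsub>S\<^esub> x \<in> carrier R" if x: "x \<in> carrier S" for x
  proof -
    have "x \<in> carrier (ring_as_module S)" using x by simp
    then obtain c where "c \<in> A \<rightarrow> carrier R" "x = (\<Oplus>\<^bsub>ring_as_module S\<^esub>a\<in>A. c a \<odot>\<^bsub>ring_as_module S\<^esub> a)"
      using A(3) by blast
    then have "x \<in> M.colon (carrier R) b" using M.finsum_in_sm[OF D A(2) AD] by simp
    then show ?thesis unfolding M.colon_def by simp
  qed
  moreover have "inj_on (\<lambda>s. b \<otimes>\<^bsub>S\<^esub> s) (carrier S)"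
  proof (rule inj_onI)
    fix u v assume u: "u \<in> carrier S" and v: "v \<in> carrier S" and eq: "b \<otimes>\<^bsub>S\<^esub> u = b \<otimes>\<^bsub>S\<^esub> v"
    let ?i = "fraction R \<one>\<^bsub>R\<^esub> b"
    have i: "?i \<in> carrier ?Q" using b(1) by (auto simp: total_quotient_ring_def)
    have bi: "\<phi> b \<otimes>\<^bsub>?Q\<^esub> ?i = \<one>\<^bsub>?Q\<^esub>"
      using fraction_mult_denom[OF e(1) R.one_closed b(1)] \<phi>(3)[OF bR] by (simp add: total_quotient_ring_def)
    have c: "\<phi> b \<in> carrier ?Q" "\<phi> u \<in> carrier ?Q" "\<phi> v \<in> carrier ?Q"
      using ring_hom_closed[OF \<phi>(1)] bS u v by auto
    have "\<phi> b \<otimes>\<^bsub>?Q\<^esub> \<phi> u = \<phi> b \<otimes>\<^bsub>?Q\<^esub> \<phi> v"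
      using ring_hom_mult[OF \<phi>(1) bS u] ring_hom_mult[OF \<phi>(1) bS v] eq by simp
    then have "(\<phi> b \<otimes>\<^bsub>?Q\<^esub> ?i) \<otimes>\<^bsub>?Q\<^esub> \<phi> u = (\<phi> b \<otimes>\<^bsub>?Q\<^esub> ?i) \<otimes>\<^bsub>?Q\<^esub> \<phi> v"
      using i c by (simp add: Q.m_assoc Q.m_lcomm Q.m_comm[of "\<phi> b" ?i])
    then have "\<phi> u = \<phi> v" using bi c by simp
    then show "u = v" using \<phi>(2) u v by (simp add: inj_on_def)
  qed
  ultimately show ?thesis using bR by blast
qed

lemma the_enat_mono_add:
  "a \<le> b + c \<Longrightarrow> b \<noteq> \<infinity> \<Longrightarrow> c \<noteq> \<infinity> \<Longrightarrow> int (the_enat a) \<le> int (the_enat b) + int (the_enat c)"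
  by (cases a; cases b; cases c) auto

lemma the_enat_mono_int: "a \<le> b \<Longrightarrow> b \<noteq> \<infinity> \<Longrightarrow> int (the_enat a) \<le> int (the_enat b)"
  by (cases a; cases b) auto

section \<open>The two Hilbert functions inside the module \<open>S\<close>\<close>

theorem theorem1p2:
  fixes R :: "('a, 'b) ring_scheme" and S :: "('a, 'c) ring_scheme"
    and m I :: "'a set" and B :: "nat \<Rightarrow> 'a set" and d :: nat
  assumes "noetherian_local_ring R m"
    and "krull_dim R = enat d" and "d \<ge> 1"
    and "finite_cover R S"
    and "finite_length_cover R S \<or> birational_cover R S"
    and "primary_to R m I"
    and "admissible_filtration R I B"
    and "\<forall>\<^sub>F n in sequentially. carrier R \<inter> Idl\<^bsub>S\<^esub> (ideal_power R I n) \<subseteq> B n"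
  shows "e1_filtration R B \<ge> e1_extension R I S"
proof -
  have ext: "ring_extension R S" using assms(4) by (simp add: finite_cover_def)
  note e = ring_extensionD[OF ext]
  have noeth: "noetherian_ring R" and mm: "maximalideal m R"
    using assms(1) by (simp_all add: noetherian_local_ring_def)
  interpret R: cring R by (rule e(1))
  interpret S: cring S by (rule e(2))
  let ?M = "ring_as_module S"
  interpret M: module R ?M by (rule module_ring_as_module[OF ext])
  have acc: "M.acc (carrier ?M)"
    using M.acc_finite_module[OF noeth] assms(4) by (simp add: finite_cover_def)
  have idI: "ideal I R" and rad: "ideal_radical R I = m"
    using assms(6) by (simp_all add: primary_to_def primary_ideal_def)
  have Im: "I \<subseteq> m"
  proof
    fix x assume x: "x \<in> I"
    then have "x \<in> carrier R" by (rule ideal.Icarr[OF idI])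
    then have "x \<in> ideal_radical R I" unfolding ideal_radical_def using x by (auto intro!: exI[of _ "Suc 0"])
    then show "x \<in> m" using rad by simp
  qed
  obtain X where X: "X \<subseteq> carrier R" "finite X" "I = Idl\<^bsub>R\<^esub> X"
    using noetherian_ring.finetely_gen[OF noeth idI] by auto
  obtain xs where xs: "set xs = X" using finite_list[OF X(2)] by auto
  have xsR: "set xs \<subseteq> carrier R" using X(1) xs by simp
  have xsI: "x \<in> I" if "x \<in> set xs" for x using R.genideal_self[OF X(1)] X(3) xs that by auto
  \<comment> \<open>\<open>Q n\<close> is \<open>I^n\<close> and \<open>P n\<close> is
    \<open>I^nS\<close>, both regarded as \<open>R\<close>-submodules of \<open>S\<close>.\<close>
  define Q where "Q n = ideal_power R I n" for n
  define P where "P n = Idl\<^bsub>S\<^esub> (Q n)" for n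
  have Q_graded_span: "Q n = M.graded_span xs (carrier R) n" for n
    unfolding Q_def using ideal_power_eq_graded_span(1)[OF ext idI xsR] X(3) xs by simp
  have P_graded_span: "P n = M.graded_span xs (carrier S) n" for n
    unfolding P_def Q_def using ideal_power_eq_graded_span(2)[OF ext idI xsR] X(3) xs by simp
  have smR: "M.sm (carrier R)" by (rule submodule_ideal_base[OF ext R.oneideal])
  have smS: "M.sm (carrier S)" using M.carrier_is_submodule by simp
  have Q: "M.sm (Q n)" for n unfolding Q_graded_span by (rule M.sm_graded_span[OF xsR smR])
  have P: "M.sm (P n)" for n unfolding P_graded_span by (rule M.sm_graded_span[OF xsR smS])
  have idQ: "ideal (Q n) R" for n unfolding Q_def by (rule ideal_power_ideal[OF e(1) idI])
  have QR: "Q n \<subseteq> carrier R" for n using ideal.Icarr[OF idQ] by auto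
  have PS: "P n \<subseteq> carrier S" for n using M.submoduleE(1)[OF P] by simp
  have QP: "Q n \<subseteq> P n" for n unfolding P_def using QR e(3) by (intro S.genideal_self) auto
  have P0: "P 0 = carrier S" by (simp add: P_graded_span)
  have PSuc: "P (Suc n) = M.list_smult xs (P n)" for n by (simp add: P_graded_span)
  have QSuc: "Q (Suc n) = M.list_smult xs (Q n)" for n by (simp add: Q_graded_span)
  have clP: "M.scale x (P n) \<subseteq> P (Suc n)" if "x \<in> set xs" for x n
    unfolding PSuc by (rule M.scale_sub_list_smult[OF xsR P that])
  have filt: "ideal_filtration R B" using assms(7) by (simp add: admissible_filtration_def)
  obtain k where k: "\<And>n. B (n + k) \<subseteq> Q n" "\<And>n. Q n \<subseteq> B n"
    using assms(7) unfolding admissible_filtration_def Q_def by blast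
  have idB: "ideal (B n) R" for n using filt by (simp add: ideal_filtration_def)
  have BR: "B n \<subseteq> carrier R" for n using ideal.Icarr[OF idB] by auto
  have B: "M.sm (B n)" for n by (rule submodule_ideal_base[OF ext idB])
  have Bdec: "B (Suc n) \<subseteq> B n" for n using filt by (simp add: ideal_filtration_def)
  \<comment> \<open>Admissibility puts \<open>I\<close> into \<open>B 1\<close>, so multiplication
    by a generator moves \<open>B n\<close> into \<open>B (n + 1)\<close>.\<close>
  have clB: "M.scale x (B n) \<subseteq> B (Suc n)" if x: "x \<in> set xs" for x n
  proof
    fix z assume "z \<in> M.scale x (B n)"
    then obtain a where a: "a \<in> B n" "z = x \<otimes>\<^bsub>S\<^esub> a" by auto
    have c: "a \<in> carrier R" "x \<in> carrier R" using a(1) BR x xsR by auto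
    have "x \<in> Q (Suc 0)"
      unfolding Q_def ideal_power_Suc ideal_power_0 using ideal_prod.prod[OF R.one_closed xsI[OF x], of R] c(2) by simp
    then have "x \<in> B (Suc 0)" using k(2) by auto
    then have "a \<otimes>\<^bsub>R\<^esub> x \<in> B n \<cdot>\<^bsub>R\<^esub> B (Suc 0)" by (rule ideal_prod.prod[OF a(1)])
    moreover have "B n \<cdot>\<^bsub>R\<^esub> B (Suc 0) \<subseteq> B (n + Suc 0)" using filt unfolding ideal_filtration_def by blast
    ultimately have "a \<otimes>\<^bsub>R\<^esub> x \<in> B (Suc n)" by auto
    then show "z \<in> B (Suc n)" using a(2) e(4)[OF c(2,1)] R.m_comm[OF c] by simp
  qed
  have nilp: "\<exists>t::nat. y [^]\<^bsub>R\<^esub> t \<in> Q n" if y: "y \<in> m" for y n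
  proof -
    have "y \<in> ideal_radical R I" using y rad by simp
    then obtain t :: nat where "y \<in> carrier R" "y [^]\<^bsub>R\<^esub> t \<in> I" unfolding ideal_radical_def by auto
    from pow_in_ideal_power[OF e(1) idI this] show ?thesis unfolding Q_def by blast
  qed
  define len where "len U V = rel_length R ?M U V" for U V
  have len_mono: "len U' V' \<le> len U V"
    if "M.sm U" "M.sm U'" "M.sm V" "M.sm V'" "U \<subseteq> U'" "U' \<subseteq> V'" "V' \<subseteq> V" for U U' V V'
    unfolding len_def by (rule M.rel_length_mono[OF that])
  have finP: "len (P n) (carrier S) \<noteq> \<infinity>" for n
    unfolding len_def
  proof (rule M.rel_length_finite[OF acc assms(1) smS P PS])
    fix y assume "y \<in> m"
    then obtain t :: nat where t: "y [^]\<^bsub>R\<^esub> t \<in> Q n" using nilp by blast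
    have "M.scale (y [^]\<^bsub>R\<^esub> t) (carrier S) \<subseteq> P n"
    proof
      fix z assume "z \<in> M.scale (y [^]\<^bsub>R\<^esub> t) (carrier S)"
      then obtain s where s: "s \<in> carrier S" "z = y [^]\<^bsub>R\<^esub> t \<otimes>\<^bsub>S\<^esub> s" by auto
      have "ideal (P n) S" unfolding P_def using QR e(3) by (intro S.genideal_ideal) auto
      then show "z \<in> P n" using ideal.I_r_closed[of "P n" S "y [^]\<^bsub>R\<^esub> t" s] s t QP by auto
    qed
    then show "\<exists>t::nat. M.scale (y [^]\<^bsub>R\<^esub> t) (carrier S) \<subseteq> P n" ..
  qed
  have finB: "len (B n) (carrier R) \<noteq> \<infinity>" for n
    unfolding len_def
  proof (rule M.rel_length_finite[OF acc assms(1) smR B BR])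
    fix y assume y: "y \<in> m"
    then obtain t :: nat where t: "y [^]\<^bsub>R\<^esub> t \<in> Q n" using nilp by blast
    have "M.scale (y [^]\<^bsub>R\<^esub> t) (carrier R) \<subseteq> B n"
    proof
      fix z assume "z \<in> M.scale (y [^]\<^bsub>R\<^esub> t) (carrier R)"
      then obtain s where s: "s \<in> carrier R" "z = y [^]\<^bsub>R\<^esub> t \<otimes>\<^bsub>S\<^esub> s" by auto
      have tB: "y [^]\<^bsub>R\<^esub> t \<in> B n" using t k(2) by auto
      have tR: "y [^]\<^bsub>R\<^esub> t \<in> carrier R" using tB BR by auto
      show "z \<in> B n" using ideal.I_r_closed[OF idB tB s(1)] e(4)[OF tR s(1)] s(2) by simp
    qed
    then show "\<exists>t::nat. M.scale (y [^]\<^bsub>R\<^esub> t) (carrier R) \<subseteq> B n" ..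
  qed
  \<comment> \<open>The successor reflects the convention that the Hilbert polynomials are taken at
    \<open>n + 1\<close>.\<close>
  define F where "F n = len (B (Suc n)) (carrier R)" for n
  define G where "G n = len (P (Suc n)) (carrier S)" for n
  have e1F: "e1_filtration R B = hilbert_coeff (eventual_poly F) 1"
  proof -
    interpret MR: module R "ring_as_module R" by (rule module_ring_as_module[OF ring_extension_refl[OF e(1)]])
    have "module_length R (quot_module (ring_as_module R) (B (n + 1))) = F n" for n
      using MR.module_length_quot[OF submodule_ideal_base[OF ring_extension_refl[OF e(1)] idB]]
        rel_length_base[OF ext idB] unfolding F_def len_def by simp
    then show ?thesis unfolding e1_filtration_def filtration_poly_def by simp
  qed
  have e1G: "e1_extension R I S = hilbert_coeff (eventual_poly G) 1"
  proof -
    have "module_length R (quot_module ?M (Idl\<^bsub>S\<^esub> (ideal_power R I (n + 1)))) = G n" for n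
      using M.module_length_quot[OF P[of "Suc n"]] unfolding G_def len_def P_def Q_def
      by (simp only: Suc_eq_plus1 carrier_ring_as_module)
    then show ?thesis unfolding e1_extension_def extension_poly_def by (simp only:)
  qed
  have numF: "eventually_numerical (\<lambda>n. int (the_enat (F n)))"
  proof (rule eventually_numerical_antidiff)
    have fin: "len (B (Suc (Suc n))) (B (Suc n)) \<noteq> \<infinity>" for n
      using len_mono[OF B B smR B order.refl Bdec BR, of "Suc n"] finB[of "Suc (Suc n)"]
      by (metis enat_ord_simps(5))
    \<comment> \<open>Shifted by \<open>k\<close>, the filtration lies degreewise in the powers of
      \<open>I\<close>, so the basis theorem makes it stable under passing from \<open>B n\<close>
      to \<open>I B n\<close> in large degrees.\<close>
    have "\<exists>c. \<forall>n\<ge>c. B (Suc n + k) \<subseteq> M.list_smult xs (B (n + k))"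
      by (rule M.graded_noetherian[where N = "\<lambda>n. B (n + k)", OF acc xsR smR])
        (use B k(1) clB in \<open>simp_all add: Q_graded_span\<close>)
    then obtain c where c: "\<forall>n\<ge>c. B (Suc n + k) \<subseteq> M.list_smult xs (B (n + k))" ..
    have gen: "B (Suc n) \<subseteq> M.list_smult xs (B n)" if "n \<ge> c + k" for n
      using c[rule_format, of "n - k"] that by simp
    have "eventually_numerical (\<lambda>n. int (the_enat (rel_length R ?M (B (Suc (Suc n))) (B (Suc n)))))"
    proof (rule M.hilbert_function[OF acc xsR])
      show "\<exists>n0. \<forall>n\<ge>n0. B (Suc (Suc n)) \<subseteq> M.list_smult xs (B (Suc n)) <+>\<^bsub>?M\<^esub> B (Suc (Suc (Suc n)))"
      proof (intro exI allI impI)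
        fix n assume "n \<ge> c + k"
        then have "B (Suc (Suc n)) \<subseteq> M.list_smult xs (B (Suc n))" by (intro gen) simp
        also have "\<dots> \<subseteq> M.list_smult xs (B (Suc n)) <+>\<^bsub>?M\<^esub> B (Suc (Suc (Suc n)))"
          by (rule M.set_add_upper1[OF M.sm_list_smult[OF xsR B] B])
        finally show "B (Suc (Suc n)) \<subseteq> M.list_smult xs (B (Suc n)) <+>\<^bsub>?M\<^esub> B (Suc (Suc (Suc n)))" .
      qed
    qed (use B Bdec clB fin in \<open>simp_all add: len_def\<close>)
    moreover have "int (the_enat (F (Suc n))) - int (the_enat (F n)) = int (the_enat (len (B (Suc (Suc n))) (B (Suc n))))" for n
    proof -
      have "F (Suc n) = len (B (Suc (Suc n))) (B (Suc n)) + F n"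
        unfolding F_def len_def by (rule M.rel_length_add[OF B B smR Bdec BR])
      then show ?thesis using fin[of n] finB[of "Suc n"] unfolding F_def[of n] by auto
    qed
    ultimately show "eventually_numerical (\<lambda>n. int (the_enat (F (Suc n))) - int (the_enat (F n)))"
      unfolding len_def by simp
  qed
  have Pdec: "P (Suc n) \<subseteq> P n" for n
  proof (induction n)
    case 0 show ?case using PS P0 by simp
  next
    case (Suc n) then show ?case unfolding PSuc by (rule M.list_smult_mono)
  qed
  \<comment> \<open>The differences of \<open>G\<close> are the lengths of
    \<open>P (n + 1) / P (n + 2)\<close>, and generation holds from the start because
    \<open>P (n + 1) = I P n\<close>.\<close>
  have numG: "eventually_numerical (\<lambda>n. int (the_enat (G n)))"
  proof (rule eventually_numerical_antidiff)
    have fin: "len (P (Suc (Suc n))) (P (Suc n)) \<noteq> \<infinity>" for n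
      using len_mono[OF P P smS P order.refl Pdec PS, of "Suc n"] finP[of "Suc (Suc n)"]
      by (metis enat_ord_simps(5))
    have "eventually_numerical (\<lambda>n. int (the_enat (rel_length R ?M (P (Suc (Suc n))) (P (Suc n)))))"
    proof (rule M.hilbert_function[OF acc xsR])
      show "\<exists>n0. \<forall>n\<ge>n0. P (Suc (Suc n)) \<subseteq> M.list_smult xs (P (Suc n)) <+>\<^bsub>?M\<^esub> P (Suc (Suc (Suc n)))"
        unfolding PSuc[symmetric] by (intro exI allI impI M.set_add_upper1 P)
    qed (use P Pdec clP fin in \<open>simp_all add: len_def\<close>)
    moreover have "int (the_enat (G (Suc n))) - int (the_enat (G n)) = int (the_enat (len (P (Suc (Suc n))) (P (Suc n))))" for n
    proof -
      have "G (Suc n) = len (P (Suc (Suc n))) (P (Suc n)) + G n"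
        unfolding G_def len_def by (rule M.rel_length_add[OF P P smS Pdec PS])
      then show ?thesis using fin[of n] finP[of "Suc n"] unfolding G_def[of n] by auto
    qed
    ultimately show "eventually_numerical (\<lambda>n. int (the_enat (G (Suc n))) - int (the_enat (G n)))"
      unfolding len_def by simp
  qed
  have RP: "M.sm (carrier R <+>\<^bsub>?M\<^esub> P n)" "P n \<subseteq> carrier R <+>\<^bsub>?M\<^esub> P n" "carrier R <+>\<^bsub>?M\<^esub> P n \<subseteq> carrier S"
    "M.sm (carrier R \<inter> P n)" for n
    using M.sm_set_add[OF smR P] M.set_add_upper2[OF smR P] M.set_add_least[OF smS e(3) PS] M.sm_Int[OF smR P] by simp_all
  \<comment> \<open>This identifies \<open>R / (R \<inter> I^nS)\<close> with the image of
    \<open>R\<close> in \<open>S / I^nS\<close>; it serves both bounds between \<open>F\<close> and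
    \<open>G\<close>.\<close>
  have iso: "len (P n) (carrier R <+>\<^bsub>?M\<^esub> P n) = len (carrier R \<inter> P n) (carrier R)" for n
    unfolding len_def by (rule M.rel_length_second_iso[OF smR P])
  have FG: "\<forall>\<^sub>F n in sequentially. int (the_enat (F n)) \<le> int (the_enat (G n))"
  proof -
    obtain N where N: "\<And>n. n \<ge> N \<Longrightarrow> carrier R \<inter> P n \<subseteq> B n"
      using assms(8) unfolding P_def Q_def eventually_sequentially by blast
    have "F n \<le> G n" if "n \<ge> N" for n
    proof -
      have "F n \<le> len (carrier R \<inter> P (Suc n)) (carrier R)"
        unfolding F_def using N[of "Suc n"] that by (intro len_mono RP B smR BR order.refl) simp
      also have "\<dots> = len (P (Suc n)) (carrier R <+>\<^bsub>?M\<^esub> P (Suc n))" by (rule iso[symmetric])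
      also have "\<dots> \<le> G n" unfolding G_def by (intro len_mono P RP smS order.refl)
      finally show ?thesis .
    qed
    then have "int (the_enat (F n)) \<le> int (the_enat (G n))" if "n \<ge> N" for n
      using that finP[of "Suc n"] by (intro the_enat_mono_int) (simp_all add: G_def)
    then show ?thesis unfolding eventually_sequentially by blast
  qed
  have "\<exists>K l. \<forall>n. int (the_enat (G n)) \<le> int (the_enat (F (n + K))) + l"
    using assms(5)
  proof
    assume "finite_length_cover R S"
    then have fl: "len (carrier R) (carrier S) \<noteq> \<infinity>"
      using M.module_length_quot[OF smR] by (simp add: finite_length_cover_def finite_length_def len_def)
    have "G n \<le> F (n + k) + len (carrier R) (carrier S)" for n
    proof -
      have "G n = len (P (Suc n)) (carrier R <+>\<^bsub>?M\<^esub> P (Suc n)) + len (carrier R <+>\<^bsub>?M\<^esub> P (Suc n)) (carrier S)"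
        unfolding G_def len_def by (rule M.rel_length_add[OF P RP(1) smS RP(2,3)])
      also have "\<dots> \<le> F (n + k) + len (carrier R) (carrier S)"
      proof (rule add_mono)
        \<comment> \<open>The shift \<open>k\<close> arises from \<open>B (Suc n + k) \<subseteq> Q
          (Suc n) \<subseteq> R \<inter> P (Suc n)\<close>.\<close>
        show "len (P (Suc n)) (carrier R <+>\<^bsub>?M\<^esub> P (Suc n)) \<le> F (n + k)"
          unfolding iso F_def using k(1)[of "Suc n"] QR[of "Suc n"] QP[of "Suc n"] by (intro len_mono RP B smR order.refl) auto
        show "len (carrier R <+>\<^bsub>?M\<^esub> P (Suc n)) (carrier S) \<le> len (carrier R) (carrier S)"
          by (intro len_mono RP smR smS order.refl M.set_add_upper1[OF smR P])
      qed
      finally show ?thesis .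
    qed
    then have "int (the_enat (G n)) \<le> int (the_enat (F (n + k))) + int (the_enat (len (carrier R) (carrier S)))" for n
      using the_enat_mono_add finB fl unfolding F_def by blast
    then show ?thesis by blast
  next
    assume "birational_cover R S"
    then obtain b where b: "b \<in> carrier R" "\<forall>s\<in>carrier S. b \<otimes>\<^bsub>S\<^esub> s \<in> carrier R" "inj_on (\<lambda>s. b \<otimes>\<^bsub>S\<^esub> s) (carrier S)"
      using birational_conductor[OF assms(4)] by blast
    define J where "J = M.scale b (carrier S)"
    have J: "M.sm J" unfolding J_def by (rule M.sm_scale[OF smS b(1)])
    have JR: "J \<subseteq> carrier R" unfolding J_def using b(2) by auto
    have bP: "M.sm (M.scale b (P n))" for n by (rule M.sm_scale[OF P b(1)])
    have bPJ: "M.scale b (P n) \<subseteq> J" for n unfolding J_def by (rule image_mono[OF PS])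
    have PJ: "M.sm (P n \<inter> J)" for n by (rule M.sm_Int[OF P J])
    \<comment> \<open>The Artin-Rees lemma for \<open>J = bS\<close>: its traces on the
      \<open>P n\<close> form a graded submodule, to which the basis theorem applies.\<close>
    have "\<exists>c. \<forall>n\<ge>c. P (Suc n) \<inter> J \<subseteq> M.list_smult xs (P n \<inter> J)"
    proof (rule M.graded_noetherian[OF acc xsR smS PJ])
      fix n x assume x: "x \<in> set xs"
      have "M.scale x J \<subseteq> J" using M.sm_smult[OF J] x xsR by auto
      then show "M.scale x (P n \<inter> J) \<subseteq> P (Suc n) \<inter> J" using clP[OF x, of n] by blast
    qed (simp add: P_graded_span)
    then obtain c where c: "\<forall>n\<ge>c. P (Suc n) \<inter> J \<subseteq> M.list_smult xs (P n \<inter> J)" ..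
    \<comment> \<open>In degree \<open>c\<close> the trace lies in \<open>J = b P 0\<close>, as
      \<open>P 0\<close> is all of \<open>S\<close>; each further degree multiplies both sides by
      \<open>I\<close>.\<close>
    have AR: "P (c + n) \<inter> J \<subseteq> M.scale b (P n)" for n
    proof (induction n)
      case 0 show ?case unfolding P0 J_def by simp
    next
      case (Suc n)
      have "P (c + Suc n) \<inter> J \<subseteq> M.list_smult xs (P (c + n) \<inter> J)" using c by simp
      also have "\<dots> \<subseteq> M.list_smult xs (M.scale b (P n))" by (rule M.list_smult_mono[OF Suc.IH])
      also have "\<dots> = M.scale b (P (Suc n))" unfolding PSuc by (rule M.scale_list_smult[OF P xsR b(1), symmetric])
      finally show ?case .
    qed
    \<comment> \<open>The shift has two sources: \<open>c\<close> from Artin-Rees and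
      \<open>k\<close> from replacing \<open>Q\<close> by \<open>B\<close>. The first inequality
      uses that multiplication by \<open>b\<close> is injective on \<open>S\<close>.\<close>
    have "G n \<le> F (n + (c + k))" for n
    proof -
      let ?n = "c + Suc n"
      have QJ: "M.sm (J \<inter> Q ?n)" "M.sm (J <+>\<^bsub>?M\<^esub> Q ?n)" by (rule M.sm_Int[OF J Q], rule M.sm_set_add[OF J Q])
      have "G n \<le> len (M.scale b (P (Suc n))) J"
        unfolding G_def len_def
      proof (rule rel_length_le_map[where f = "M.scale b"])
        fix U assume "M.sm U" "P (Suc n) \<subseteq> U"
        then show "M.sm (M.scale b U) \<and> M.scale b (P (Suc n)) \<subseteq> M.scale b U"
          using M.sm_scale[OF _ b(1)] by (auto intro: image_mono)
      next
        fix U V assume UV: "U \<subset> V" "V \<subseteq> carrier S"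
        have "M.scale b U \<noteq> M.scale b V"
          using inj_on_image_eq_iff[OF b(3), of U V] UV by auto
        then show "M.scale b U \<subset> M.scale b V" using UV(1) by (auto simp: psubset_eq)
      qed (use smS PS J in \<open>simp_all add: J_def\<close>)
      also have "\<dots> \<le> len (J \<inter> Q ?n) J"
        using AR[of "Suc n"] QP[of ?n] by (intro len_mono QJ bP J order.refl bPJ) auto
      also have "\<dots> = len (Q ?n) (J <+>\<^bsub>?M\<^esub> Q ?n)"
        unfolding len_def by (rule M.rel_length_second_iso[OF J Q, symmetric])
      also have "\<dots> \<le> F (n + (c + k))"
      proof -
        have "B (Suc (n + (c + k))) \<subseteq> Q ?n" using k(1)[of ?n] by (simp add: ac_simps)
        then show ?thesis unfolding F_def
          by (intro len_mono B Q smR QJ M.set_add_upper2[OF J Q] M.set_add_least[OF smR JR QR])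
      qed
      finally show ?thesis .
    qed
    moreover have "F n \<noteq> \<infinity>" for n unfolding F_def by (rule finB)
    ultimately have "int (the_enat (G n)) \<le> int (the_enat (F (n + (c + k)))) + 0" for n
      using the_enat_mono_int by simp
    then show ?thesis by blast
  qed
  then obtain K l where GF: "\<And>n. int (the_enat (G n)) \<le> int (the_enat (F (n + K))) + l" by blast
  \<comment> \<open>An eventually constant \<open>F\<close> makes \<open>B\<close> stationary,
    whence \<open>I^(N+1) \<subseteq> B (N + 1) = B (N + 2 + k) \<subseteq> I^(N+2)\<close> and
    \<open>I^(N+1) = 0\<close> by Nakayama. All of \<open>m\<close> is then nilpotent, against
    positive dimension.\<close>
  have nonconst: "\<not> (\<exists>c. \<forall>\<^sub>F n in sequentially. int (the_enat (F n)) = c)"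
  proof
    assume "\<exists>c. \<forall>\<^sub>F n in sequentially. int (the_enat (F n)) = c"
    then obtain c N where N: "\<And>n. n \<ge> N \<Longrightarrow> int (the_enat (F n)) = c" unfolding eventually_sequentially by blast
    have stab: "B (Suc (Suc n)) = B (Suc n)" if "n \<ge> N" for n
    proof -
      have "F (Suc n) = len (B (Suc (Suc n))) (B (Suc n)) + F n"
        unfolding F_def len_def by (rule M.rel_length_add[OF B B smR Bdec BR])
      moreover have "the_enat (F (Suc n)) = the_enat (F n)" using N[of n] N[of "Suc n"] that by simp
      moreover have "F n \<noteq> \<infinity>" "F (Suc n) \<noteq> \<infinity>" using finB by (simp_all add: F_def)
      ultimately have "len (B (Suc (Suc n))) (B (Suc n)) = 0"
        by (cases "len (B (Suc (Suc n))) (B (Suc n))") (auto simp: zero_enat_def)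
      then show ?thesis unfolding len_def by (rule M.rel_length_eq_0[OF B B Bdec])
    qed
    have stab': "B (Suc N + j) = B (Suc N)" for j
      by (induction j) (use stab in simp_all)
    have "Q (Suc N) \<subseteq> B (Suc N)" by (rule k(2))
    also have "\<dots> = B (Suc (Suc N) + k)" using stab'[of "Suc k"] by simp
    also have "\<dots> \<subseteq> Q (Suc (Suc N))" by (rule k(1))
    also have "\<dots> = M.list_smult xs (Q (Suc N))" by (rule QSuc)
    finally have "Q (Suc N) = {\<zero>\<^bsub>?M\<^esub>}"
      by (intro M.nakayama[OF acc assms(1) Q]) (use xsI Im in auto)
    then have Q0: "Q (Suc N) = {\<zero>\<^bsub>R\<^esub>}" using e(7) by simp
    \<comment> \<open>A prime ideal contains every nilpotent element, hence \<open>m\<close>, and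
      equals it by maximality. Thus no strict chain of two primes exists.\<close>
    have prime: "p = m" if p: "primeideal p R" for p
    proof -
      interpret p: primeideal p R by fact
      have "y \<in> p" if y: "y \<in> m" for y
      proof -
        have yR: "y \<in> carrier R" by (rule ideal.Icarr[OF maximalideal.axioms(1)[OF mm] y])
        obtain t :: nat where "y [^]\<^bsub>R\<^esub> t \<in> Q (Suc N)" using nilp[OF y] by blast
        then have "y [^]\<^bsub>R\<^esub> t \<in> p" using Q0 p.zero_closed by simp
        then show ?thesis
        proof (induction t)
          case 0
          then have "\<one>\<^bsub>R\<^esub> \<in> p" by simp
          then show ?case using p.one_imp_carrier p.I_notcarr by simp
        next
          case (Suc t)
          then have "y [^]\<^bsub>R\<^esub> t \<otimes>\<^bsub>R\<^esub> y \<in> p" by simp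
          then show ?case using p.I_prime[of "y [^]\<^bsub>R\<^esub> t" y] yR Suc.IH by auto
        qed
      qed
      then have "m \<subseteq> p" by auto
      then show "p = m"
        using maximalideal.I_maximal[OF mm p.ideal_axioms] p.a_subset p.I_notcarr by auto
    qed
    have "krull_dim R \<le> enat 0"
      unfolding krull_dim_def
    proof (rule Sup_least)
      fix z assume "z \<in> {enat n | n. \<exists>p :: nat \<Rightarrow> 'a set. (\<forall>i\<le>n. primeideal (p i) R) \<and> (\<forall>i<n. p i \<subset> p (Suc i))}"
      then obtain n and p :: "nat \<Rightarrow> 'a set" where z: "z = enat n" "\<forall>i\<le>n. primeideal (p i) R" "\<forall>i<n. p i \<subset> p (Suc i)" by auto
      have "n = 0"
      proof (rule ccontr)
        assume "n \<noteq> 0"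
        then have "primeideal (p 0) R" "primeideal (p (Suc 0)) R" "p 0 \<subset> p (Suc 0)" using z by auto
        then show False using prime by auto
      qed
      then show "z \<le> enat 0" using z by simp
    qed
    then show False using assms(2,3) by simp
  qed
  have "hilbert_coeff (eventual_poly G) 1 \<le> hilbert_coeff (eventual_poly F) 1"
    using finB finP numF numG FG GF nonconst by (intro e1_compare[of F G]) (simp_all add: F_def G_def)
  then show ?thesis using e1F e1G by simp
qed

end
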